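(* Assume ZF + DC together with the definability axiom, the independence axiom, and the inaccessibility axiom. Then there are no MAD families.
   Context: For a set of ordinals $x$, $\mathrm{OD}_x$ denotes the class of all sets definable (in the universe, by a first-order formula in the language of membership) from $x$ and a finite tuple of ordinals. Finite tuples of sets of ordinals are identified with single sets of ordinals, so e.g. $\mathrm{OD}_{xy}$ is the class of sets definable from $x$, $y$ and finitely many ordinals, and $y_0z$ denotes the pair of $y_0$ and $z$. An "$\mathrm{OD}_x$-set" is a set belonging to $\mathrm{OD}_x$. Definability axiom: every set is definable from a set of ordinals. An independence relation is a ternary class relation $y_0 \mathrel{\perp\!\!\!\perp}_x y_1$ on sets of ordinals such that: (symmetry) $y_0 \mathrel{\perp\!\!\!\perp}_x y_1$ implies $y_1 \mathrel{\perp\!\!\!\perp}_x y_0$; (heredity) if $y_0'\in\mathrm{OD}_{xy_0}$ is a set of ordinals, then $y_0 \mathrel{\perp\!\!\!\perp}_x y_1$ implies $y_0' \mathrel{\perp\!\!\!\perp}_x y_1$; (transitivity) $y_0 \mathrel{\perp\!\!\!\perp}_x y_1$ and $z \mathrel{\perp\!\!\!\perp}_{xy_0} y_1$ imply $y_0z \mathrel{\perp\!\!\!\perp}_x y_1$; (duplication) if $A\in\mathrm{OD}_x$ is a nonempty set of sets of ordinals then there are $y_0,y_1\in A$ with $y_0 \mathrel{\perp\!\!\!\perp}_x y_1$; (product) if $y_0 \mathrel{\perp\!\!\!\perp}_x y_1$, $A\in\mathrm{OD}_x$ and $\langle y_0,y_1\rangle\in A$, then there are $\mathrm{OD}_x$-sets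 $B_0,B_1$ with $y_0\in B_0$, $y_1\in B_1$ such that for all $y_0'\in B_0$, $y_1'\in B_1$, $y_0' \mathrel{\perp\!\!\!\perp}_x y_1'$ implies $\langle y_0',y_1'\rangle\in A$. Independence axiom: there is a class independence relation definable without parameters. Inaccessibility axiom: there is no $\omega_1$-sequence of (distinct) reals, i.e. no injection of $\omega_1$ into $\mathcal{P}(\omega)$. A MAD family is an infinite set $A\subseteq\mathcal{P}(\omega)$ such that any two distinct elements of $A$ have finite intersection, and $A$ is maximal under inclusion with this property.
   Formalization: The members of a MAD family are required to be infinite subsets of ω (and maximality is among such families); with finite members allowed, the finite subsets of ω together with ω itself form a MAD family in ZF. *)

theory Defs
  imports Main
begin

text \<open>
  ZF + DC is rendered semantically: a universe of sets is an arbitrary structure consisting of a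
  type \<open>'a\<close> with a binary relation on it that satisfies the axioms. No well-foundedness
  or standardness of the structure is assumed, so that a statement about all such structures is
  (by soundness and completeness) the statement that the theory proves. Definability
  is Tarskian satisfaction in the structure of formulas of the language of membership.
\<close>

datatype fm = Mem nat nat | Equ nat nat | Neg fm | Conj fm fm | Univ nat fm

primrec fv :: "fm \<Rightarrow> nat set" where
  "fv (Mem i j) = {i, j}"
| "fv (Equ i j) = {i, j}"
| "fv (Neg p) = fv p"
| "fv (Conj p q) = fv p \<union> fv q"
| "fv (Univ i p) = fv p - {i}"

primrec sat :: "('a \<Rightarrow> 'a \<Rightarrow> bool) \<Rightarrow> fm \<Rightarrow> (nat \<Rightarrow> 'a) \<Rightarrow> bool" where
  "sat E (Mem i j) v \<longleftrightarrow> E (v i) (v j)"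
| "sat E (Equ i j) v \<longleftrightarrow> v i = v j"
| "sat E (Neg p) v \<longleftrightarrow> \<not> sat E p v"
| "sat E (Conj p q) v \<longleftrightarrow> sat E p v \<and> sat E q v"
| "sat E (Univ i p) v \<longleftrightarrow> (\<forall>a. sat E p (v(i := a)))"

locale set_structure =
  fixes mem :: "'a \<Rightarrow> 'a \<Rightarrow> bool"  (infix "\<epsilon>" 50)
begin

definition subset :: "'a \<Rightarrow> 'a \<Rightarrow> bool" where
  "subset x y \<longleftrightarrow> (\<forall>z. z \<epsilon> x \<longrightarrow> z \<epsilon> y)"

definition is_empty :: "'a \<Rightarrow> bool" where
  "is_empty x \<longleftrightarrow> (\<forall>z. \<not> z \<epsilon> x)"

definition is_upair :: "'a \<Rightarrow> 'a \<Rightarrow> 'a \<Rightarrow> bool" where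
  "is_upair p a b \<longleftrightarrow> (\<forall>z. z \<epsilon> p \<longleftrightarrow> z = a \<or> z = b)"

definition is_inter :: "'a \<Rightarrow> 'a \<Rightarrow> 'a \<Rightarrow> bool" where
  "is_inter z x y \<longleftrightarrow> (\<forall>u. u \<epsilon> z \<longleftrightarrow> u \<epsilon> x \<and> u \<epsilon> y)"

definition is_power :: "'a \<Rightarrow> 'a \<Rightarrow> bool" where
  "is_power p x \<longleftrightarrow> (\<forall>z. z \<epsilon> p \<longleftrightarrow> subset z x)"

definition is_succ :: "'a \<Rightarrow> 'a \<Rightarrow> bool" where
  "is_succ s x \<longleftrightarrow> (\<forall>z. z \<epsilon> s \<longleftrightarrow> z \<epsilon> x \<or> z = x)"

definition is_pair :: "'a \<Rightarrow> 'a \<Rightarrow> 'a \<Rightarrow> bool" where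
  "is_pair p a b \<longleftrightarrow> (\<forall>z. z \<epsilon> p \<longleftrightarrow> is_upair z a a \<or> is_upair z a b)"

definition pair_in :: "'a \<Rightarrow> 'a \<Rightarrow> 'a \<Rightarrow> bool" where
  "pair_in a b r \<longleftrightarrow> (\<exists>p. p \<epsilon> r \<and> is_pair p a b)"

definition is_function :: "'a \<Rightarrow> 'a \<Rightarrow> 'a \<Rightarrow> bool" where
  "is_function f a b \<longleftrightarrow>
     (\<forall>p. p \<epsilon> f \<longrightarrow> (\<exists>x y. x \<epsilon> a \<and> y \<epsilon> b \<and> is_pair p x y)) \<and>
     (\<forall>x. x \<epsilon> a \<longrightarrow> (\<exists>!y. pair_in x y f))"

definition is_injection :: "'a \<Rightarrow> 'a \<Rightarrow> 'a \<Rightarrow> bool" where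
  "is_injection f a b \<longleftrightarrow> is_function f a b \<and>
     (\<forall>x x' y. pair_in x y f \<and> pair_in x' y f \<longrightarrow> x = x')"

definition is_bijection :: "'a \<Rightarrow> 'a \<Rightarrow> 'a \<Rightarrow> bool" where
  "is_bijection f a b \<longleftrightarrow> is_injection f a b \<and> (\<forall>y. y \<epsilon> b \<longrightarrow> (\<exists>x. pair_in x y f))"

definition is_inductive :: "'a \<Rightarrow> bool" where
  "is_inductive i \<longleftrightarrow> (\<forall>e. is_empty e \<longrightarrow> e \<epsilon> i) \<and>
     (\<forall>x s. x \<epsilon> i \<and> is_succ s x \<longrightarrow> s \<epsilon> i)"

definition is_omega :: "'a \<Rightarrow> bool" where
  "is_omega w \<longleftrightarrow> (\<forall>n. n \<epsilon> w \<longleftrightarrow> (\<forall>i. is_inductive i \<longrightarrow> n \<epsilon> i))"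

text \<open>Finiteness and countability are those of the structure: both the natural numbers and the
  witnessing functions are elements of the universe.\<close>

definition is_finite :: "'a \<Rightarrow> bool" where
  "is_finite x \<longleftrightarrow> (\<exists>w n f. is_omega w \<and> n \<epsilon> w \<and> is_bijection f n x)"

definition is_countable :: "'a \<Rightarrow> bool" where
  "is_countable x \<longleftrightarrow> (\<exists>w f. is_omega w \<and> is_injection f x w)"

definition is_transitive :: "'a \<Rightarrow> bool" where
  "is_transitive x \<longleftrightarrow> (\<forall>y. y \<epsilon> x \<longrightarrow> subset y x)"

text \<open>In the presence of Foundation, ordinals are the transitive sets of transitive sets.\<close>

definition is_ordinal :: "'a \<Rightarrow> bool" where
  "is_ordinal x \<longleftrightarrow> is_transitive x \<and> (\<forall>y. y \<epsilon> x \<longrightarrow> is_transitive y)"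

definition is_omega1 :: "'a \<Rightarrow> bool" where
  "is_omega1 k \<longleftrightarrow> is_ordinal k \<and> \<not> is_countable k \<and> (\<forall>a. a \<epsilon> k \<longrightarrow> is_countable a)"

definition set_of_ordinals :: "'a \<Rightarrow> bool" where
  "set_of_ordinals x \<longleftrightarrow> (\<forall>a. a \<epsilon> x \<longrightarrow> is_ordinal a)"

text \<open>Variable 0 stands for the defined set and variable \<open>Suc i\<close> for the \<open>i\<close>-th parameter. The
  bound on the free variables keeps the unspecified values of \<^term>\<open>(!)\<close> beyond
  the end of the list from acting as additional parameters.\<close>

definition definable_from :: "'a list \<Rightarrow> 'a \<Rightarrow> bool" where
  "definable_from ps z \<longleftrightarrow>
     (\<exists>\<phi>. fv \<phi> \<subseteq> {..length ps} \<and> (\<forall>y. sat (\<epsilon>) \<phi> ((!) (y # ps)) \<longleftrightarrow> y = z))"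

definition OD :: "'a list \<Rightarrow> 'a \<Rightarrow> bool" where
  "OD xs z \<longleftrightarrow> (\<exists>as. (\<forall>a \<in> set as. is_ordinal a) \<and> definable_from (xs @ as) z)"

text \<open>An identification of pairs of sets of ordinals (hence, by iteration, of finite tuples) with
  sets of ordinals: a parameter-free definable injective coding. Values outside
  the sets of ordinals are irrelevant.\<close>

definition pair_coding :: "('a \<Rightarrow> 'a \<Rightarrow> 'a) \<Rightarrow> bool" where
  "pair_coding c \<longleftrightarrow>
     (\<forall>x y. set_of_ordinals x \<and> set_of_ordinals y \<longrightarrow> set_of_ordinals (c x y)) \<and>
     (\<forall>x y x' y'. set_of_ordinals x \<and> set_of_ordinals y \<and>
        set_of_ordinals x' \<and> set_of_ordinals y' \<and> c x y = c x' y' \<longrightarrow> x = x' \<and> y = y') \<and>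
     (\<exists>\<phi>. fv \<phi> \<subseteq> {..<3} \<and> (\<forall>x y z. set_of_ordinals x \<and> set_of_ordinals y \<longrightarrow>
        (sat (\<epsilon>) \<phi> ((!) [x, y, z]) \<longleftrightarrow> z = c x y)))"

text \<open>\<open>R x y0 y1\<close> reads: \<open>y0\<close> and \<open>y1\<close> are independent over \<open>x\<close>.\<close>

definition independence_relation ::
    "('a \<Rightarrow> 'a \<Rightarrow> 'a) \<Rightarrow> ('a \<Rightarrow> 'a \<Rightarrow> 'a \<Rightarrow> bool) \<Rightarrow> bool" where
  "independence_relation c R \<longleftrightarrow>
     (\<forall>x y0 y1. R x y0 y1 \<longrightarrow>
        set_of_ordinals x \<and> set_of_ordinals y0 \<and> set_of_ordinals y1) \<and>
     \<comment> \<open>symmetry\<close>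
     (\<forall>x y0 y1. R x y0 y1 \<longrightarrow> R x y1 y0) \<and>
     \<comment> \<open>heredity\<close>
     (\<forall>x y0 y1 y0'. set_of_ordinals y0' \<and> OD [x, y0] y0' \<and> R x y0 y1 \<longrightarrow> R x y0' y1) \<and>
     \<comment> \<open>transitivity\<close>
     (\<forall>x y0 y1 z. R x y0 y1 \<and> R (c x y0) z y1 \<longrightarrow> R x (c y0 z) y1) \<and>
     \<comment> \<open>duplication\<close>
     (\<forall>x A. set_of_ordinals x \<and> OD [x] A \<and> (\<exists>y. y \<epsilon> A) \<and>
        (\<forall>y. y \<epsilon> A \<longrightarrow> set_of_ordinals y) \<longrightarrow>
        (\<exists>y0 y1. y0 \<epsilon> A \<and> y1 \<epsilon> A \<and> R x y0 y1)) \<and>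
     \<comment> \<open>product\<close>
     (\<forall>x y0 y1 A. R x y0 y1 \<and> OD [x] A \<and> pair_in y0 y1 A \<longrightarrow>
        (\<exists>B0 B1. OD [x] B0 \<and> OD [x] B1 \<and> y0 \<epsilon> B0 \<and> y1 \<epsilon> B1 \<and>
           (\<forall>y0' y1'. y0' \<epsilon> B0 \<and> y1' \<epsilon> B1 \<and> R x y0' y1' \<longrightarrow> pair_in y0' y1' A)))"

definition definability_axiom :: bool where
  "definability_axiom \<longleftrightarrow> (\<forall>z. \<exists>x. set_of_ordinals x \<and> definable_from [x] z)"

definition independence_axiom :: "('a \<Rightarrow> 'a \<Rightarrow> 'a) \<Rightarrow> bool" where
  "independence_axiom c \<longleftrightarrow>
     (\<exists>\<phi>. fv \<phi> \<subseteq> {..<3} \<and> independence_relation c (\<lambda>x y0 y1. sat (\<epsilon>) \<phi> ((!) [x, y0, y1])))"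

definition inaccessibility_axiom :: bool where
  "inaccessibility_axiom \<longleftrightarrow>
     \<not> (\<exists>k w p f. is_omega1 k \<and> is_omega w \<and> is_power p w \<and> is_injection f k p)"

text \<open>As usual, the members of an almost disjoint family are infinite subsets of \<open>\<omega>\<close>. If finite
  members were allowed, the finite subsets of \<open>\<omega>\<close> together with \<open>\<omega>\<close> itself would form
  an infinite maximal family in every model of ZF.\<close>

definition almost_disjoint_family :: "'a \<Rightarrow> bool" where
  "almost_disjoint_family A \<longleftrightarrow>
     \<not> is_finite A \<and>
     (\<exists>w. is_omega w \<and> (\<forall>a. a \<epsilon> A \<longrightarrow> subset a w \<and> \<not> is_finite a)) \<and>
     (\<forall>a b z. a \<epsilon> A \<and> b \<epsilon> A \<and> a \<noteq> b \<and> is_inter z a b \<longrightarrow> is_finite z)"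

definition MAD_family :: "'a \<Rightarrow> bool" where
  "MAD_family A \<longleftrightarrow> almost_disjoint_family A \<and>
     (\<forall>B. almost_disjoint_family B \<and> subset A B \<longrightarrow> B = A)"

end

text \<open>In the two schemata the assignment \<open>v\<close> supplies arbitrary parameters. Full Separation is
  stated although it follows from this form of Replacement.\<close>

locale ZF = set_structure +
  assumes extensionality: "(\<forall>z. z \<epsilon> x \<longleftrightarrow> z \<epsilon> y) \<Longrightarrow> x = y"
    and foundation: "(\<exists>y. y \<epsilon> x) \<Longrightarrow> \<exists>y. y \<epsilon> x \<and> \<not> (\<exists>z. z \<epsilon> x \<and> z \<epsilon> y)"
    and pairing: "\<exists>p. is_upair p x y"
    and union: "\<exists>u. \<forall>z. z \<epsilon> u \<longleftrightarrow> (\<exists>y. y \<epsilon> x \<and> z \<epsilon> y)"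
    and power_set: "\<exists>p. is_power p x"
    and infinity: "\<exists>i. is_inductive i"
    and separation: "\<exists>b. \<forall>x. x \<epsilon> b \<longleftrightarrow> x \<epsilon> a \<and> sat (\<epsilon>) \<phi> (v(0 := x))"
    and replacement:
      "(\<forall>x y y'. x \<epsilon> a \<and> sat (\<epsilon>) \<phi> (v(0 := x, 1 := y)) \<and> sat (\<epsilon>) \<phi> (v(0 := x, 1 := y'))
          \<longrightarrow> y = y') \<Longrightarrow>
       \<exists>b. \<forall>y. y \<epsilon> b \<longleftrightarrow> (\<exists>x. x \<epsilon> a \<and> sat (\<epsilon>) \<phi> (v(0 := x, 1 := y)))"

locale ZF_DC = ZF +
  assumes dependent_choice:
    "(\<exists>x. x \<epsilon> A) \<Longrightarrow> (\<forall>x. x \<epsilon> A \<longrightarrow> (\<exists>y. y \<epsilon> A \<and> pair_in x y r)) \<Longrightarrow>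
     \<exists>w f. is_omega w \<and> is_function f w A \<and>
       (\<forall>n m x y. n \<epsilon> w \<and> is_succ m n \<and> pair_in n x f \<and> pair_in m y f \<longrightarrow> pair_in x y r)"

end

theory Submission imports Defs begin

text \<open>Let \<open>A\<close> be a MAD family, definable from the set of ordinals \<open>x\<close>. By reflection, the sets in
  \<open>OD [x]\<close> carry a well-order definable from \<open>x\<close>. Along it, choose greedily a maximal family
  \<open>D\<close> of \<open>OD [x]\<close> subsets of \<open>\<omega>\<close> contained in a proper ideal that also contains every set
  meeting all but finitely many members of \<open>A\<close> finitely. Then \<open>D\<close> is itself in \<open>OD [x]\<close>, and it is
  enumerated injectively along an ordinal, which is countable by inaccessibility. Hence some
  infinite \<open>z \<subseteq> \<omega>\<close> is almost disjoint from all members of \<open>D\<close>, and by maximality of \<open>A\<close> the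
  set \<open>X\<close> of those \<open>a \<in> A\<close> not contained in a member of \<open>D\<close> is nonempty. Duplication yields
  independent \<open>a\<^sub>0, a\<^sub>1 \<in> X\<close>. If \<open>a\<^sub>0 = a\<^sub>1\<close>, then \<open>a\<^sub>0\<close> is in \<open>OD [x]\<close>, hence in \<open>D\<close>. Otherwise
  the product axiom gives \<open>OD [x]\<close> sets \<open>B\<^sub>0\<close>, \<open>B\<^sub>1\<close> whose independent members are almost
  disjoint with a common bound. Since any two nonempty \<open>OD [x]\<close> sets have independent members,
  the unions \<open>u\<^sub>0 \<supseteq> a\<^sub>0\<close> and \<open>u\<^sub>1 \<supseteq> a\<^sub>1\<close> of \<open>B\<^sub>0\<close> and \<open>B\<^sub>1\<close> are almost disjoint \<open>OD [x]\<close> sets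
  outside \<open>D\<close>, so neither can be added to \<open>D\<close>: each covers \<open>\<omega>\<close> together with a member
  of the ideal. Then \<open>\<omega>\<close> lies in the ideal, a contradiction.\<close>

section \<open>Definability by formulas with parameters\<close>

text \<open>The structure need not be well-founded from outside, so induction, recursion and
  collection apply only to predicates given by a formula. Every such use carries a certificate
  \<open>dfn\<close>, and much of the development derives these certificates. A second obstacle is
  that truth in the universe is not definable, so the class of OD sets cannot be handled through its
  own definition. Finally, no ideal is selected while the greedy family grows. Each stage only asks
  that some ideal exists, and the ideal at the end is the union over all stages of the intersections
  of the witnesses, together with the small sets. Infinity of the MAD family keeps the ideal of
  small sets proper.\<close>

lemma finite_fv: "finite (fv \<phi>)"
  by (induction \<phi>) auto

lemma sat_cong: "(\<And>i. i \<in> fv \<phi> \<Longrightarrow> v i = w i) \<Longrightarrow> sat E \<phi> v \<longleftrightarrow> sat E \<phi> w"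
proof (induction \<phi> arbitrary: v w)
  case (Conj p q)
  have "sat E p v \<longleftrightarrow> sat E p w" "sat E q v \<longleftrightarrow> sat E q w"
    by (rule Conj.IH, simp add: Conj.prems)+
  then show ?case by simp
next
  case (Univ i p)
  have "sat E p (v(i := a)) \<longleftrightarrow> sat E p (w(i := a))" for a
    by (rule Univ.IH) (simp add: Univ.prems)
  then show ?case by simp
next
  case (Neg p)
  have "sat E p v \<longleftrightarrow> sat E p w" by (rule Neg.IH) (simp add: Neg.prems)
  then show ?case by simp
qed auto

lemma sat_rename:
  "\<exists>\<psi>. fv \<psi> \<subseteq> f ` fv \<phi> \<and> (\<forall>v. sat E \<psi> v \<longleftrightarrow> sat E \<phi> (\<lambda>i. v (f i)))"
proof (induction \<phi> arbitrary: f)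
  case (Mem i j)
  show ?case by (rule exI[of _ "Mem (f i) (f j)"]) auto
next
  case (Equ i j)
  show ?case by (rule exI[of _ "Equ (f i) (f j)"]) auto
next
  case (Neg p)
  obtain \<psi> where "fv \<psi> \<subseteq> f ` fv p" "\<forall>v. sat E \<psi> v \<longleftrightarrow> sat E p (\<lambda>i. v (f i))"
    using Neg[of f] by blast
  then show ?case by (intro exI[of _ "Neg \<psi>"]) auto
next
  case (Conj p q)
  obtain \<psi> where "fv \<psi> \<subseteq> f ` fv p" "\<forall>v. sat E \<psi> v \<longleftrightarrow> sat E p (\<lambda>i. v (f i))"
    using Conj(1)[of f] by blast
  moreover obtain \<chi> where "fv \<chi> \<subseteq> f ` fv q" "\<forall>v. sat E \<chi> v \<longleftrightarrow> sat E q (\<lambda>i. v (f i))"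
    using Conj(2)[of f] by blast
  ultimately show ?case by (intro exI[of _ "Conj \<psi> \<chi>"]) auto
next
  case (Univ i p)
  \<comment> \<open>\<open>f\<close> need not be injective, so the bound variable goes to a variable
    outside the image to avoid capture.\<close>
  obtain m where m: "m \<notin> f ` fv p"
    using ex_new_if_finite[OF infinite_UNIV_nat finite_imageI[OF finite_fv, of f p]] by blast
  obtain \<psi> where \<psi>: "fv \<psi> \<subseteq> (f(i := m)) ` fv p"
    "\<And>v. sat E \<psi> v \<longleftrightarrow> sat E p (\<lambda>j. v ((f(i := m)) j))"
    using Univ[of "f(i := m)"] by blast
  have "sat E (Univ m \<psi>) v \<longleftrightarrow> sat E (Univ i p) (\<lambda>j. v (f j))" for v
  proof -
    have "sat E p (\<lambda>j. (v(m := a)) ((f(i := m)) j)) \<longleftrightarrow> sat E p ((\<lambda>j. v (f j))(i := a))" for a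
      by (rule sat_cong) (use m in auto)
    then show ?thesis by (simp add: \<psi>(2) del: fun_upd_apply)
  qed
  moreover have "fv (Univ m \<psi>) \<subseteq> f ` fv (Univ i p)"
    using \<psi>(1) by (auto split: if_splits)
  ultimately show ?case by blast
qed

context set_structure
begin

definition env :: "'a list \<Rightarrow> (nat \<Rightarrow> 'a) \<Rightarrow> nat \<Rightarrow> 'a" where
  "env ps v i = (if i < length ps then ps ! i else v (i - length ps))"

text \<open>A shallow embedding: \<open>Q\<close> is a HOL predicate whose open variables are the
  entries of \<open>v\<close>, while \<open>ps\<close> fills the first slots of the assignment. Such
  certificates compose without handling formulas themselves.\<close>

definition dfn :: "'a list \<Rightarrow> ((nat \<Rightarrow> 'a) \<Rightarrow> bool) \<Rightarrow> bool" where
  "dfn ps Q \<longleftrightarrow> (\<exists>\<phi>. \<forall>v. Q v \<longleftrightarrow> sat (\<epsilon>) \<phi> (env ps v))"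

text \<open>A term enters through its graph: slot 0 holds the value and the arguments move up by
  one. In this way HOL functions such as pairing may occur in formulas of a language without
  function symbols.\<close>

definition dft :: "'a list \<Rightarrow> ((nat \<Rightarrow> 'a) \<Rightarrow> 'a) \<Rightarrow> bool" where
  "dft ps t \<longleftrightarrow> dfn ps (\<lambda>v. v 0 = t (\<lambda>i. v (Suc i)))"

lemma dfn_reparam:
  assumes "dfn ps Q" and "\<And>v. env ps (g v) = (\<lambda>i. env qs v (f i))"
  shows "dfn qs (\<lambda>v. Q (g v))"
proof -
  obtain \<phi> where \<phi>: "\<And>v. Q v \<longleftrightarrow> sat (\<epsilon>) \<phi> (env ps v)"
    using assms(1) unfolding dfn_def by blast
  obtain \<psi> where "\<And>v. sat (\<epsilon>) \<psi> v \<longleftrightarrow> sat (\<epsilon>) \<phi> (\<lambda>i. v (f i))"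
    using sat_rename by blast
  then show ?thesis unfolding dfn_def by (intro exI[of _ \<psi>]) (simp add: \<phi> assms(2))
qed

lemma dfn_rename: "dfn ps Q \<Longrightarrow> dfn ps (\<lambda>v. Q (\<lambda>i. v (f i)))"
  by (rule dfn_reparam[where f = "\<lambda>i. if i < length ps then i else length ps + f (i - length ps)"])
    (auto simp: env_def)

lemma dfn_mono:
  assumes "dfn ps Q" and "set ps \<subseteq> set qs"
  shows "dfn qs Q"
proof -
  have "\<exists>j < length qs. qs ! j = ps ! i" if "i < length ps" for i
    using assms(2) that by (metis in_set_conv_nth nth_mem subsetD)
  then obtain f where "\<And>i. i < length ps \<Longrightarrow> f i < length qs \<and> qs ! f i = ps ! i"
    by metis
  note f = this
  have "env ps v = (\<lambda>i. env qs v (if i < length ps then f i else length qs + (i - length ps)))" for v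
  proof
    fix i
    show "env ps v i = env qs v (if i < length ps then f i else length qs + (i - length ps))"
      using f[of i] by (cases "i < length ps") (simp_all only: env_def if_True if_False not_add_less1 add_diff_cancel_left')
  qed
  then show ?thesis
    by (rule dfn_reparam[OF assms(1)])
qed

text \<open>Turns a parameter into an open variable. This is needed to quantify a parameter away,
  either because it is itself definable or because it is to be replaced by a least ordinal.\<close>

lemma dfn_abs:
  assumes "dfn (c # ps) Q"
  obtains Q' where "dfn ps (\<lambda>v. Q' (v 0) (\<lambda>i. v (Suc i)))" "\<And>v. Q' c v \<longleftrightarrow> Q v"
proof -
  obtain \<phi> where \<phi>: "\<And>v. Q v \<longleftrightarrow> sat (\<epsilon>) \<phi> (env (c # ps) v)"
    using assms(1) unfolding dfn_def by blast
  \<comment> \<open>The parameter in slot 0 moves behind the remaining parameters, where it becomes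
    the first open variable; slots beyond it stay in place.\<close>
  define f where "f i = (if i = 0 then length ps else if i \<le> length ps then i - 1 else i)" for i
  obtain \<psi> where \<psi>: "\<And>v. sat (\<epsilon>) \<psi> v \<longleftrightarrow> sat (\<epsilon>) \<phi> (\<lambda>i. v (f i))"
    using sat_rename by blast
  have "env (v 0 # ps) (\<lambda>i. v (Suc i)) = (\<lambda>i. env ps v (f i))" for v
    by (auto simp: env_def f_def nth_Cons' Suc_diff_Suc fun_eq_iff)
  then have "dfn ps (\<lambda>v. sat (\<epsilon>) \<phi> (env (v 0 # ps) (\<lambda>i. v (Suc i))))"
    unfolding dfn_def by (intro exI[of _ \<psi>]) (simp add: \<psi>)
  then show thesis
    by (intro that[of "\<lambda>y v. sat (\<epsilon>) \<phi> (env (y # ps) v)"]) (simp_all add: \<phi>)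
qed

lemma dfn_not: "dfn ps P \<Longrightarrow> dfn ps (\<lambda>v. \<not> P v)"
  unfolding dfn_def by (elim exE, rule_tac x = "Neg \<phi>" in exI) simp

lemma dfn_conj: "dfn ps P \<Longrightarrow> dfn ps Q \<Longrightarrow> dfn ps (\<lambda>v. P v \<and> Q v)"
  unfolding dfn_def by (elim exE, rule_tac x = "Conj \<phi> \<phi>'" in exI) simp

lemma dfn_disj:
  assumes "dfn ps P" "dfn ps Q"
  shows "dfn ps (\<lambda>v. P v \<or> Q v)"
proof -
  have "dfn ps (\<lambda>v. \<not> (\<not> P v \<and> \<not> Q v))" by (intro dfn_not dfn_conj assms)
  then show ?thesis by simp
qed

lemma dfn_imp:
  assumes "dfn ps P" "dfn ps Q"
  shows "dfn ps (\<lambda>v. P v \<longrightarrow> Q v)"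
  using dfn_disj[OF dfn_not[OF assms(1)] assms(2)] by (simp only: imp_conv_disj)

lemma dfn_iff:
  assumes "dfn ps P" "dfn ps Q"
  shows "dfn ps (\<lambda>v. P v \<longleftrightarrow> Q v)"
  using dfn_conj[OF dfn_imp[OF assms] dfn_imp[OF assms(2,1)]] by (simp only: iff_conv_conj_imp)

lemma dfn_bool: "dfn ps (\<lambda>v. b)"
proof (cases b)
  case True
  then show ?thesis unfolding dfn_def by (intro exI[of _ "Equ 0 0"]) simp
next
  case False
  then show ?thesis unfolding dfn_def by (intro exI[of _ "Neg (Equ 0 0)"]) simp
qed

lemma dfn_all:
  assumes "dfn ps (\<lambda>v. Q (v 0) (\<lambda>i. v (Suc i)))"
  shows "dfn ps (\<lambda>v. \<forall>a. Q a v)"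
proof -
  obtain \<phi> where \<phi>: "\<And>v. Q (v 0) (\<lambda>i. v (Suc i)) \<longleftrightarrow> sat (\<epsilon>) \<phi> (env ps v)"
    using assms unfolding dfn_def by blast
  let ?n = "length ps"
  \<comment> \<open>The quantified slot \<open>?n\<close> lies between the parameters and the other
    open variables. It is sent to \<open>m\<close>, beyond every slot in use, and later slots move
    down to close the gap.\<close>
  define m where "m = Suc (Max (insert ?n (fv \<phi>)))"
  have m: "i < m" if "i \<in> fv \<phi>" for i
    unfolding m_def using that by (simp add: finite_fv le_imp_less_Suc)
  have mn: "?n < m" unfolding m_def by (simp add: finite_fv le_imp_less_Suc)
  define f where "f i = (if i < ?n then i else if i = ?n then m else i - 1)" for i
  obtain \<psi> where \<psi>: "\<And>v. sat (\<epsilon>) \<psi> v \<longleftrightarrow> sat (\<epsilon>) \<phi> (\<lambda>i. v (f i))"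
    using sat_rename by blast
  have "(\<forall>a. Q a v) \<longleftrightarrow> sat (\<epsilon>) (Univ m \<psi>) (env ps v)" for v
  proof -
    have "Q a v \<longleftrightarrow> sat (\<epsilon>) \<psi> ((env ps v)(m := a))" for a
    proof -
      have "sat (\<epsilon>) \<phi> (env ps (case_nat a v)) \<longleftrightarrow>
          sat (\<epsilon>) \<phi> (\<lambda>i. ((env ps v)(m := a)) (f i))"
      proof (rule sat_cong)
        fix i assume "i \<in> fv \<phi>"
        then have "i < m" by (rule m)
        then show "env ps (case_nat a v) i = ((env ps v)(m := a)) (f i)"
          using mn by (cases "i - ?n") (auto simp: env_def f_def intro: arg_cong[of _ _ v])
      qed
      then show ?thesis using \<phi>[of "case_nat a v"] by (simp add: \<psi>)
    qed
    then show ?thesis by simp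
  qed
  then show ?thesis unfolding dfn_def by blast
qed

lemma dfn_ex:
  assumes "dfn ps (\<lambda>v. Q (v 0) (\<lambda>i. v (Suc i)))"
  shows "dfn ps (\<lambda>v. \<exists>a. Q a v)"
proof -
  have "dfn ps (\<lambda>v. \<not> (\<forall>a. \<not> Q a v))" by (rule dfn_not[OF dfn_all[OF dfn_not[OF assms]]])
  then show ?thesis by simp
qed

lemma dft_var: "dft ps (\<lambda>v. v i)"
  unfolding dft_def dfn_def
  by (rule exI[of _ "Equ (length ps) (length ps + Suc i)"]) (simp add: env_def)

lemma dft_const:
  assumes "c \<in> set ps"
  shows "dft ps (\<lambda>v. c)"
proof -
  obtain k where "k < length ps" "ps ! k = c" using assms by (metis in_set_conv_nth)
  then show ?thesis unfolding dft_def dfn_def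
    by (intro exI[of _ "Equ (length ps) k"]) (simp add: env_def)
qed

lemma dft_shift: "dft ps t \<Longrightarrow> dft ps (\<lambda>v. t (\<lambda>i. v (Suc i)))"
  unfolding dft_def
  by (drule dfn_rename[where f = "\<lambda>i. case i of 0 \<Rightarrow> 0 | Suc j \<Rightarrow> Suc (Suc j)"]) simp

text \<open>A term is removed by naming its value with a bound variable.\<close>

lemma dfn_subst:
  assumes "dfn ps (\<lambda>v. P (v 0) (\<lambda>i. v (Suc i)))" and "dft ps t"
  shows "dfn ps (\<lambda>v. P (t v) v)"
proof -
  have "dfn ps (\<lambda>v. \<exists>y. y = t v \<and> P y v)"
    by (rule dfn_ex, rule dfn_conj[OF assms(2)[unfolded dft_def] assms(1)])
  then show ?thesis by simp
qed

text \<open>The family \<open>T\<close> is infinite, but a formula has finitely many free variables,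
  so finitely many replacements, made one at a time, suffice.\<close>

lemma dfn_comp:
  assumes Q: "dfn ps Q" and T: "\<And>i. dft ps (T i)"
  shows "dfn ps (\<lambda>v. Q (\<lambda>i. T i v))"
proof -
  obtain \<phi> where \<phi>: "\<And>v. Q v \<longleftrightarrow> sat (\<epsilon>) \<phi> (env ps v)"
    using Q unfolding dfn_def by blast
  obtain n where n: "\<And>i. i \<in> fv \<phi> \<Longrightarrow> i < n"
    using finite_fv[of \<phi>] by (meson finite_nat_set_iff_bounded)
  \<comment> \<open>The substitution is simultaneous: even variables feed the terms, odd ones the open slots.\<close>
  have "dfn ps (\<lambda>v. Q (\<lambda>i. if i < k then T i (\<lambda>j. v (2 * j)) else v (2 * i + 1)))" for k
  proof (induction k)
    case 0
    show ?case using dfn_rename[OF Q, of "\<lambda>i. 2 * i + 1"] by simp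
  next
    case (Suc k)
    define R where "R v = Q (\<lambda>i. if i < k then T i (\<lambda>j. v (2 * j)) else v (2 * i + 1))" for v
    have R: "dfn ps R" unfolding R_def by (rule Suc)
    have "dft ps (\<lambda>v. T k (\<lambda>j. v (2 * j)))"
      using dfn_rename[OF T[of k, unfolded dft_def], of "\<lambda>i. if i = 0 then 0 else 2 * i - 1"]
      unfolding dft_def by simp
    moreover have "dfn ps (\<lambda>v. R ((\<lambda>i. v (Suc i))(2 * k + 1 := v 0)))"
      using dfn_rename[OF R, of "\<lambda>i. if i = 2 * k + 1 then 0 else Suc i"]
      by (simp add: fun_upd_def if_distrib[of v for v] cong: if_cong)
    ultimately have "dfn ps (\<lambda>v. R (v(2 * k + 1 := T k (\<lambda>j. v (2 * j)))))"
      by (intro dfn_subst[where P = "\<lambda>y v. R (v(2 * k + 1 := y))"])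
    moreover have "R (v(2 * k + 1 := T k (\<lambda>j. v (2 * j)))) \<longleftrightarrow>
        Q (\<lambda>i. if i < Suc k then T i (\<lambda>j. v (2 * j)) else v (2 * i + 1))" for v
      unfolding R_def
    proof (rule arg_cong[of _ _ Q], rule ext)
      have "2 * j \<noteq> 2 * k + 1" for j :: nat by presburger
      then have *: "(\<lambda>j. (v(2 * k + 1 := y)) (2 * j)) = (\<lambda>j. v (2 * j))" for y
        by simp
      show "(if i < k then T i (\<lambda>j. (v(2 * k + 1 := T k (\<lambda>j. v (2 * j)))) (2 * j))
          else (v(2 * k + 1 := T k (\<lambda>j. v (2 * j)))) (2 * i + 1)) =
        (if i < Suc k then T i (\<lambda>j. v (2 * j)) else v (2 * i + 1))" for i
        unfolding * by (auto simp: less_Suc_eq)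
    qed
    ultimately show ?case by simp
  qed
  \<comment> \<open>Halving the indices merges the even and odd copies into the single assignment
    \<open>v\<close>.\<close>
  note * = dfn_rename[OF this[of n], of "\<lambda>i. i div 2"]
  have "2 * j div 2 = j" "(2 * j + 1) div 2 = j" for j :: nat by simp_all
  with * have "dfn ps (\<lambda>v. Q (\<lambda>i. if i < n then T i v else v i))" by (simp only:)
  moreover have "Q (\<lambda>i. if i < n then T i v else v i) \<longleftrightarrow> Q (\<lambda>i. T i v)" for v
    unfolding \<phi> by (rule sat_cong) (auto simp: env_def dest!: n)
  ultimately show ?thesis by simp
qed

lemma dfn_subst1:
  "dfn ps (\<lambda>v. P (v 0)) \<Longrightarrow> dft ps t \<Longrightarrow> dfn ps (\<lambda>v. P (t v))"
  by (rule dfn_subst)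

lemma dfn_subst2:
  "dfn ps (\<lambda>v. P (v 0) (v 1)) \<Longrightarrow> dft ps t \<Longrightarrow> dft ps s \<Longrightarrow> dfn ps (\<lambda>v. P (t v) (s v))"
  by (drule dfn_comp[where T = "\<lambda>i. if i = 0 then t else s"]) auto

lemma dfn_subst3:
  "dfn ps (\<lambda>v. P (v 0) (v 1) (v 2)) \<Longrightarrow> dft ps t \<Longrightarrow> dft ps s \<Longrightarrow> dft ps u \<Longrightarrow>
    dfn ps (\<lambda>v. P (t v) (s v) (u v))"
  by (drule dfn_comp[where T = "\<lambda>i. if i = 0 then t else if i = 1 then s else u"]) auto

text \<open>Six is the number of arguments of the step relations behind the greedy enumerations: a
  parameter, the history, three ordinals and the value.\<close>

lemma dfn_subst6:
  "dfn ps (\<lambda>v. P (v 0) (v 1) (v 2) (v 3) (v 4) (v 5)) \<Longrightarrow>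
    dft ps t \<Longrightarrow> dft ps s \<Longrightarrow> dft ps u \<Longrightarrow> dft ps r \<Longrightarrow> dft ps q \<Longrightarrow> dft ps p \<Longrightarrow>
    dfn ps (\<lambda>v. P (t v) (s v) (u v) (r v) (q v) (p v))"
  by (drule dfn_comp[where T = "\<lambda>i. if i = 0 then t else if i = 1 then s else
      if i = 2 then u else if i = 3 then r else if i = 4 then q else p"]) auto

lemma dft_fun1:
  assumes "dfn ps (\<lambda>v. v 0 = f (v 1))" and "dft ps t"
  shows "dft ps (\<lambda>v. f (t v))"
  unfolding dft_def
  by (rule dfn_subst2[where P = "\<lambda>x y. x = f y", OF assms(1) dft_var dft_shift[OF assms(2)]])

lemma dft_fun2:
  assumes "dfn ps (\<lambda>v. v 0 = f (v 1) (v 2))" and "dft ps t" "dft ps s"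
  shows "dft ps (\<lambda>v. f (t v) (s v))"
  unfolding dft_def
  by (rule dfn_subst3[where P = "\<lambda>x y z. x = f y z",
        OF assms(1) dft_var dft_shift[OF assms(2)] dft_shift[OF assms(3)]])

text \<open>The rules \<open>dfn_intros\<close> show by recursion on its syntax that a HOL predicate on assignments is
  expressed by a formula; a bound variable becomes \<open>v 0\<close>, which shifts the others.\<close>

named_theorems dfn_intros

lemma dfn_mem0: "dfn ps (\<lambda>v. v i \<epsilon> v j)"
  unfolding dfn_def by (rule exI[of _ "Mem (length ps + i) (length ps + j)"]) (simp add: env_def)

lemma dfn_eq0: "dfn ps (\<lambda>v. v i = v j)"
  unfolding dfn_def by (rule exI[of _ "Equ (length ps + i) (length ps + j)"]) (simp add: env_def)

lemma dfn_mem: "dft ps s \<Longrightarrow> dft ps t \<Longrightarrow> dfn ps (\<lambda>v. s v \<epsilon> t v)"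
  by (rule dfn_subst2[where P = "\<lambda>x y. x \<epsilon> y", OF dfn_mem0])

lemma dfn_eq: "dft ps s \<Longrightarrow> dft ps t \<Longrightarrow> dfn ps (\<lambda>v. s v = t v)"
  by (rule dfn_subst2[where P = "(=)", OF dfn_eq0])

lemma dfn_ex1:
  assumes "dfn ps (\<lambda>v. Q (v 0) (\<lambda>i. v (Suc i)))"
  shows "dfn ps (\<lambda>v. \<exists>!a. Q a v)"
proof -
  have 1: "dfn ps (\<lambda>v. Q (v 0) (\<lambda>i. v (Suc (Suc i))))"
    using dfn_rename[OF assms, of "\<lambda>i. case i of 0 \<Rightarrow> 0 | Suc j \<Rightarrow> Suc (Suc j)"] by simp
  show ?thesis unfolding Ex1_def
    by (rule dfn_ex, rule dfn_conj[OF assms], rule dfn_all, rule dfn_imp[OF 1 dfn_eq0])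
qed

lemmas [dfn_intros] = dfn_mem dfn_eq dft_var dfn_all dfn_ex dfn_ex1 dfn_not dfn_conj
  dfn_disj dfn_imp dfn_iff

section \<open>Definability from lists and the class of OD sets\<close>

lemma definable_fromE:
  assumes "definable_from ps z"
  obtains P where "dfn ps (\<lambda>v. P (v 0))" "\<And>y. P y \<longleftrightarrow> y = z"
proof -
  obtain \<phi> where \<phi>: "fv \<phi> \<subseteq> {..length ps}" "\<And>y. sat (\<epsilon>) \<phi> ((!) (y # ps)) \<longleftrightarrow> y = z"
    using assms unfolding definable_from_def by blast
  \<comment> \<open>\<open>definable_from\<close> places the defined set before the parameters,
    \<open>env\<close> places it after them.\<close>
  define f where "f i = (case i of 0 \<Rightarrow> length ps | Suc j \<Rightarrow> j)" for i
  obtain \<psi> where \<psi>: "\<And>v. sat (\<epsilon>) \<psi> v \<longleftrightarrow> sat (\<epsilon>) \<phi> (\<lambda>i. v (f i))"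
    using sat_rename by blast
  have "sat (\<epsilon>) \<phi> ((!) (v 0 # ps)) \<longleftrightarrow> sat (\<epsilon>) \<psi> (env ps v)" for v
    unfolding \<psi>
    by (rule sat_cong) (use \<phi>(1) in \<open>auto simp: env_def f_def nth_Cons split: nat.split\<close>)
  then have "dfn ps (\<lambda>v. sat (\<epsilon>) \<phi> ((!) (v 0 # ps)))"
    unfolding dfn_def by blast
  then show thesis by (rule that) (rule \<phi>(2))
qed

lemma definable_fromI:
  assumes "dfn ps (\<lambda>v. P (v 0))" "\<And>y. P y \<longleftrightarrow> y = z"
  shows "definable_from ps z"
proof -
  obtain \<phi> where \<phi>: "\<And>v. P (v 0) \<longleftrightarrow> sat (\<epsilon>) \<phi> (env ps v)"
    using assms(1) unfolding dfn_def by blast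
  \<comment> \<open>All open variables collapse to slot 0: the formula may mention several, but
    \<open>P\<close> looks only at \<open>v 0\<close>.\<close>
  define f where "f i = (if i < length ps then Suc i else 0)" for i
  obtain \<psi> where \<psi>: "fv \<psi> \<subseteq> f ` fv \<phi>" "\<And>v. sat (\<epsilon>) \<psi> v \<longleftrightarrow> sat (\<epsilon>) \<phi> (\<lambda>i. v (f i))"
    using sat_rename by blast
  have "sat (\<epsilon>) \<psi> ((!) (y # ps)) \<longleftrightarrow> y = z" for y
  proof -
    have "(\<lambda>i. (y # ps) ! f i) = env ps (\<lambda>_. y)"
      by (auto simp: env_def f_def)
    then show ?thesis using \<phi>[of "\<lambda>_. y"] assms(2) by (simp add: \<psi>(2))
  qed
  moreover have "fv \<psi> \<subseteq> {..length ps}" using \<psi>(1) by (auto simp: f_def split: if_splits)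
  ultimately show ?thesis unfolding definable_from_def by blast
qed

text \<open>Each parameter is replaced by its own definition over \<open>xs\<close>; the list
  \<open>as\<close> gathers the ordinals that these definitions use.\<close>

lemma dfn_OD_parameters:
  assumes "\<And>p. p \<in> set ps \<Longrightarrow> OD xs p"
  obtains as where "\<And>a. a \<in> set as \<Longrightarrow> is_ordinal a" "\<And>Q. dfn ps Q \<Longrightarrow> dfn (xs @ as) Q"
proof -
  have "\<exists>as. (\<forall>a\<in>set as. is_ordinal a) \<and> (\<forall>Q. dfn ps Q \<longrightarrow> dfn (xs @ as) Q)"
    using assms
  proof (induction ps)
    case Nil
    show ?case by (intro exI[of _ "[]"]) (auto elim: dfn_mono)
  next
    case (Cons p ps)
    then obtain as where as: "\<forall>a\<in>set as. is_ordinal a" "\<And>Q. dfn ps Q \<Longrightarrow> dfn (xs @ as) Q"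
      by auto
    obtain bs where bs: "\<forall>a\<in>set bs. is_ordinal a" "definable_from (xs @ bs) p"
      using Cons.prems[of p] unfolding OD_def by auto
    obtain P where P: "dfn (xs @ bs) (\<lambda>v. P (v 0))" "\<And>y. P y \<longleftrightarrow> y = p"
      using definable_fromE[OF bs(2)] by blast
    have "dfn (xs @ as @ bs) Q" if Q: "dfn (p # ps) Q" for Q
    proof -
      obtain Q' where Q': "dfn ps (\<lambda>v. Q' (v 0) (\<lambda>i. v (Suc i)))" "\<And>v. Q' p v \<longleftrightarrow> Q v"
        using dfn_abs[OF Q] by blast
      have "dfn (xs @ as @ bs) (\<lambda>v. Q' (v 0) (\<lambda>i. v (Suc i)))"
        by (rule dfn_mono[OF as(2)[OF Q'(1)]]) auto
      moreover have "dfn (xs @ as @ bs) (\<lambda>v. P (v 0))"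
        by (rule dfn_mono[OF P(1)]) auto
      ultimately have "dfn (xs @ as @ bs) (\<lambda>v. \<exists>y. P y \<and> Q' y v)"
        by (intro dfn_ex dfn_conj)
      then show ?thesis by (simp add: P(2) Q'(2))
    qed
    then show ?case using as(1) bs(1) by (intro exI[of _ "as @ bs"]) auto
  qed
  then show thesis using that by blast
qed

lemma OD_I:
  assumes "\<And>p. p \<in> set ps \<Longrightarrow> OD xs p"
    and "dfn ps (\<lambda>v. P (v 0))" and "\<And>y. P y \<longleftrightarrow> y = z"
  shows "OD xs z"
proof -
  obtain as where as: "\<And>a. a \<in> set as \<Longrightarrow> is_ordinal a" "\<And>Q. dfn ps Q \<Longrightarrow> dfn (xs @ as) Q"
    using dfn_OD_parameters[of ps xs] assms(1) by blast
  have "definable_from (xs @ as) z" by (rule definable_fromI[OF as(2)[OF assms(2)] assms(3)])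
  then show ?thesis unfolding OD_def using as(1) by blast
qed

lemma OD_parameter: "p \<in> set xs \<Longrightarrow> OD xs p"
  unfolding OD_def
  by (intro exI[of _ "[]"] conjI definable_fromI[where P = "\<lambda>y. y = p"] dfn_intros dft_const) auto

lemma OD_ordinal: "is_ordinal a \<Longrightarrow> OD xs a"
  unfolding OD_def
  by (intro exI[of _ "[a]"] conjI definable_fromI[where P = "\<lambda>y. y = a"] dfn_intros dft_const) auto

end

context ZF
begin

section \<open>Basic set theory\<close>

lemma set_eq_iff: "x = y \<longleftrightarrow> (\<forall>z. z \<epsilon> x \<longleftrightarrow> z \<epsilon> y)"
  using extensionality by blast

lemma comprehension:
  assumes "dfn ps (\<lambda>v. P (v 0))"
  shows "\<exists>b. \<forall>x. x \<epsilon> b \<longleftrightarrow> x \<epsilon> a \<and> P x"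
proof -
  obtain \<phi> where \<phi>: "\<And>v. P (v 0) \<longleftrightarrow> sat (\<epsilon>) \<phi> (env ps v)"
    using assms unfolding dfn_def by blast
  define f where "f i = (if i < length ps then Suc i else 0)" for i
  obtain \<psi> where \<psi>: "\<And>v. sat (\<epsilon>) \<psi> v \<longleftrightarrow> sat (\<epsilon>) \<phi> (\<lambda>i. v (f i))"
    using sat_rename by blast
  have "(\<lambda>i. ((!) (x # ps)) (f i)) = env ps (\<lambda>_. x)" for x
    by (auto simp: f_def env_def)
  then have *: "sat (\<epsilon>) \<psi> ((!) (x # ps)) \<longleftrightarrow> P x" for x
    using \<phi>[of "\<lambda>_. x"] by (simp add: \<psi>)
  have "((!) (a # ps))(0 := x) = (!) (x # ps)" for x
    by (auto simp: nth_Cons fun_eq_iff split: nat.split)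
  then show ?thesis using separation[of a \<psi> "(!) (a # ps)"] * by simp
qed

lemma collection_image:
  assumes "dfn ps (\<lambda>v. P (v 0) (v 1))"
    and "\<And>x y y'. x \<epsilon> a \<Longrightarrow> P x y \<Longrightarrow> P x y' \<Longrightarrow> y = y'"
  shows "\<exists>b. \<forall>y. y \<epsilon> b \<longleftrightarrow> (\<exists>x. x \<epsilon> a \<and> P x y)"
proof -
  obtain \<phi> where \<phi>: "\<And>v. P (v 0) (v 1) \<longleftrightarrow> sat (\<epsilon>) \<phi> (env ps v)"
    using assms unfolding dfn_def by blast
  define f where "f i = (if i < length ps then Suc (Suc i) else if i = length ps then 0 else 1)" for i
  obtain \<psi> where \<psi>: "\<And>v. sat (\<epsilon>) \<psi> v \<longleftrightarrow> sat (\<epsilon>) \<phi> (\<lambda>i. v (f i))"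
    using sat_rename by blast
  have "(\<lambda>i. ((!) (x # y # ps)) (f i)) = env ps (case_nat x (\<lambda>_. y))" for x y
    by (auto simp: f_def env_def fun_eq_iff split: nat.split)
  then have *: "sat (\<epsilon>) \<psi> ((!) (x # y # ps)) \<longleftrightarrow> P x y" for x y
    using \<phi>[of "case_nat x (\<lambda>_. y)"] by (simp add: \<psi>)
  have "((!) (a # a # ps))(0 := x, 1 := y) = (!) (x # y # ps)" for x y
    by (auto simp: nth_Cons fun_eq_iff split: nat.split)
  then show ?thesis
    using replacement[of a \<psi> "(!) (a # a # ps)"] * assms(2) by (simp add: Let_def) blast
qed

text \<open>A value is determined only if the class \<open>C\<close> is a set; otherwise it is
  unspecified. Hence each operation below comes with a membership rule, often proved by bounding
  \<open>C\<close> inside a known set.\<close>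

definition col :: "('a \<Rightarrow> bool) \<Rightarrow> 'a" where
  "col C = (THE b. \<forall>x. x \<epsilon> b \<longleftrightarrow> C x)"

lemma mem_col: "\<exists>b. \<forall>x. x \<epsilon> b \<longleftrightarrow> C x \<Longrightarrow> x \<epsilon> col C \<longleftrightarrow> C x"
proof -
  assume "\<exists>b. \<forall>x. x \<epsilon> b \<longleftrightarrow> C x"
  then have "\<exists>!b. \<forall>x. x \<epsilon> b \<longleftrightarrow> C x" using extensionality by blast
  from theI'[OF this] show ?thesis unfolding col_def by blast
qed

lemma mem_col_sub:
  assumes "dfn ps (\<lambda>v. C (v 0))" and "\<And>x. C x \<Longrightarrow> x \<epsilon> a"
  shows "x \<epsilon> col C \<longleftrightarrow> C x"
  using comprehension[OF assms(1), of a] assms(2) by (intro mem_col) blast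

section \<open>Elementary set operations\<close>

definition "emp = col (\<lambda>_. False)"
definition "upr a b = col (\<lambda>z. z = a \<or> z = b)"
definition "bigU a = col (\<lambda>z. \<exists>y. y \<epsilon> a \<and> z \<epsilon> y)"
definition "cup a b = bigU (upr a b)"
definition "Po a = col (\<lambda>z. subset z a)"
definition "suc a = cup a (upr a a)"
definition "opair a b = upr (upr a a) (upr a b)"

lemma mem_emp [simp]: "\<not> x \<epsilon> emp"
  using mem_col_sub[of "[]" "\<lambda>_. False" undefined x] dfn_bool unfolding emp_def by blast

lemma mem_upr [simp]: "x \<epsilon> upr a b \<longleftrightarrow> x = a \<or> x = b"
  unfolding upr_def using pairing[of a b] by (intro mem_col) (simp add: is_upair_def)

lemma mem_bigU [simp]: "x \<epsilon> bigU a \<longleftrightarrow> (\<exists>y. y \<epsilon> a \<and> x \<epsilon> y)"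
  unfolding bigU_def using union[of a] by (intro mem_col)

lemma mem_cup [simp]: "x \<epsilon> cup a b \<longleftrightarrow> x \<epsilon> a \<or> x \<epsilon> b"
  by (auto simp: cup_def)

lemma mem_Po [simp]: "x \<epsilon> Po a \<longleftrightarrow> subset x a"
  unfolding Po_def using power_set[of a] by (intro mem_col) (simp add: is_power_def)

lemma mem_suc [simp]: "x \<epsilon> suc a \<longleftrightarrow> x \<epsilon> a \<or> x = a"
  by (auto simp: suc_def)

lemma is_upair_iff [simp]: "is_upair p a b \<longleftrightarrow> p = upr a b"
  by (simp add: is_upair_def set_eq_iff[of p])

lemma is_pair_iff [simp]: "is_pair p a b \<longleftrightarrow> p = opair a b"
  by (simp add: is_pair_def opair_def set_eq_iff[of p])

lemma pair_in_iff [simp]: "pair_in a b r \<longleftrightarrow> opair a b \<epsilon> r"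
  by (simp add: pair_in_def)

lemma is_empty_iff: "is_empty x \<longleftrightarrow> x = emp"
  by (simp add: is_empty_def set_eq_iff[of x])

lemma is_succ_iff: "is_succ s x \<longleftrightarrow> s = suc x"
  by (simp add: is_succ_def set_eq_iff[of s])

lemma is_power_iff: "is_power p x \<longleftrightarrow> p = Po x"
  by (simp add: is_power_def set_eq_iff[of p])

lemma upr_eq: "upr a b = upr c d \<longleftrightarrow> (a = c \<and> b = d) \<or> (a = d \<and> b = c)"
  by (subst set_eq_iff) (simp, metis)

lemma opair_eq [simp]: "opair a b = opair c d \<longleftrightarrow> a = c \<and> b = d"
  unfolding opair_def upr_eq by auto

lemma subset_refl [simp]: "subset x x"
  by (simp add: subset_def)

lemma dfn_subset0: "dfn ps (\<lambda>v. subset (v 0) (v 1))"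
  unfolding subset_def by (rule dfn_intros)+

lemmas dfn_subset [dfn_intros] = dfn_subst2[where P = subset, OF dfn_subset0]

lemma dft_emp [dfn_intros]: "dft ps (\<lambda>v. emp)"
  unfolding dft_def is_empty_iff[symmetric] is_empty_def by (rule dfn_intros)+

lemma dft_upr0: "dfn ps (\<lambda>v. v 0 = upr (v 1) (v 2))"
  unfolding set_eq_iff[of "v 0" for v] mem_upr by (rule dfn_intros)+

lemmas dft_upr [dfn_intros] = dft_fun2[where f = upr, OF dft_upr0]

lemma dft_bigU0: "dfn ps (\<lambda>v. v 0 = bigU (v 1))"
  unfolding set_eq_iff[of "v 0" for v] mem_bigU by (rule dfn_intros)+

lemmas dft_bigU [dfn_intros] = dft_fun1[where f = bigU, OF dft_bigU0]

lemma dft_Po0: "dfn ps (\<lambda>v. v 0 = Po (v 1))"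
  unfolding set_eq_iff[of "v 0" for v] mem_Po by (rule dfn_intros)+

lemmas dft_Po [dfn_intros] = dft_fun1[where f = Po, OF dft_Po0]

lemma dft_cup [dfn_intros]: "dft ps s \<Longrightarrow> dft ps t \<Longrightarrow> dft ps (\<lambda>v. cup (s v) (t v))"
  unfolding cup_def by (rule dft_bigU[OF dft_upr])

lemma dft_suc [dfn_intros]: "dft ps s \<Longrightarrow> dft ps (\<lambda>v. suc (s v))"
  unfolding suc_def by (rule dft_cup[OF _ dft_upr])

lemma dft_opair [dfn_intros]: "dft ps s \<Longrightarrow> dft ps t \<Longrightarrow> dft ps (\<lambda>v. opair (s v) (t v))"
  unfolding opair_def by (rule dft_upr[OF dft_upr dft_upr])

lemma not_mem_self [simp]: "\<not> x \<epsilon> x"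
  using foundation[of "upr x x"] by auto

lemma mem_asym: "x \<epsilon> y \<Longrightarrow> \<not> y \<epsilon> x"
  using foundation[of "upr x y"] by auto

lemma suc_inj [simp]: "suc a = suc b \<longleftrightarrow> a = b"
  by (metis mem_suc mem_asym)

lemma suc_neq_emp [simp]: "suc a \<noteq> emp" "emp \<noteq> suc a"
  by (metis mem_suc mem_emp)+

section \<open>Relations and functions as sets\<close>

definition "cart a b = col (\<lambda>p. \<exists>x y. x \<epsilon> a \<and> y \<epsilon> b \<and> p = opair x y)"

lemma mem_cart: "p \<epsilon> cart a b \<longleftrightarrow> (\<exists>x y. x \<epsilon> a \<and> y \<epsilon> b \<and> p = opair x y)"
  unfolding cart_def
proof (rule mem_col_sub[where a = "Po (Po (cup a b))" and ps = "[a, b]"])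
  show "dfn [a, b] (\<lambda>v. \<exists>x y. x \<epsilon> a \<and> y \<epsilon> b \<and> v 0 = opair x y)"
    by (rule dfn_intros | (rule dft_const, simp; fail))+
qed (auto simp: opair_def subset_def)

lemma opair_mem_cart [simp]: "opair x y \<epsilon> cart a b \<longleftrightarrow> x \<epsilon> a \<and> y \<epsilon> b"
  by (auto simp: mem_cart)

definition "rng s = col (\<lambda>y. \<exists>x. opair x y \<epsilon> s)"

lemma mem_rng: "y \<epsilon> rng s \<longleftrightarrow> (\<exists>x. opair x y \<epsilon> s)"
  unfolding rng_def
proof (rule mem_col_sub[where a = "bigU (bigU s)" and ps = "[s]"])
  show "dfn [s] (\<lambda>v. \<exists>x. opair x (v 0) \<epsilon> s)"
    by (rule dfn_intros | (rule dft_const, simp; fail))+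
  show "\<exists>x. opair x y \<epsilon> s \<Longrightarrow> y \<epsilon> bigU (bigU s)" for y
    unfolding opair_def by (metis mem_bigU mem_upr)
qed

lemma dft_rng0: "dfn ps (\<lambda>v. v 0 = rng (v 1))"
  unfolding set_eq_iff[of "v 0" for v] mem_rng by (rule dfn_intros)+

lemmas dft_rng [dfn_intros] = dft_fun1[where f = rng, OF dft_rng0]

definition "restr s a = col (\<lambda>p. p \<epsilon> s \<and> (\<exists>x y. x \<epsilon> a \<and> p = opair x y))"

lemma mem_restr: "p \<epsilon> restr s a \<longleftrightarrow> p \<epsilon> s \<and> (\<exists>x y. x \<epsilon> a \<and> p = opair x y)"
  unfolding restr_def
proof (rule mem_col_sub[where a = s and ps = "[s, a]"])
  show "dfn [s, a] (\<lambda>v. v 0 \<epsilon> s \<and> (\<exists>x y. x \<epsilon> a \<and> v 0 = opair x y))"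
    by (rule dfn_intros | (rule dft_const, simp; fail))+
qed auto

lemma opair_mem_restr [simp]: "opair x y \<epsilon> restr s a \<longleftrightarrow> opair x y \<epsilon> s \<and> x \<epsilon> a"
  by (auto simp: mem_restr)

lemma dft_restr0: "dfn ps (\<lambda>v. v 0 = restr (v 1) (v 2))"
  unfolding set_eq_iff[of "v 0" for v] mem_restr by (rule dfn_intros)+

lemmas dft_restr [dfn_intros] = dft_fun2[where f = restr, OF dft_restr0]

definition fn :: "'a \<Rightarrow> 'a \<Rightarrow> bool" where
  "fn s d \<longleftrightarrow> (\<forall>p. p \<epsilon> s \<longrightarrow> (\<exists>x y. x \<epsilon> d \<and> p = opair x y)) \<and> (\<forall>x. x \<epsilon> d \<longrightarrow> (\<exists>!y. opair x y \<epsilon> s))"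

text \<open>The value is taken as the union of all sets related to \<open>x\<close>. This is total,
  equals the usual value on the domain of a function, and is empty outside the domain.\<close>

definition "app s x = col (\<lambda>u. \<exists>y. opair x y \<epsilon> s \<and> u \<epsilon> y)"

lemma mem_app: "u \<epsilon> app s x \<longleftrightarrow> (\<exists>y. opair x y \<epsilon> s \<and> u \<epsilon> y)"
  unfolding app_def
proof (rule mem_col_sub[where a = "bigU (rng s)" and ps = "[s, x]"])
  show "dfn [s, x] (\<lambda>v. \<exists>y. opair x y \<epsilon> s \<and> v 0 \<epsilon> y)"
    by (rule dfn_intros | (rule dft_const, simp; fail))+
  show "\<exists>y. opair x y \<epsilon> s \<and> u \<epsilon> y \<Longrightarrow> u \<epsilon> bigU (rng s)" for u
    using mem_rng by auto
qed

lemma dft_app0: "dfn ps (\<lambda>v. v 0 = app (v 1) (v 2))"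
  unfolding set_eq_iff[of "v 0" for v] mem_app by (rule dfn_intros)+

lemmas dft_app [dfn_intros] = dft_fun2[where f = app, OF dft_app0]

lemma app_eq:
  assumes "fn s d" "x \<epsilon> d"
  shows "opair x y \<epsilon> s \<longleftrightarrow> y = app s x"
proof -
  obtain z where z: "opair x z \<epsilon> s" "\<And>y. opair x y \<epsilon> s \<Longrightarrow> y = z"
    using assms unfolding fn_def by blast
  then have "app s x = z" by (intro extensionality) (metis mem_app)
  then show ?thesis using z by metis
qed

lemma fn_domD: "fn s d \<Longrightarrow> opair x y \<epsilon> s \<Longrightarrow> x \<epsilon> d"
  unfolding fn_def by fastforce

lemma fn_restr: "fn s d \<Longrightarrow> subset e d \<Longrightarrow> fn (restr s e) e"
  unfolding fn_def subset_def by (simp add: mem_restr)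

lemma fn_ext_subset:
  assumes "fn s d" "fn t d" "\<And>x. x \<epsilon> d \<Longrightarrow> app s x = app t x" "p \<epsilon> s"
  shows "p \<epsilon> t"
proof -
  obtain x y where xy: "x \<epsilon> d" "p = opair x y" using assms(1,4) unfolding fn_def by blast
  then have "y = app t x" using app_eq[OF assms(1) xy(1)] assms(3,4) by simp
  then show ?thesis using app_eq[OF assms(2) xy(1)] xy(2) by simp
qed

lemma fn_ext:
  assumes "fn s d" "fn t d" "\<And>x. x \<epsilon> d \<Longrightarrow> app s x = app t x"
  shows "s = t"
  using fn_ext_subset[OF assms] fn_ext_subset[OF assms(2,1) assms(3)[symmetric]]
  by (intro extensionality allI iffI)

lemma app_restr: "fn s d \<Longrightarrow> subset e d \<Longrightarrow> x \<epsilon> e \<Longrightarrow> app (restr s e) x = app s x"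
  using app_eq[OF fn_restr, of s d e x "app s x"] app_eq[of s d x "app s x"]
  by (simp add: subset_def)

lemma is_function_iff: "is_function f a b \<longleftrightarrow> fn f a \<and> (\<forall>x y. opair x y \<epsilon> f \<longrightarrow> y \<epsilon> b)"
proof -
  have "(\<forall>p. p \<epsilon> f \<longrightarrow> (\<exists>x y. x \<epsilon> a \<and> y \<epsilon> b \<and> p = opair x y)) \<longleftrightarrow>
      (\<forall>p. p \<epsilon> f \<longrightarrow> (\<exists>x y. x \<epsilon> a \<and> p = opair x y)) \<and> (\<forall>x y. opair x y \<epsilon> f \<longrightarrow> y \<epsilon> b)"
    (is "?L \<longleftrightarrow> ?R")
  proof
    assume ?L
    then have "\<exists>x' y'. x' \<epsilon> a \<and> y' \<epsilon> b \<and> opair x y = opair x' y'" if "opair x y \<epsilon> f" for x y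
      using that by blast
    then show ?R using \<open>?L\<close> by auto
  qed blast
  then show ?thesis unfolding is_function_def fn_def pair_in_iff is_pair_iff by blast
qed

lemma dfn_fn0: "dfn ps (\<lambda>v. fn (v 0) (v 1))"
  unfolding fn_def by (rule dfn_intros)+

lemmas dfn_fn [dfn_intros] = dfn_subst2[where P = fn, OF dfn_fn0]

lemma dfn_is_function0: "dfn ps (\<lambda>v. is_function (v 0) (v 1) (v 2))"
  unfolding is_function_iff by (rule dfn_intros)+

lemmas dfn_is_function [dfn_intros] = dfn_subst3[where P = is_function, OF dfn_is_function0]

definition "funs a b = col (\<lambda>g. is_function g a b)"

lemma mem_funs: "g \<epsilon> funs a b \<longleftrightarrow> is_function g a b"
  unfolding funs_def
proof (rule mem_col_sub[where a = "Po (cart a b)" and ps = "[a, b]"])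
  show "dfn [a, b] (\<lambda>v. is_function (v 0) a b)"
    by (rule dfn_intros | (rule dft_const, simp; fail))+
  show "is_function g a b \<Longrightarrow> g \<epsilon> Po (cart a b)" for g
    unfolding is_function_def by (auto simp: subset_def mem_cart)
qed

lemma dft_funs0: "dfn ps (\<lambda>v. v 0 = funs (v 1) (v 2))"
  unfolding set_eq_iff[of "v 0" for v] mem_funs by (rule dfn_intros)+

lemmas dft_funs [dfn_intros] = dft_fun2[where f = funs, OF dft_funs0]

lemma fn_graph:
  assumes "dfn ps (\<lambda>v. P (v 0) (v 1))" and "\<And>x. x \<epsilon> d \<Longrightarrow> \<exists>!y. P x y"
  obtains s where "fn s d" "\<And>x. x \<epsilon> d \<Longrightarrow> P x (app s x)" "\<And>x y. opair x y \<epsilon> s \<longleftrightarrow> x \<epsilon> d \<and> P x y"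
proof -
  have "\<exists>s. \<forall>p. p \<epsilon> s \<longleftrightarrow> (\<exists>x. x \<epsilon> d \<and> (\<exists>y. P x y \<and> p = opair x y))"
  proof (rule collection_image)
    show "dfn ps (\<lambda>v. \<exists>y. P (v 0) y \<and> v 1 = opair (v 0) y)"
      by (rule dfn_intros dfn_subst2[OF assms(1)])+
  qed (use assms(2) in auto)
  then obtain s where s: "\<And>p. p \<epsilon> s \<longleftrightarrow> (\<exists>x. x \<epsilon> d \<and> (\<exists>y. P x y \<and> p = opair x y))" by blast
  have 1: "opair x y \<epsilon> s \<longleftrightarrow> x \<epsilon> d \<and> P x y" for x y by (auto simp: s)
  have 2: "fn s d" unfolding fn_def using assms(2) by (auto simp: 1) (auto simp: s)
  have "P x (app s x)" if "x \<epsilon> d" for x using app_eq[OF 2 that] 1 that by blast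
  then show thesis using that 1 2 by blast
qed

section \<open>Ordinals and transfinite recursion\<close>

lemma dfn_is_ordinal0: "dfn ps (\<lambda>v. is_ordinal (v 0))"
  unfolding is_ordinal_def is_transitive_def by (rule dfn_intros)+

lemmas dfn_is_ordinal [dfn_intros] = dfn_subst1[where P = is_ordinal, OF dfn_is_ordinal0]

lemma ord_elem: "is_ordinal a \<Longrightarrow> b \<epsilon> a \<Longrightarrow> is_ordinal b"
  unfolding is_ordinal_def is_transitive_def subset_def by blast

lemma ord_trans: "is_ordinal c \<Longrightarrow> a \<epsilon> b \<Longrightarrow> b \<epsilon> c \<Longrightarrow> a \<epsilon> c"
  unfolding is_ordinal_def is_transitive_def subset_def by blast

lemma ord_subset: "is_ordinal a \<Longrightarrow> b \<epsilon> a \<Longrightarrow> subset b a"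
  using ord_trans unfolding subset_def by blast

text \<open>Foundation applies only to sets, so the counterexamples must form one; this is where the
  certificate for \<open>P\<close> is used.\<close>

lemma ord_induct:
  assumes P: "dfn ps (\<lambda>v. P (v 0))"
    and step: "\<And>a. is_ordinal a \<Longrightarrow> (\<And>b. b \<epsilon> a \<Longrightarrow> P b) \<Longrightarrow> P a"
    and a: "is_ordinal a"
  shows "P a"
proof (rule ccontr)
  assume "\<not> P a"
  \<comment> \<open>\<open>suc a\<close> instead of \<open>a\<close> puts the assumed counterexample
    itself into \<open>B\<close>.\<close>
  obtain B where B: "\<And>x. x \<epsilon> B \<longleftrightarrow> x \<epsilon> suc a \<and> \<not> P x"
    using comprehension[OF dfn_not[OF P]] by blast
  have "a \<epsilon> B" by (simp add: B \<open>\<not> P a\<close>)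
  then obtain m where m: "m \<epsilon> B" "\<And>z. z \<epsilon> B \<Longrightarrow> \<not> z \<epsilon> m"
    using foundation[of B] by blast
  then have m': "is_ordinal m" "m \<epsilon> suc a" "\<not> P m" using a ord_elem by (auto simp: B)
  have "P b" if "b \<epsilon> m" for b
    using m(2)[of b] that m'(2) ord_trans[OF a that] by (auto simp: B)
  then show False using step[OF m'(1)] m'(3) by blast
qed

lemma ord_least:
  assumes P: "dfn ps (\<lambda>v. P (v 0))" and "is_ordinal a" "P a"
  obtains m where "is_ordinal m" "P m" "\<And>b. b \<epsilon> m \<Longrightarrow> \<not> P b"
  using ord_induct[OF dfn_not[OF P] _ assms(2)] assms(3) by blast

lemma ord_linear_step:
  assumes "\<And>c. c \<epsilon> a \<Longrightarrow> c \<epsilon> b \<or> c = b \<or> b \<epsilon> c" "\<And>d. d \<epsilon> b \<Longrightarrow> a \<epsilon> d \<or> a = d \<or> d \<epsilon> a"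
    and "is_ordinal a" "is_ordinal b"
  shows "a \<epsilon> b \<or> a = b \<or> b \<epsilon> a"
proof (rule ccontr)
  assume *: "\<not> ?thesis"
  have "c \<epsilon> b" if "c \<epsilon> a" for c
    using assms(1)[OF that] * that ord_trans[OF assms(3) _ that] by blast
  moreover have "d \<epsilon> a" if "d \<epsilon> b" for d
    using assms(2)[OF that] * that ord_trans[OF assms(4) _ that] by blast
  ultimately have "a = b" by (intro extensionality) blast
  with * show False by blast
qed

lemma ord_linear:
  assumes "is_ordinal a" "is_ordinal b"
  shows "a \<epsilon> b \<or> a = b \<or> b \<epsilon> a"
proof -
  let ?P = "\<lambda>a. \<forall>b. is_ordinal b \<longrightarrow> a \<epsilon> b \<or> a = b \<or> b \<epsilon> a"
  have "?P a"
  proof (rule ord_induct[where P = ?P and ps = "[]", OF _ _ assms(1)])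
    show "dfn [] (\<lambda>v. ?P (v 0))" by (rule dfn_intros)+
    fix a assume a: "is_ordinal a" "\<And>c. c \<epsilon> a \<Longrightarrow> ?P c"
    have "a \<epsilon> b \<or> a = b \<or> b \<epsilon> a" if "is_ordinal b" for b
    proof (rule ord_induct[where P = "\<lambda>b. a \<epsilon> b \<or> a = b \<or> b \<epsilon> a" and ps = "[a]", OF _ _ that])
      show "dfn [a] (\<lambda>v. a \<epsilon> v 0 \<or> a = v 0 \<or> v 0 \<epsilon> a)"
        by (rule dfn_intros | (rule dft_const, simp; fail))+
      fix b assume b: "is_ordinal b" "\<And>d. d \<epsilon> b \<Longrightarrow> a \<epsilon> d \<or> a = d \<or> d \<epsilon> a"
      show "a \<epsilon> b \<or> a = b \<or> b \<epsilon> a"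
        by (rule ord_linear_step[OF _ b(2) a(1) b(1)]) (use a(2) b(1) in blast)+
    qed
    then show "?P a" by blast
  qed
  then show ?thesis using assms(2) by blast
qed

lemma ord_subset_iff:
  assumes "is_ordinal a" "is_ordinal b"
  shows "subset a b \<longleftrightarrow> a \<epsilon> b \<or> a = b"
  using ord_linear[OF assms] ord_subset[OF assms(2)] unfolding subset_def by auto

lemma ord_suc: "is_ordinal a \<Longrightarrow> is_ordinal (suc a)"
  unfolding is_ordinal_def is_transitive_def subset_def mem_suc by metis

lemma ord_emp: "is_ordinal emp"
  unfolding is_ordinal_def is_transitive_def by simp

lemma ord_bigU: "(\<And>a. a \<epsilon> S \<Longrightarrow> is_ordinal a) \<Longrightarrow> is_ordinal (bigU S)"
  unfolding is_ordinal_def is_transitive_def subset_def mem_bigU by meson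

lemma ord_bound:
  assumes "\<And>a. a \<epsilon> S \<Longrightarrow> is_ordinal a"
  obtains d where "is_ordinal d" "\<And>a. a \<epsilon> S \<Longrightarrow> a \<epsilon> d"
proof
  have u: "is_ordinal (bigU S)" by (rule ord_bigU[OF assms])
  \<comment> \<open>The supremum may belong to \<open>S\<close>, so its successor is the strict
    bound.\<close>
  then show "is_ordinal (suc (bigU S))" by (rule ord_suc)
  fix a assume a: "a \<epsilon> S"
  then have "subset a (bigU S)" by (auto simp: subset_def)
  then show "a \<epsilon> suc (bigU S)" using ord_subset_iff[OF assms[OF a] u] by simp
qed

lemma ord_two_bound:
  assumes "is_ordinal a" "is_ordinal b"
  obtains d where "is_ordinal d" "a \<epsilon> d" "b \<epsilon> d"
proof -
  have "is_ordinal x" if "x \<epsilon> upr a b" for x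
    using that assms unfolding mem_upr by (elim disjE) simp_all
  then obtain d where "is_ordinal d" "\<And>x. x \<epsilon> upr a b \<Longrightarrow> x \<epsilon> d"
    using ord_bound by blast
  then show thesis using that[of d] mem_upr by simp
qed

text \<open>The Burali-Forti argument: a strict bound of all ordinals would be below itself.\<close>

lemma no_set_of_all_ordinals: "\<exists>a. is_ordinal a \<and> \<not> a \<epsilon> S"
proof (rule ccontr)
  assume *: "\<not> ?thesis"
  obtain O' where O': "\<And>x. x \<epsilon> O' \<longleftrightarrow> x \<epsilon> S \<and> is_ordinal x"
    using comprehension[of "[]" is_ordinal S] dfn_is_ordinal0 by blast
  then obtain d where "is_ordinal d" "\<And>a. a \<epsilon> O' \<Longrightarrow> a \<epsilon> d"
    using ord_bound[of O'] by blast
  moreover from this have "d \<epsilon> O'" using * O' by blast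
  ultimately show False by fastforce
qed

text \<open>Replacement along the inverse relation would collect all ordinals into a set. This is
  what forces greedy recursions to stop.\<close>

lemma no_injection_from_ordinals:
  assumes "dfn ps (\<lambda>v. P (v 0) (v 1))"
    and "\<And>a. is_ordinal a \<Longrightarrow> \<exists>y. y \<epsilon> X \<and> P a y"
    and inj: "\<And>a b y. is_ordinal a \<Longrightarrow> is_ordinal b \<Longrightarrow> P a y \<Longrightarrow> P b y \<Longrightarrow> a = b"
  shows False
proof -
  have "\<exists>S. \<forall>a. a \<epsilon> S \<longleftrightarrow> (\<exists>y. y \<epsilon> X \<and> (is_ordinal a \<and> P a y))"
  proof (rule collection_image)
    show "dfn ps (\<lambda>v. is_ordinal (v 1) \<and> P (v 1) (v 0))"
      by (rule dfn_intros dfn_subst2[OF assms(1)])+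
  qed (use inj in blast)
  then obtain S where "\<And>a. a \<epsilon> S \<longleftrightarrow> (\<exists>y. y \<epsilon> X \<and> (is_ordinal a \<and> P a y))" by blast
  then show False using no_set_of_all_ordinals[of S] assms(2) by blast
qed

section \<open>The natural numbers of the structure\<close>

definition "om = col (\<lambda>n. \<forall>i. is_inductive i \<longrightarrow> n \<epsilon> i)"

lemma is_inductive_iff: "is_inductive i \<longleftrightarrow> emp \<epsilon> i \<and> (\<forall>x. x \<epsilon> i \<longrightarrow> suc x \<epsilon> i)"
  unfolding is_inductive_def is_empty_iff is_succ_iff by auto

lemma dfn_is_inductive0: "dfn ps (\<lambda>v. is_inductive (v 0))"
  unfolding is_inductive_iff by (rule dfn_intros)+

lemmas dfn_is_inductive [dfn_intros] = dfn_subst1[where P = is_inductive, OF dfn_is_inductive0]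

lemma mem_om: "n \<epsilon> om \<longleftrightarrow> (\<forall>i. is_inductive i \<longrightarrow> n \<epsilon> i)"
proof -
  obtain i where i: "is_inductive i" using infinity by blast
  show ?thesis unfolding om_def
  proof (rule mem_col_sub[where a = i and ps = "[]"])
    show "dfn [] (\<lambda>v. \<forall>i. is_inductive i \<longrightarrow> v 0 \<epsilon> i)" by (rule dfn_intros)+
  qed (use i in blast)
qed

lemma is_omega_iff [simp]: "is_omega w \<longleftrightarrow> w = om"
  by (simp add: is_omega_def set_eq_iff[of w] mem_om)

lemma dft_om [dfn_intros]: "dft ps (\<lambda>v. om)"
  unfolding dft_def set_eq_iff[of "v 0" for v] mem_om by (rule dfn_intros)+

lemma emp_om [simp]: "emp \<epsilon> om"
  by (simp add: mem_om is_inductive_iff)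

lemma suc_om [simp]: "n \<epsilon> om \<Longrightarrow> suc n \<epsilon> om"
  by (simp add: mem_om is_inductive_iff)

lemma om_induct:
  assumes P: "dfn ps (\<lambda>v. P (v 0))" and "P emp" "\<And>n. n \<epsilon> om \<Longrightarrow> P n \<Longrightarrow> P (suc n)" "n \<epsilon> om"
  shows "P n"
proof -
  obtain B where B: "\<And>x. x \<epsilon> B \<longleftrightarrow> x \<epsilon> om \<and> P x"
    using comprehension[OF P] by blast
  have "is_inductive B" unfolding is_inductive_iff B using assms by auto
  then show ?thesis using assms(4) B unfolding mem_om by blast
qed

lemma om_ord: "n \<epsilon> om \<Longrightarrow> is_ordinal n"
  by (rule om_induct[OF dfn_is_ordinal0]) (auto intro: ord_emp ord_suc)

lemma om_subset: "n \<epsilon> om \<Longrightarrow> subset n om"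
proof (rule om_induct[where P = "\<lambda>n. subset n om"])
  show "dfn [] (\<lambda>v. subset (v 0) om)" by (rule dfn_intros)+
qed (auto simp: subset_def)

lemma ord_om: "is_ordinal om"
  unfolding is_ordinal_def is_transitive_def[of om] using om_subset om_ord is_ordinal_def by blast

lemma om_trans: "m \<epsilon> n \<Longrightarrow> n \<epsilon> om \<Longrightarrow> m \<epsilon> om"
  using om_subset unfolding subset_def by blast

text \<open>Numerals name only the standard elements; \<open>om\<close> may contain more. They serve
  as variable names and as tags for connectives.\<close>

primrec num :: "nat \<Rightarrow> 'a" where
  "num 0 = emp"
| "num (Suc i) = suc (num i)"

lemma num_om [simp]: "num i \<epsilon> om"
  by (induction i) auto

lemma num_inj [simp]: "num i = num j \<longleftrightarrow> i = j"
proof (induction i arbitrary: j)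
  case 0
  show ?case by (cases j) auto
next
  case (Suc i)
  show ?case by (cases j) (auto simp: Suc)
qed

lemma dft_num [dfn_intros]: "dft ps (\<lambda>v. num i)"
  by (induction i) (simp_all add: dft_emp dft_suc)

section \<open>Recursion along the ordinals\<close>

definition functional :: "('a \<Rightarrow> 'a \<Rightarrow> bool) \<Rightarrow> bool" where
  "functional C \<longleftrightarrow> (\<forall>s y y'. C s y \<longrightarrow> C s y' \<longrightarrow> y = y')"

lemma functionalD: "functional C \<Longrightarrow> C s y \<Longrightarrow> C s y' \<Longrightarrow> y = y'"
  unfolding functional_def by blast

text \<open>\<open>C\<close> relates the history below \<open>a\<close> to the value at
  \<open>a\<close>. It may be undefined on some histories, so that a recursion can come to an
  end.\<close>

definition rseq :: "('a \<Rightarrow> 'a \<Rightarrow> bool) \<Rightarrow> 'a \<Rightarrow> 'a \<Rightarrow> bool" where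
  "rseq C s k \<longleftrightarrow> is_ordinal k \<and> fn s k \<and> (\<forall>a y. opair a y \<epsilon> s \<longrightarrow> C (restr s a) y)"

lemma dfn_rseq [dfn_intros]:
  assumes "dfn ps (\<lambda>v. C (\<lambda>i. v (Suc (Suc i))) (v 0) (v 1))" "dft ps s" "dft ps k"
  shows "dfn ps (\<lambda>v. rseq (C v) (s v) (k v))"
proof -
  have "dfn ps (\<lambda>v. C (\<lambda>i. v (Suc (Suc (Suc i)))) (v 0) (v 1))"
    using dfn_rename[OF assms(1), of "\<lambda>i. if i < 2 then i else Suc i"] by simp
  then have "dfn ps (\<lambda>v. C (\<lambda>i. v (Suc (Suc i))) (restr (s (\<lambda>i. v (Suc (Suc i)))) (v (Suc 0))) (v 0))"
    by (intro dfn_subst[where P = "\<lambda>z v. C (\<lambda>i. v (Suc (Suc i))) z (v 0)"] dft_restr dft_var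
        dft_shift[where t = "\<lambda>v. s (\<lambda>i. v (Suc i))"] dft_shift assms(2)) simp
  then show ?thesis unfolding rseq_def
    by (intro dfn_intros assms dft_shift[where t = "\<lambda>v. s (\<lambda>i. v (Suc i))"] dft_shift)
qed

lemma rseq_app: "rseq C s k \<Longrightarrow> a \<epsilon> k \<Longrightarrow> C (restr s a) (app s a)"
  unfolding rseq_def using app_eq by blast

lemma restr_restr: "subset a b \<Longrightarrow> restr (restr s b) a = restr s a"
  by (subst set_eq_iff) (auto simp: mem_restr subset_def)

lemma rseq_restr:
  assumes "rseq C s k" "is_ordinal m" "subset m k"
  shows "rseq C (restr s m) m"
  unfolding rseq_def
proof (intro conjI allI impI)
  show "fn (restr s m) m" using assms fn_restr unfolding rseq_def by blast
  fix a y assume *: "opair a y \<epsilon> restr s m"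
  then have "subset a m" using ord_subset[OF assms(2)] by simp
  with * show "C (restr (restr s m) a) y" using assms(1) unfolding rseq_def
    by (simp add: restr_restr)
qed (rule assms(2))

text \<open>Induction on the common argument: equal histories force equal values.\<close>

lemma rseq_agree:
  assumes C: "functional C"
    and s: "rseq C s k" and t: "rseq C t m"
  shows "opair a y \<epsilon> s \<Longrightarrow> opair a z \<epsilon> t \<Longrightarrow> y = z"
proof -
  have fs: "fn s k" "is_ordinal k" and ft: "fn t m" "is_ordinal m" using s t unfolding rseq_def by auto
  assume *: "opair a y \<epsilon> s" "opair a z \<epsilon> t"
  then have a: "is_ordinal a" using fn_domD[OF fs(1)] ord_elem[OF fs(2)] by blast
  let ?P = "\<lambda>a. \<forall>y z. opair a y \<epsilon> s \<and> opair a z \<epsilon> t \<longrightarrow> y = z"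
  have "?P a"
  proof (rule ord_induct[where P = ?P and ps = "[s, t]", OF _ _ a])
    show "dfn [s, t] (\<lambda>v. ?P (v 0))"
      by (rule dfn_intros | (rule dft_const, simp; fail))+
    fix a assume a: "is_ordinal a" "\<And>b. b \<epsilon> a \<Longrightarrow> ?P b"
    have "y = z" if "opair a y \<epsilon> s" "opair a z \<epsilon> t" for y z
    proof -
      have sub: "subset a k" "subset a m"
        using that fn_domD fs ft ord_subset by blast+
      have "app (restr s a) b = app (restr t a) b" if "b \<epsilon> a" for b
      proof -
        have "opair b (app s b) \<epsilon> s" "opair b (app t b) \<epsilon> t"
          using app_eq[OF fs(1)] app_eq[OF ft(1)] sub that by (auto simp: subset_def)
        then have "app s b = app t b" using a(2)[OF that] by blast
        then show ?thesis using app_restr fs ft sub that by metis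
      qed
      then have "restr s a = restr t a"
        using fn_ext fn_restr fs(1) ft(1) sub by blast
      then show ?thesis using that s t functionalD[OF C] unfolding rseq_def by metis
    qed
    then show "?P a" by blast
  qed
  then show "y = z" using * by blast
qed

lemma rseq_restr_eq:
  assumes C: "functional C"
    and s: "rseq C s k" and t: "rseq C t m" and "subset k m"
  shows "restr t k = s"
proof (rule fn_ext)
  show "fn (restr t k) k" "fn s k" using assms fn_restr unfolding rseq_def by blast+
  fix x assume x: "x \<epsilon> k"
  then have "x \<epsilon> m" using assms(4) by (simp add: subset_def)
  then have "opair x (app t x) \<epsilon> t" "opair x (app s x) \<epsilon> s"
    using s t x app_eq unfolding rseq_def by blast+
  then have "app s x = app t x" using rseq_agree[OF C s t] by blast
  then show "app (restr t k) x = app s x" using app_restr t x assms(4) unfolding rseq_def by metis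
qed

lemma rseq_unique:
  assumes C: "functional C"
    and s: "rseq C s k" and t: "rseq C t k"
  shows "t = s"
proof (rule fn_ext)
  show "fn t k" "fn s k" using s t unfolding rseq_def by blast+
  show "app t x = app s x" if "x \<epsilon> k" for x
    using rseq_agree[OF C t s, of x "app t x" "app s x"] app_eq[of s k x] app_eq[of t k x] s t that
    unfolding rseq_def by blast
qed

lemma rseq_exists:
  assumes C: "functional C"
    and dC: "dfn ps (\<lambda>v. C (v 0) (v 1))"
    and ext: "\<And>b s. b \<epsilon> k \<Longrightarrow> rseq C s b \<Longrightarrow> \<exists>y. C s y" and k: "is_ordinal k"
  shows "\<exists>s. rseq C s k"
proof -
  let ?P = "\<lambda>k. (\<forall>b s. b \<epsilon> k \<and> rseq C s b \<longrightarrow> (\<exists>y. C s y)) \<longrightarrow> (\<exists>s. rseq C s k)"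
  note C2 = dfn_subst2[OF dC]
  have "?P k"
  proof (rule ord_induct[where P = ?P and ps = ps, OF _ _ k])
    show "dfn ps (\<lambda>v. ?P (v 0))"
      by (rule dfn_intros C2)+
    fix k assume k: "is_ordinal k" "\<And>b. b \<epsilon> k \<Longrightarrow> ?P b"
    show "?P k"
    proof
      assume ext: "\<forall>b s. b \<epsilon> k \<and> rseq C s b \<longrightarrow> (\<exists>y. C s y)"
      have ex: "\<exists>s. rseq C s b" if "b \<epsilon> k" for b
        using k(2)[OF that] ext ord_trans[OF k(1) _ that] by blast
      \<comment> \<open>The value at \<open>b\<close> is read off from the unique recursion of
        length \<open>b\<close>; the resulting graph is a recursion of length
        \<open>k\<close>.\<close>
      let ?Q = "\<lambda>b y. \<exists>s. rseq C s b \<and> C s y"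
      have un: "\<exists>!y. ?Q b y" if "b \<epsilon> k" for b
      proof (rule ex_ex1I)
        show "\<exists>y. ?Q b y" using ex[OF that] ext that by blast
        show "y = z" if "?Q b y" "?Q b z" for y z
          using that rseq_unique[OF C] functionalD[OF C] by blast
      qed
      have "dfn ps (\<lambda>v. ?Q (v 0) (v 1))" by (rule dfn_intros C2)+
      then obtain s where s: "fn s k" "\<And>b. b \<epsilon> k \<Longrightarrow> ?Q b (app s b)"
        "\<And>b y. opair b y \<epsilon> s \<longleftrightarrow> b \<epsilon> k \<and> ?Q b y"
        using fn_graph[of ps ?Q k] un by blast
      have "C (restr s a) y" if ay: "opair a y \<epsilon> s" for a y
      proof -
        obtain t where t: "rseq C t a" "C t y" and a: "a \<epsilon> k" using ay s(3) by blast
        have sub: "subset a k" using ord_subset[OF k(1) a] .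
        have "restr s a = t"
        proof (rule fn_ext)
          show "fn (restr s a) a" "fn t a" using fn_restr[OF s(1) sub] t(1) unfolding rseq_def by auto
          fix b assume b: "b \<epsilon> a"
          then have "b \<epsilon> k" using sub by (simp add: subset_def)
          then obtain u where u: "rseq C u b" "C u (app s b)" using s(2) by blast
          have ba: "subset b a" using ord_subset[OF ord_elem[OF k(1) a] b] .
          have "restr t b = u" by (rule rseq_restr_eq[OF C u(1) t(1) ba])
          then have "app t b = app s b" using rseq_app[OF t(1) b] u(2) functionalD[OF C] by blast
          then show "app (restr s a) b = app t b" using app_restr[OF s(1) sub b] by simp
        qed
        then show ?thesis using t(2) by simp
      qed
      then show "\<exists>s. rseq C s k" using k(1) s(1) unfolding rseq_def by blast
    qed
  qed
  then show ?thesis using ext by blast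
qed

section \<open>Greedy recursions\<close>

definition greedy :: "('a \<Rightarrow> 'a \<Rightarrow> bool) \<Rightarrow> 'a \<Rightarrow> bool" where
  "greedy C s \<longleftrightarrow> (\<exists>k. rseq C s k) \<and> \<not> (\<exists>y. C s y)"

lemma dfn_greedy [dfn_intros]:
  assumes "dfn ps (\<lambda>v. C (\<lambda>i. v (Suc (Suc i))) (v 0) (v 1))" "dft ps s"
  shows "dfn ps (\<lambda>v. greedy (C v) (s v))"
proof -
  have "dfn ps (\<lambda>v. C (\<lambda>i. v (Suc (Suc (Suc i)))) (v 0) (v 1))"
    using dfn_rename[OF assms(1), of "\<lambda>i. if i < 2 then i else Suc i"] by simp
  moreover have "dfn ps (\<lambda>v. C (\<lambda>i. v (Suc i)) (s (\<lambda>i. v (Suc i))) (v 0))"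
    using assms(1)
    by (intro dfn_subst[where P = "\<lambda>z v. C (\<lambda>i. v (Suc i)) z (v 0)", OF _ dft_shift[OF assms(2)]]) simp
  ultimately show ?thesis unfolding greedy_def
    by (intro dfn_intros dft_shift assms(2)) simp_all
qed

text \<open>Every step lists a new element of the set \<open>X\<close>; a recursion that never
  stopped would inject the ordinals into \<open>X\<close>.\<close>

lemma greedy_exists:
  assumes C: "functional C"
    and dC: "dfn ps (\<lambda>v. C (v 0) (v 1))"
    and X: "\<And>s y. C s y \<Longrightarrow> y \<epsilon> X \<and> \<not> y \<epsilon> rng s"
  shows "\<exists>!s. greedy C s"
proof (rule ex_ex1I)
  show "\<exists>s. greedy C s"
  proof (rule ccontr)
    assume *: "\<nexists>s. greedy C s"
    then have ext: "\<exists>y. C s y" if "rseq C s k" for s k using that unfolding greedy_def by blast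
    have ex: "\<exists>s. rseq C s a" if "is_ordinal a" for a
      using rseq_exists[OF C dC _ that] ext by blast
    let ?P = "\<lambda>a y. \<exists>s. rseq C s a \<and> C s y"
    have less: False if "a \<epsilon> b" "?P a y" "?P b y" for a b y
    proof -
      obtain s t where s: "rseq C s a" "C s y" and t: "rseq C t b" "C t y" using \<open>?P a y\<close> \<open>?P b y\<close> by blast
      have "is_ordinal b" "fn t b" using t(1) unfolding rseq_def by auto
      then have "restr t a = s" using rseq_restr_eq[OF C s(1) t(1) ord_subset] \<open>a \<epsilon> b\<close> by blast
      then have "app t a = y" using rseq_app[OF t(1) \<open>a \<epsilon> b\<close>] s(2) functionalD[OF C] by blast
      then have "y \<epsilon> rng t" using app_eq[OF \<open>fn t b\<close> \<open>a \<epsilon> b\<close>] mem_rng by blast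
      then show False using X[OF t(2)] by blast
    qed
    show False
    proof (rule no_injection_from_ordinals[where P = ?P])
      show "dfn ps (\<lambda>v. ?P (v 0) (v 1))" by (rule dfn_intros dfn_subst2[OF dC])+
      show "\<exists>y. y \<epsilon> X \<and> ?P a y" if "is_ordinal a" for a using ex[OF that] ext X by blast
      show "a = b" if "is_ordinal a" "is_ordinal b" "?P a y" "?P b y" for a b y
        using ord_linear[OF that(1,2)] less that by blast
    qed
  qed
  have "s = t" if st: "greedy C s" "greedy C t" for s t
  proof -
    obtain k m where k: "rseq C s k" "rseq C t m" using st unfolding greedy_def by blast
    then have "is_ordinal k" "is_ordinal m" unfolding rseq_def by auto
    \<comment> \<open>The shorter of two recursions is an initial segment of the longer one, which
      shows that it could have continued.\<close>
    have less: False if "greedy C s" "rseq C s k" "rseq C t m" "k \<epsilon> m" for s k t m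
    proof -
      have "is_ordinal m" using \<open>rseq C t m\<close> unfolding rseq_def by blast
      then have "restr t k = s" using rseq_restr_eq[OF C that(2,3) ord_subset] that(4) by blast
      then show False using rseq_app[OF that(3,4)] that(1) unfolding greedy_def by blast
    qed
    then show ?thesis
      using ord_linear[OF \<open>is_ordinal k\<close> \<open>is_ordinal m\<close>]
    proof (elim disjE)
      assume "k = m"
      then show "s = t" using rseq_unique[OF C k(2)] k(1) by simp
    qed (use less k st in blast)+
  qed
  then show "\<And>s t. greedy C s \<Longrightarrow> greedy C t \<Longrightarrow> s = t" .
qed

section \<open>The cumulative hierarchy and reflection\<close>

definition fresh :: "('a \<Rightarrow> 'a \<Rightarrow> 'a \<Rightarrow> 'a \<Rightarrow> 'a \<Rightarrow> bool) \<Rightarrow> 'a \<Rightarrow> 'a \<Rightarrow> 'a \<Rightarrow> 'a \<Rightarrow> 'a \<Rightarrow> bool" where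
  "fresh R s a b c y \<longleftrightarrow>
     is_ordinal a \<and> is_ordinal b \<and> is_ordinal c \<and> R s a b c y \<and> \<not> y \<epsilon> rng s"

text \<open>If \<open>R\<close> gives each triple of ordinals at most one value for a given history,
  then choosing the lexicographically least triple with an unlisted value makes the step functional.
  Later values may depend on earlier ones through \<open>s\<close>.\<close>

definition lexleast :: "('a \<Rightarrow> 'a \<Rightarrow> 'a \<Rightarrow> 'a \<Rightarrow> 'a \<Rightarrow> bool) \<Rightarrow> 'a \<Rightarrow> 'a \<Rightarrow> bool" where
  "lexleast R s y \<longleftrightarrow> (\<exists>a b c. fresh R s a b c y \<and>
     (\<forall>a'. a' \<epsilon> a \<longrightarrow> \<not> (\<exists>b c y. fresh R s a' b c y)) \<and>
     (\<forall>b'. b' \<epsilon> b \<longrightarrow> \<not> (\<exists>c y. fresh R s a b' c y)) \<and>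
     (\<forall>c'. c' \<epsilon> c \<longrightarrow> \<not> (\<exists>y. fresh R s a b c' y)))"

lemma functional_lexleast:
  assumes R: "\<And>s a b c y y'. R s a b c y \<Longrightarrow> R s a b c y' \<Longrightarrow> y = y'"
  shows "functional (lexleast R)"
  unfolding functional_def
proof (intro allI impI)
  fix s y y' assume "lexleast R s y" "lexleast R s y'"
  then obtain a b c a' b' c' where
    1: "fresh R s a b c y" "\<forall>a'. a' \<epsilon> a \<longrightarrow> \<not> (\<exists>b c y. fresh R s a' b c y)"
       "\<forall>b'. b' \<epsilon> b \<longrightarrow> \<not> (\<exists>c y. fresh R s a b' c y)" "\<forall>c'. c' \<epsilon> c \<longrightarrow> \<not> (\<exists>y. fresh R s a b c' y)"
    and 2: "fresh R s a' b' c' y'" "\<forall>a. a \<epsilon> a' \<longrightarrow> \<not> (\<exists>b c y. fresh R s a b c y)"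
       "\<forall>b. b \<epsilon> b' \<longrightarrow> \<not> (\<exists>c y. fresh R s a' b c y)" "\<forall>c. c \<epsilon> c' \<longrightarrow> \<not> (\<exists>y. fresh R s a' b' c y)"
    unfolding lexleast_def by (elim exE conjE) rule
  have o: "is_ordinal a" "is_ordinal a'" "is_ordinal b" "is_ordinal b'" "is_ordinal c" "is_ordinal c'"
    using 1(1) 2(1) unfolding fresh_def by blast+
  have a: "a = a'" using ord_linear[OF o(1,2)] 1(1,2) 2(1,2) by blast
  have b: "b = b'" using ord_linear[OF o(3,4)] 1(1,3) 2(1,3) unfolding a by blast
  have c: "c = c'" using ord_linear[OF o(5,6)] 1(1,4) 2(1,4) unfolding a b by blast
  show "y = y'" using 1(1) 2(1) R unfolding a b c fresh_def by blast
qed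

lemma dfn_lexleast [dfn_intros]:
  assumes R: "dfn ps (\<lambda>v. R (v 0) (v 1) (v 2) (v 3) (v 4) (v 5))"
    and "dft ps p" "dft ps s" "dft ps y"
  shows "dfn ps (\<lambda>v. lexleast (R (p v)) (s v) (y v))"
  by (rule dfn_subst3[where P = "\<lambda>p. lexleast (R p)", OF _ assms(2-4)],
      unfold lexleast_def fresh_def) (rule dfn_intros dfn_subst6[OF R])+

text \<open>The lexicographic minimum is found by three successive uses of \<open>ord_least\<close>,
  each with the earlier minima as parameters.\<close>

lemma lexleast_exists:
  assumes R: "dfn ps (\<lambda>v. R (v 0) (v 1) (v 2) (v 3) (v 4))" and ex: "fresh R s a b c y"
  shows "\<exists>y. lexleast R s y"
proof -
  have R': "dfn (s # a # b # c # ps) (\<lambda>v. R (v 1) (v 2) (v 3) (v 4) (v 5))" for s a b c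
    using dfn_rename[OF dfn_mono[OF R], of "s # a # b # c # ps" Suc] by (auto simp: numeral_eq_Suc)
  note R6 = dfn_subst6[where P = "\<lambda>_. R" and t = "\<lambda>v. v 0", OF R' dft_var]
  have o: "is_ordinal a" "is_ordinal b" "is_ordinal c" using ex unfolding fresh_def by auto
  let ?A = "\<lambda>a. \<exists>b c y. fresh R s a b c y"
  \<comment> \<open>The repeated \<open>s\<close> only pads the parameter list to the shape of
    \<open>R'\<close>.\<close>
  have "dfn (s # s # s # s # ps) (\<lambda>v. ?A (v 0))" unfolding fresh_def
    by (rule dfn_intros R6 | (rule dft_const, simp; fail))+
  from ord_least[OF this o(1)] ex obtain a0 where
    a0: "is_ordinal a0" "?A a0" "\<And>a'. a' \<epsilon> a0 \<Longrightarrow> \<not> ?A a'" by blast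
  let ?B = "\<lambda>b. \<exists>c y. fresh R s a0 b c y"
  have dB: "dfn (s # a0 # s # s # ps) (\<lambda>v. ?B (v 0))" unfolding fresh_def
    by (rule dfn_intros R6 | (rule dft_const, simp; fail))+
  obtain b1 where "is_ordinal b1" "?B b1" using a0(2) unfolding fresh_def by blast
  from ord_least[OF dB this] obtain b0 where
    b0: "is_ordinal b0" "?B b0" "\<And>b'. b' \<epsilon> b0 \<Longrightarrow> \<not> ?B b'" by blast
  let ?C = "\<lambda>c. \<exists>y. fresh R s a0 b0 c y"
  have dC: "dfn (s # a0 # b0 # s # ps) (\<lambda>v. ?C (v 0))" unfolding fresh_def
    by (rule dfn_intros R6 | (rule dft_const, simp; fail))+
  obtain c1 where "is_ordinal c1" "?C c1" using b0(2) unfolding fresh_def by blast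
  from ord_least[OF dC this] obtain c0 where
    c0: "is_ordinal c0" "?C c0" "\<And>c'. c' \<epsilon> c0 \<Longrightarrow> \<not> ?C c'" by blast
  then show ?thesis unfolding lexleast_def using a0(3) b0(3) by blast
qed

lemma greedy_lexleast_exists:
  assumes "dfn ps (\<lambda>v. R (v 0) (v 1) (v 2) (v 3) (v 4) (v 5))"
    and "\<And>p s a b c y y'. R p s a b c y \<Longrightarrow> R p s a b c y' \<Longrightarrow> y = y'"
    and "\<And>s a b c y. R p s a b c y \<Longrightarrow> y \<epsilon> X"
  shows "\<exists>!s. greedy (lexleast (R p)) s"
proof (rule greedy_exists)
  show "functional (lexleast (R p))" by (rule functional_lexleast) (rule assms(2))
  show "dfn (p # ps) (\<lambda>v. lexleast (R p) (v 0) (v 1))"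
  proof (rule dfn_lexleast)
    show "dfn (p # ps) (\<lambda>v. R (v 0) (v 1) (v 2) (v 3) (v 4) (v 5))"
      by (rule dfn_mono[OF assms(1)]) auto
  qed (rule dft_var dft_const, simp?)+
  show "y \<epsilon> X \<and> \<not> y \<epsilon> rng s" if "lexleast (R p) s y" for s y
    using that assms(3) unfolding lexleast_def fresh_def by blast
qed

lemma greedy_lexleast_closed:
  assumes dR: "dfn ps (\<lambda>v. R (v 0) (v 1) (v 2) (v 3) (v 4) (v 5))"
    and "greedy (lexleast (R p)) s" "is_ordinal a" "is_ordinal b" "is_ordinal c" "R p s a b c y"
  shows "y \<epsilon> rng s"
proof (rule ccontr)
  assume "\<not> y \<epsilon> rng s"
  then have "fresh (R p) s a b c y" using assms unfolding fresh_def by blast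
  moreover have "dfn (p # ps) (\<lambda>v. R p (v 0) (v 1) (v 2) (v 3) (v 4))"
  proof (rule dfn_subst6[where P = R])
    show "dfn (p # ps) (\<lambda>v. R (v 0) (v 1) (v 2) (v 3) (v 4) (v 5))"
      by (rule dfn_mono[OF dR]) auto
  qed (rule dft_var dft_const, simp?)+
  ultimately have "\<exists>y. lexleast (R p) s y" using lexleast_exists by blast
  then show False using assms(2) unfolding greedy_def by blast
qed

section \<open>The cumulative hierarchy\<close>

definition "pot r = col (\<lambda>z. \<exists>u. u \<epsilon> r \<and> subset z u)"

lemma mem_pot: "z \<epsilon> pot r \<longleftrightarrow> (\<exists>u. u \<epsilon> r \<and> subset z u)"
  unfolding pot_def
proof (rule mem_col_sub[where a = "Po (bigU r)" and ps = "[r]"])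
  show "dfn [r] (\<lambda>v. \<exists>u. u \<epsilon> r \<and> subset (v 0) u)"
    by (rule dfn_intros | (rule dft_const, simp; fail))+
qed (auto simp: subset_def)

lemma dft_pot0: "dfn ps (\<lambda>v. v 0 = pot (v 1))"
  unfolding set_eq_iff[of "v 0" for v] mem_pot by (rule dfn_intros)+

lemmas dft_pot [dfn_intros] = dft_fun1[where f = pot, OF dft_pot0]

text \<open>With \<open>rng s\<close> the earlier levels, the next one consists of all subsets of
  earlier levels. Zero, successor and limit stages are thus treated alike.\<close>

definition lev_step :: "'a \<Rightarrow> 'a \<Rightarrow> bool" where
  "lev_step s y \<longleftrightarrow> y = pot (rng s)"

lemma functional_lev_step: "functional lev_step"
  unfolding functional_def lev_step_def by simp

lemma dfn_lev_step0: "dfn ps (\<lambda>v. lev_step (v 0) (v 1))"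
  unfolding lev_step_def by (rule dfn_intros)+

lemmas dfn_lev_step [dfn_intros] = dfn_subst2[where P = lev_step, OF dfn_lev_step0]

lemma lev_step_seq_exists: "is_ordinal a \<Longrightarrow> \<exists>s. rseq lev_step s a"
  by (rule rseq_exists[OF functional_lev_step dfn_lev_step0]) (auto simp: lev_step_def)

text \<open>The value \<open>emp\<close> off the ordinals makes \<open>V\<close> a total function
  with a definable graph, so that it can be used as a term.\<close>

definition "V a = (if is_ordinal a then THE y. \<exists>s. rseq lev_step s a \<and> lev_step s y else emp)"

lemma V_eq: "is_ordinal a \<Longrightarrow> y = V a \<longleftrightarrow> (\<exists>s. rseq lev_step s a \<and> lev_step s y)"
proof -
  assume a: "is_ordinal a"
  obtain s where s: "rseq lev_step s a" using lev_step_seq_exists[OF a] by blast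
  have *: "(\<exists>s. rseq lev_step s a \<and> lev_step s y) \<longleftrightarrow> y = pot (rng s)" for y
    using rseq_unique[OF functional_lev_step s] s unfolding lev_step_def by blast
  show ?thesis unfolding V_def using a by (simp add: *)
qed

lemma dft_V0: "dfn ps (\<lambda>v. v 0 = V (v 1))"
proof -
  have "dfn ps (\<lambda>v. (is_ordinal (v 1) \<longrightarrow> (\<exists>s. rseq lev_step s (v 1) \<and> lev_step s (v 0))) \<and>
    (\<not> is_ordinal (v 1) \<longrightarrow> v 0 = emp))" by (rule dfn_intros)+
  moreover have "(is_ordinal a \<longrightarrow> (\<exists>s. rseq lev_step s a \<and> lev_step s y)) \<and>
    (\<not> is_ordinal a \<longrightarrow> y = emp) \<longleftrightarrow> y = V a" for a y
    using V_eq[of a y] by (auto simp: V_def)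
  ultimately show ?thesis by simp
qed

lemmas dft_V [dfn_intros] = dft_fun1[where f = V, OF dft_V0]

lemma mem_V: "is_ordinal a \<Longrightarrow> z \<epsilon> V a \<longleftrightarrow> (\<exists>b. b \<epsilon> a \<and> subset z (V b))"
proof -
  assume a: "is_ordinal a"
  obtain s where s: "rseq lev_step s a" "V a = pot (rng s)"
    using V_eq[OF a, of "V a"] unfolding lev_step_def by blast
  have fs: "fn s a" using s(1) unfolding rseq_def by blast
  have app: "app s b = V b" if "b \<epsilon> a" for b
    unfolding V_eq[OF ord_elem[OF a that]]
    using rseq_app[OF s(1) that] rseq_restr[OF s(1) ord_elem[OF a that] ord_subset[OF a that]] by blast
  have "opair b y \<epsilon> s \<longleftrightarrow> b \<epsilon> a \<and> y = V b" for b y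
    using app_eq[OF fs, of b y] fn_domD[OF fs, of b y] app[of b] by metis
  then show ?thesis by (auto simp: s(2) mem_pot mem_rng)
qed

lemma V_mono: "is_ordinal b \<Longrightarrow> subset a b \<Longrightarrow> is_ordinal a \<Longrightarrow> subset (V a) (V b)"
  by (auto simp: subset_def[of _ "V b"] subset_def[of a] mem_V)

text \<open>Least witnesses make Replacement applicable to \<open>P\<close>, and monotonicity lifts
  them all to a common bound. This serves as Collection for ordinal witnesses.\<close>

lemma collect_bound:
  assumes P: "dfn ps (\<lambda>v. P (v 0) (v 1))"
    and ex: "\<And>x. x \<epsilon> X \<Longrightarrow> \<exists>d. is_ordinal d \<and> P x d"
    and mono: "\<And>x d e. x \<epsilon> X \<Longrightarrow> is_ordinal d \<Longrightarrow> is_ordinal e \<Longrightarrow> P x d \<Longrightarrow> d \<epsilon> e \<Longrightarrow> P x e"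
  shows "\<exists>d. is_ordinal d \<and> (\<forall>x. x \<epsilon> X \<longrightarrow> P x d)"
proof -
  let ?L = "\<lambda>x d. is_ordinal d \<and> P x d \<and> (\<forall>e. e \<epsilon> d \<longrightarrow> \<not> P x e)"
  have L: "\<exists>d. ?L x d" if "x \<epsilon> X" for x
  proof -
    obtain d where d: "is_ordinal d" "P x d" using ex[OF \<open>x \<epsilon> X\<close>] by blast
    have "dfn (x # ps) (\<lambda>v. P x (v 0))"
    proof (rule dfn_subst2[of _ P])
      show "dfn (x # ps) (\<lambda>v. P (v 0) (v 1))" by (rule dfn_mono[OF P]) auto
    qed (rule dft_const dft_var, simp?)+
    from ord_least[OF this d] show ?thesis by blast
  qed
  have "\<exists>S. \<forall>d. d \<epsilon> S \<longleftrightarrow> (\<exists>x. x \<epsilon> X \<and> ?L x d)"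
  proof (rule collection_image)
    show "dfn ps (\<lambda>v. ?L (v 0) (v 1))" by (rule dfn_intros dfn_subst2[OF P])+
    show "d = e" if "x \<epsilon> X" "?L x d" "?L x e" for x d e
      using ord_linear[of d e] that by blast
  qed
  then obtain S where S: "\<And>d. d \<epsilon> S \<longleftrightarrow> (\<exists>x. x \<epsilon> X \<and> ?L x d)" by blast
  then obtain e where e: "is_ordinal e" "\<And>d. d \<epsilon> S \<Longrightarrow> d \<epsilon> e" using ord_bound[of S] by blast
  have "P x e" if "x \<epsilon> X" for x
  proof -
    obtain d where d: "?L x d" using L[OF \<open>x \<epsilon> X\<close>] by blast
    then have "d \<epsilon> e" using S e(2) \<open>x \<epsilon> X\<close> by blast
    then show ?thesis using mono[OF that _ e(1)] d by blast
  qed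
  then show ?thesis using e(1) by blast
qed

lemma transitive_superset: "\<exists>t. subset z t \<and> is_transitive t"
proof -
  \<comment> \<open>\<open>bigU (bigU (rng s))\<close> consists of the members of members of earlier
    values, which makes the union of the \<open>om\<close> stages transitive.\<close>
  let ?C = "\<lambda>s y. y = cup z (bigU (bigU (rng s)))"
  have "functional ?C" unfolding functional_def by simp
  moreover have "dfn [z] (\<lambda>v. ?C (v 0) (v 1))" by (rule dfn_intros | (rule dft_const, simp; fail))+
  ultimately obtain s where s: "rseq ?C s om" using rseq_exists[OF _ _ _ ord_om, of ?C] by blast
  then have fs: "fn s om" unfolding rseq_def by blast
  have step: "app s n = cup z (bigU (bigU (rng (restr s n))))" if "n \<epsilon> om" for n
    using rseq_app[OF s that] .
  have "u \<epsilon> bigU (rng s)" if u: "u \<epsilon> w" "w \<epsilon> bigU (rng s)" for u w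
  proof -
    obtain n x where n: "opair n x \<epsilon> s" "w \<epsilon> x" using u(2) by (auto simp: mem_rng)
    then have no: "n \<epsilon> om" using fn_domD[OF fs] by blast
    have "x \<epsilon> rng (restr s (suc n))" using n(1) by (auto simp: mem_rng)
    then have "u \<epsilon> app s (suc n)" unfolding step[OF suc_om[OF no]] using n(2) u(1) by auto
    moreover have "app s (suc n) \<epsilon> rng s" unfolding mem_rng using app_eq[OF fs suc_om[OF no]] by blast
    ultimately show ?thesis by auto
  qed
  then have "is_transitive (bigU (rng s))" unfolding is_transitive_def subset_def by blast
  moreover have "app s emp \<epsilon> rng s" unfolding mem_rng using app_eq[OF fs emp_om] by blast
  then have "subset z (bigU (rng s))" using step[OF emp_om] by (auto simp: subset_def)
  ultimately show ?thesis by blast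
qed

lemma V_cover_step:
  assumes "\<And>u. u \<epsilon> m \<Longrightarrow> \<exists>a. is_ordinal a \<and> u \<epsilon> V a"
  shows "\<exists>a. is_ordinal a \<and> m \<epsilon> V a"
proof -
  have "\<exists>d. is_ordinal d \<and> (\<forall>u. u \<epsilon> m \<longrightarrow> u \<epsilon> V d)"
  proof (rule collect_bound[OF _ assms])
    show "dfn [] (\<lambda>v. v 0 \<epsilon> V (v 1))" by (rule dfn_intros)+
    show "u \<epsilon> V e" if "is_ordinal d" "is_ordinal e" "u \<epsilon> V d" "d \<epsilon> e" for u d e
      using V_mono[OF that(2) ord_subset[OF that(2,4)] that(1)] that(3) unfolding subset_def by blast
  qed
  then obtain d where d: "is_ordinal d" "subset m (V d)" unfolding subset_def by blast
  then have "m \<epsilon> V (suc d)" unfolding mem_V[OF ord_suc[OF d(1)]] by auto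
  then show ?thesis using ord_suc[OF d(1)] by blast
qed

text \<open>A minimal set outside the hierarchy is sought inside a transitive set, so that all its
  members are already covered.\<close>

lemma V_cover: "\<exists>a. is_ordinal a \<and> z \<epsilon> V a"
proof (rule ccontr)
  assume *: "\<not> ?thesis"
  \<comment> \<open>The singleton of \<open>z\<close> ensures that \<open>z\<close> itself lies in
    \<open>t\<close>.\<close>
  obtain t where t: "subset (upr z z) t" "is_transitive t" using transitive_superset by blast
  have "dfn [] (\<lambda>v. \<not> (\<exists>a. is_ordinal a \<and> v 0 \<epsilon> V a))" by (rule dfn_intros)+
  from comprehension[OF this, of t] obtain B where
    B: "\<And>u. u \<epsilon> B \<longleftrightarrow> u \<epsilon> t \<and> \<not> (\<exists>a. is_ordinal a \<and> u \<epsilon> V a)" by blast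
  have "z \<epsilon> B" using t(1) * unfolding B subset_def by simp
  then obtain m where m: "m \<epsilon> B" "\<And>u. u \<epsilon> B \<Longrightarrow> \<not> u \<epsilon> m" using foundation[of B] by blast
  have "\<exists>a. is_ordinal a \<and> u \<epsilon> V a" if "u \<epsilon> m" for u
    using m that B t(2) unfolding is_transitive_def subset_def by blast
  then show False using V_cover_step m(1) unfolding B by blast
qed

section \<open>Reflection of formulas in levels\<close>

primrec rsat :: "'a \<Rightarrow> fm \<Rightarrow> (nat \<Rightarrow> 'a) \<Rightarrow> bool" where
  "rsat L (Mem i j) v \<longleftrightarrow> v i \<epsilon> v j"
| "rsat L (Equ i j) v \<longleftrightarrow> v i = v j"
| "rsat L (Neg p) v \<longleftrightarrow> \<not> rsat L p v"
| "rsat L (Conj p q) v \<longleftrightarrow> rsat L p v \<and> rsat L q v"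
| "rsat L (Univ i p) v \<longleftrightarrow> (\<forall>a. a \<epsilon> L \<longrightarrow> rsat L p (v(i := a)))"

lemma app_om_eq: "g \<epsilon> funs om L \<Longrightarrow> n \<epsilon> om \<Longrightarrow> opair n y \<epsilon> g \<longleftrightarrow> y = app g n"
  using app_eq unfolding mem_funs is_function_iff by blast

lemma app_om_mem: "g \<epsilon> funs om L \<Longrightarrow> n \<epsilon> om \<Longrightarrow> app g n \<epsilon> L"
  using app_om_eq[of g L n "app g n"] unfolding mem_funs is_function_iff by blast

lemma funs_om_I:
  assumes "dfn ps (\<lambda>v. P (v 0) (v 1))" "\<And>x. x \<epsilon> om \<Longrightarrow> \<exists>!y. P x y" "\<And>x y. x \<epsilon> om \<Longrightarrow> P x y \<Longrightarrow> y \<epsilon> L"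
  obtains g where "g \<epsilon> funs om L" "\<And>x y. x \<epsilon> om \<Longrightarrow> P x y \<longleftrightarrow> app g x = y"
proof -
  obtain g where g: "fn g om" "\<And>x. x \<epsilon> om \<Longrightarrow> P x (app g x)" "\<And>x y. opair x y \<epsilon> g \<longleftrightarrow> x \<epsilon> om \<and> P x y"
    using fn_graph[OF assms(1,2)] by blast
  then have "g \<epsilon> funs om L" unfolding mem_funs is_function_iff using assms(3) by blast
  moreover have "P x y \<longleftrightarrow> app g x = y" if "x \<epsilon> om" for x y using assms(2)[OF that] g(2)[OF that] by blast
  ultimately show thesis using that by blast
qed

lemma funs_om_update:
  assumes g: "g \<epsilon> funs om L" and a: "a \<epsilon> L"
  obtains h where "h \<epsilon> funs om L" "app h i = a \<or> \<not> i \<epsilon> om" "\<And>j. j \<epsilon> om \<Longrightarrow> j \<noteq> i \<Longrightarrow> app h j = app g j"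
proof -
  let ?P = "\<lambda>x y. (x = i \<longrightarrow> y = a) \<and> (x \<noteq> i \<longrightarrow> y = app g x)"
  have 1: "dfn [g, i, a] (\<lambda>v. ?P (v 0) (v 1))" by (rule dfn_intros | (rule dft_const, simp; fail))+
  have 2: "\<exists>!y. ?P x y" if "x \<epsilon> om" for x by (cases "x = i") auto
  have 3: "y \<epsilon> L" if "x \<epsilon> om" "?P x y" for x y
    using that a app_om_mem[OF g] by (cases "x = i") auto
  obtain h where h: "h \<epsilon> funs om L" "\<And>x y. x \<epsilon> om \<Longrightarrow> ?P x y \<longleftrightarrow> app h x = y"
    by (rule funs_om_I[where P = ?P and L = L, OF 1], erule 2, erule (1) 3, rule that)
  show thesis
  proof (rule that[OF h(1)])
    show "app h i = a \<or> \<not> i \<epsilon> om" using h(2)[of i a] by blast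
    show "app h j = app g j" if "j \<epsilon> om" "j \<noteq> i" for j using h(2)[of j "app g j"] that by blast
  qed
qed

text \<open>A HOL assignment is usually not an element of the universe. A formula sees finitely many
  variables, so a set function agreeing with the assignment on finitely many numerals can stand in
  for it.\<close>

lemma funs_om_finite_part:
  assumes "\<And>j. v j \<epsilon> L"
  shows "\<exists>g. g \<epsilon> funs om L \<and> (\<forall>j<n. app g (num j) = v j)"
proof (induction n)
  case 0
  have "dfn [v 0] (\<lambda>w. w 1 = v 0)" by (rule dfn_intros | (rule dft_const, simp; fail))+
  then obtain g where "g \<epsilon> funs om L"
    by (rule funs_om_I[where P = "\<lambda>x y. y = v 0" and L = L]) (simp_all add: assms)
  then show ?case by auto
next
  case (Suc n)
  then obtain g where g: "g \<epsilon> funs om L" "\<And>j. j < n \<Longrightarrow> app g (num j) = v j" by blast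
  obtain h where h: "h \<epsilon> funs om L" "app h (num n) = v n \<or> \<not> num n \<epsilon> om"
    "\<And>j. j \<epsilon> om \<Longrightarrow> j \<noteq> num n \<Longrightarrow> app h j = app g j"
    using funs_om_update[OF g(1) assms] by blast
  then have "app h (num j) = v j" if "j < Suc n" for j
    using that g(2) by (cases "j = n") auto
  then show ?case using h(1) by blast
qed

lemma env_Nil: "env [] v = v"
  by (simp add: env_def fun_eq_iff)

lemma dfn_sat: "dfn ps (\<lambda>v. sat (\<epsilon>) \<phi> v)"
proof (rule dfn_mono)
  show "dfn [] (\<lambda>v. sat (\<epsilon>) \<phi> v)"
    unfolding dfn_def by (rule exI[of _ \<phi>]) (simp add: env_Nil)
qed simp

definition reflects :: "fm \<Rightarrow> 'a \<Rightarrow> bool" where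
  "reflects \<phi> l \<longleftrightarrow> (\<forall>v. (\<forall>j. v j \<epsilon> V l) \<longrightarrow> (rsat (V l) \<phi> v \<longleftrightarrow> sat (\<epsilon>) \<phi> v))"

text \<open>\<open>W c d\<close> is meant to say that requests posed in \<open>V c\<close> are met
  in \<open>V d\<close>. Monotonicity in both arguments allows conjunctions and limits of
  iterations.\<close>

definition closing :: "('a \<Rightarrow> 'a \<Rightarrow> bool) \<Rightarrow> bool" where
  "closing W \<longleftrightarrow> dfn [] (\<lambda>v. W (v 0) (v 1)) \<and>
     (\<forall>c. is_ordinal c \<longrightarrow> (\<exists>d. is_ordinal d \<and> W c d)) \<and>
     (\<forall>c d c' d'. is_ordinal c \<longrightarrow> is_ordinal d \<longrightarrow> is_ordinal c' \<longrightarrow> is_ordinal d' \<longrightarrow>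
        W c d \<longrightarrow> subset c' c \<longrightarrow> subset d d' \<longrightarrow> W c' d')"

definition closed_under :: "('a \<Rightarrow> 'a \<Rightarrow> bool) \<Rightarrow> 'a \<Rightarrow> bool" where
  "closed_under W l \<longleftrightarrow> is_ordinal l \<and> (\<exists>c. c \<epsilon> l) \<and>
     (\<forall>c. c \<epsilon> l \<longrightarrow> suc c \<epsilon> l \<and> (\<exists>d. d \<epsilon> l \<and> W c d))"

lemma closing_mono:
  "closing W \<Longrightarrow> W c d \<Longrightarrow> is_ordinal c \<Longrightarrow> is_ordinal d \<Longrightarrow> is_ordinal c' \<Longrightarrow> is_ordinal d' \<Longrightarrow>
    subset c' c \<Longrightarrow> subset d d' \<Longrightarrow> W c' d'"
  unfolding closing_def by blast

lemma closed_under_weaken: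
  "closed_under W l \<Longrightarrow> (\<And>c d. W c d \<Longrightarrow> W' c d) \<Longrightarrow> closed_under W' l"
  unfolding closed_under_def by blast

lemma closed_underD: "closed_under W l \<Longrightarrow> c \<epsilon> l \<Longrightarrow> \<exists>d. d \<epsilon> l \<and> W c d"
  unfolding closed_under_def by blast

lemma closing_conj:
  assumes "closing W" "closing W'"
  shows "closing (\<lambda>c d. W c d \<and> W' c d)"
  unfolding closing_def
proof (intro conjI allI impI)
  show "dfn [] (\<lambda>v. W (v 0) (v 1) \<and> W' (v 0) (v 1))"
    using assms unfolding closing_def by (intro dfn_conj) blast+
  fix c assume c: "is_ordinal c"
  obtain d d' where d: "is_ordinal d" "W c d" "is_ordinal d'" "W' c d'"
    using assms c unfolding closing_def by meson
  obtain e where e: "is_ordinal e" "d \<epsilon> e" "d' \<epsilon> e" using ord_two_bound d(1,3) by blast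
  have "W c e" "W' c e"
    using closing_mono[OF assms(1) d(2) c d(1) c e(1) subset_refl ord_subset[OF e(1,2)]]
      closing_mono[OF assms(2) d(4) c d(3) c e(1) subset_refl ord_subset[OF e(1,3)]] .
  then show "\<exists>d. is_ordinal d \<and> W c d \<and> W' c d" using e(1) by blast
next
  fix c d c' d' assume *: "is_ordinal c" "is_ordinal d" "is_ordinal c'" "is_ordinal d'"
    "W c d \<and> W' c d" "subset c' c" "subset d d'"
  show "W c' d'" using assms(1) * unfolding closing_def by blast
  show "W' c' d'" using assms(2) * unfolding closing_def by blast
qed

text \<open>The supremum of an iteration of length \<open>om\<close> is closed. Each term is the
  least ordinal that exceeds \<open>g\<close> and all earlier terms and answers those under
  \<open>W\<close>; taking the least one makes the step functional.\<close>

lemma closing_point: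
  assumes W: "closing W" and g0: "is_ordinal g"
  shows "\<exists>l. closed_under W l \<and> g \<epsilon> l"
proof -
  let ?P = "\<lambda>s y. is_ordinal y \<and> g \<epsilon> y \<and> (\<forall>u. u \<epsilon> rng s \<longrightarrow> u \<epsilon> y \<and> W u y)"
  let ?C = "\<lambda>s y. ?P s y \<and> (\<forall>z. z \<epsilon> y \<longrightarrow> \<not> ?P s z)"
  have dW: "dfn [] (\<lambda>v. W (v 0) (v 1))" using W unfolding closing_def by blast
  have dW': "dfn [g] (\<lambda>v. W (v 0) (v 1))" by (rule dfn_mono[OF dW]) simp
  note mono = closing_mono[OF W]
  have fC: "functional ?C" unfolding functional_def
  proof (intro allI impI)
    fix s y y' assume "?C s y" "?C s y'"
    then show "y = y'" using ord_linear[of y y'] by blast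
  qed
  have dC: "dfn [g] (\<lambda>v. ?C (v 0) (v 1))"
    by (rule dfn_intros dfn_subst2[OF dW'] | (rule dft_const, simp; fail))+
  have ex: "\<exists>y. ?C s y" if "rseq ?C s b" for s b
  proof -
    have o: "is_ordinal u" if "u \<epsilon> rng s" for u
      using \<open>rseq ?C s b\<close> that unfolding rseq_def mem_rng by blast
    have "\<exists>d. is_ordinal d \<and> (\<forall>u. u \<epsilon> rng s \<longrightarrow> W u d)"
    proof (rule collect_bound[OF dW])
      show "\<exists>d. is_ordinal d \<and> W u d" if "u \<epsilon> rng s" for u
        using W o[OF that] unfolding closing_def by blast
      show "W u e" if "u \<epsilon> rng s" "is_ordinal d" "is_ordinal e" "W u d" "d \<epsilon> e" for u d e
        using mono[OF that(4) o[OF that(1)] that(2) o[OF that(1)] that(3) subset_refl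
            ord_subset[OF that(3,5)]] .
    qed
    then obtain d where d: "is_ordinal d" "\<And>u. u \<epsilon> rng s \<Longrightarrow> W u d" by blast
    obtain d' where d': "is_ordinal d'" "\<And>u. u \<epsilon> rng s \<Longrightarrow> u \<epsilon> d'" using ord_bound[of "rng s"] o by blast
    obtain e where e: "is_ordinal e" "d \<epsilon> e" "d' \<epsilon> e" using ord_two_bound d(1) d'(1) by blast
    obtain e' where e': "is_ordinal e'" "e \<epsilon> e'" "g \<epsilon> e'" using ord_two_bound e(1) g0 by blast
    have de: "d \<epsilon> e'" "d' \<epsilon> e'" using e e' ord_trans by blast+
    have "W u e'" if "u \<epsilon> rng s" for u
      by (rule mono[OF d(2)[OF that] o[OF that] d(1) o[OF that] e'(1) subset_refl ord_subset[OF e'(1) de(1)]])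
    moreover have "u \<epsilon> e'" if "u \<epsilon> rng s" for u using d'(2)[OF that] de(2) ord_trans[OF e'(1)] by blast
    ultimately have P: "?P s e'" using e' by blast
    have dW2: "dfn [s, g] (\<lambda>v. W (v 0) (v 1))" by (rule dfn_mono[OF dW]) simp
    have "dfn [s, g] (\<lambda>v. ?P s (v 0))"
      by (rule dfn_intros dfn_subst2[OF dW2] | (rule dft_const, simp; fail))+
    then show ?thesis
    proof (rule ord_least[where P = "?P s", OF _ e'(1) P])
      fix m assume "?P s m" "\<And>z. z \<epsilon> m \<Longrightarrow> \<not> ?P s z"
      then have "?C s m" by blast
      then show "\<exists>y. ?C s y" by (rule exI[where P = "?C s" and x = m])
    qed
  qed
  have "\<exists>s. rseq ?C s om" by (rule rseq_exists[OF fC dC _ ord_om], rule ex, assumption)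
  then obtain s where s: "rseq ?C s om" ..
  have fs: "fn s om" using s unfolding rseq_def by blast
  have step: "?P (restr s n) (app s n)" if "n \<epsilon> om" for n using rseq_app[OF s that] by blast
  have mem: "app s n \<epsilon> rng s" if "n \<epsilon> om" for n unfolding mem_rng using app_eq[OF fs that] by blast
  have next': "app s n \<epsilon> app s (suc n) \<and> W (app s n) (app s (suc n))" if n: "n \<epsilon> om" for n
  proof -
    have "app s n \<epsilon> rng (restr s (suc n))" unfolding mem_rng using app_eq[OF fs n] by auto
    then show ?thesis using step[OF suc_om[OF n]] by blast
  qed
  let ?l = "bigU (rng s)"
  have l: "x \<epsilon> ?l \<longleftrightarrow> (\<exists>n. n \<epsilon> om \<and> x \<epsilon> app s n)" for x
  proof
    assume "x \<epsilon> ?l"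
    then obtain n y where n: "opair n y \<epsilon> s" "x \<epsilon> y" by (auto simp: mem_rng)
    then have "n \<epsilon> om" using fn_domD[OF fs] by blast
    then show "\<exists>n. n \<epsilon> om \<and> x \<epsilon> app s n" using n app_eq[OF fs] by metis
  qed (use mem in auto)
  have o: "is_ordinal (app s n)" if "n \<epsilon> om" for n using step[OF that] by blast
  have ol: "is_ordinal ?l"
  proof (rule ord_bigU)
    show "is_ordinal a" if "a \<epsilon> rng s" for a
      using s that unfolding rseq_def mem_rng by blast
  qed
  have "closed_under W ?l" unfolding closed_under_def
  proof (intro conjI allI impI)
    show "is_ordinal ?l" by (rule ol)
    show "\<exists>c. c \<epsilon> ?l" unfolding l using step[OF emp_om] emp_om by blast
    fix c assume "c \<epsilon> ?l"
    then obtain n where n: "n \<epsilon> om" "c \<epsilon> app s n" unfolding l by blast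
    note on = o[OF n(1)] and on' = o[OF suc_om[OF n(1)]] and oc = ord_elem[OF o[OF n(1)] n(2)]
    have "subset (suc c) (app s n)" using n(2) ord_trans[OF on _ n(2)] unfolding subset_def by auto
    then have "suc c \<epsilon> app s n \<or> suc c = app s n" using ord_subset_iff[OF ord_suc[OF oc] on] by blast
    then show "suc c \<epsilon> ?l"
    proof
      assume "suc c \<epsilon> app s n"
      then show ?thesis unfolding l using n(1) by blast
    next
      assume "suc c = app s n"
      then have "suc c \<epsilon> app s (suc n)" using next'[OF n(1)] by simp
      then show ?thesis unfolding l using suc_om[OF n(1)] by blast
    qed
    have "W c (app s (suc n))"
      using mono[OF conjunct2[OF next'[OF n(1)]] on on' oc on' ord_subset[OF on n(2)] subset_refl] .
    moreover have "app s (suc n) \<epsilon> ?l" unfolding l using next'[OF suc_om[OF n(1)]] n(1) suc_om by blast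
    ultimately show "\<exists>d. d \<epsilon> ?l \<and> W c d" by blast
  qed
  moreover have "g \<epsilon> ?l" unfolding l using step[OF emp_om] emp_om by blast
  ultimately show ?thesis by blast
qed

lemma V_limit_finite:
  fixes v :: "nat \<Rightarrow> 'a"
  assumes l: "closed_under W l" and v: "\<And>j. v j \<epsilon> V l"
  shows "\<exists>c. c \<epsilon> l \<and> (\<forall>j<n. v j \<epsilon> V c)"
proof (induction n)
  case 0
  then show ?case using l unfolding closed_under_def by simp
next
  case (Suc n)
  have ol: "is_ordinal l" using l unfolding closed_under_def by blast
  obtain c where c: "c \<epsilon> l" "\<forall>j<n. v j \<epsilon> V c" using Suc by blast
  obtain b where b: "b \<epsilon> l" "subset (v n) (V b)" using v[of n] unfolding mem_V[OF ol] by blast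
  let ?d = "suc b"
  have d: "?d \<epsilon> l" using l b(1) unfolding closed_under_def by blast
  have od: "is_ordinal ?d" "is_ordinal c" using ord_elem[OF ol] d c(1) by blast+
  have vn: "v n \<epsilon> V ?d" unfolding mem_V[OF od(1)] using b(2) by auto
  have "\<exists>e. e \<epsilon> l \<and> subset c e \<and> subset ?d e \<and> is_ordinal e"
    using ord_linear[OF od] ord_subset[OF od(1), of c] ord_subset[OF od(2), of ?d] subset_refl d c(1) od by metis
  then obtain e where e: "e \<epsilon> l" "subset (V c) (V e)" "subset (V ?d) (V e)"
    using V_mono od by blast
  then have "v j \<epsilon> V e" if "j < Suc n" for j
    using that c(2) vn unfolding less_Suc_eq subset_def by blast
  then show ?case using e(1) by blast
qed

text \<open>The Tarski-Vaught criterion as a closing relation: whenever \<open>p\<close> has a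
  witness for parameters from \<open>V c\<close>, it has one in \<open>V d\<close>.\<close>

lemma closing_witness:
  assumes "\<And>j. j \<in> fv p \<Longrightarrow> j < n"
  shows "\<exists>W. closing W \<and> (\<forall>l v. closed_under W l \<longrightarrow> (\<forall>j. v j \<epsilon> V l) \<longrightarrow>
    (\<exists>a. sat (\<epsilon>) p (v(i := a))) \<longrightarrow> (\<exists>a. a \<epsilon> V l \<and> sat (\<epsilon>) p (v(i := a))))"
proof -
  \<comment> \<open>Assignments are internal functions \<open>g\<close> on \<open>om\<close>, with
    the value at \<open>i\<close> overridden by \<open>a\<close>.\<close>
  let ?S = "\<lambda>a g. sat (\<epsilon>) p (\<lambda>j. if j = i then a else app g (num j))"
  let ?Q = "\<lambda>g d. (\<exists>a. ?S a g) \<longrightarrow> (\<exists>a. a \<epsilon> V d \<and> ?S a g)"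
  let ?W = "\<lambda>c d. \<forall>g. g \<epsilon> funs om (V c) \<longrightarrow> ?Q g d"
  have dS: "dfn ps (\<lambda>v. ?S (s v) (t v))" if "dft ps s" "dft ps t" for ps s t
  proof -
    have "dft ps (if j = i then s else (\<lambda>v. app (t v) (num j)))" for j
      using that by (auto intro: dfn_intros)
    from dfn_comp[OF dfn_sat this, of p] show ?thesis
      by (rule back_subst[of "dfn ps"]) (auto intro!: sat_cong)
  qed
  have dQ: "dfn ps (\<lambda>v. ?Q (s v) (t v))" if "dft ps s" "dft ps t" for ps s t
    by (rule dfn_subst2[where P = ?Q, OF _ that]) (rule dfn_intros dS)+
  have mono: "?Q g e" if "is_ordinal d" "is_ordinal e" "subset d e" "?Q g d" for g d e
    using V_mono[OF that(2,3,1)] that(4) unfolding subset_def by blast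
  have "closing ?W" unfolding closing_def
  proof (intro conjI)
    show "dfn [] (\<lambda>v. ?W (v 0) (v 1))" by (rule dfn_intros dQ)+
    show "\<forall>c. is_ordinal c \<longrightarrow> (\<exists>d. is_ordinal d \<and> ?W c d)"
    proof (intro allI impI)
      fix c assume "is_ordinal c"
      show "\<exists>d. is_ordinal d \<and> ?W c d"
      proof (rule collect_bound)
        show "dfn [] (\<lambda>v. ?Q (v 0) (v 1))" by (rule dQ dft_var)+
        show "\<exists>d. is_ordinal d \<and> ?Q g d" for g
        proof (cases "\<exists>a. ?S a g")
          case True
          then obtain a where a: "?S a g" by blast
          obtain d where "is_ordinal d" "a \<epsilon> V d" using V_cover by blast
          then show ?thesis using a by blast
        next
          case False
          then show ?thesis using ord_emp by blast
        qed
        show "?Q g e" if "is_ordinal d" "is_ordinal e" "?Q g d" "d \<epsilon> e" for g d e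
          using mono[OF that(1,2) ord_subset[OF that(2,4)] that(3)] .
      qed
    qed
    show "\<forall>c d c' d'. is_ordinal c \<longrightarrow> is_ordinal d \<longrightarrow> is_ordinal c' \<longrightarrow> is_ordinal d' \<longrightarrow>
      ?W c d \<longrightarrow> subset c' c \<longrightarrow> subset d d' \<longrightarrow> ?W c' d'"
    proof (intro allI impI)
      fix c d c' d' g
      assume *: "is_ordinal c" "is_ordinal d" "is_ordinal c'" "is_ordinal d'" "?W c d" "subset c' c"
        "subset d d'" "g \<epsilon> funs om (V c')" "\<exists>a. ?S a g"
      have "g \<epsilon> funs om (V c)" using *(8) V_mono[OF *(1,6,3)]
        unfolding mem_funs is_function_iff subset_def by blast
      then have "?Q g d" using *(5) by blast
      from mono[OF *(2,4,7) this] show "\<exists>a. a \<epsilon> V d' \<and> ?S a g" using *(9) by blast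
    qed
  qed
  moreover have "\<exists>a. a \<epsilon> V l \<and> sat (\<epsilon>) p (v(i := a))"
    if l: "closed_under ?W l" and v: "\<And>j. v j \<epsilon> V l" and ex: "\<exists>a. sat (\<epsilon>) p (v(i := a))" for l v
  proof -
    \<comment> \<open>\<open>Suc n\<close> rather than \<open>n\<close> guarantees that
      \<open>v 0\<close>, the default value of \<open>w\<close> below, also lies in
      \<open>V c\<close>.\<close>
    from V_limit_finite[where v = v and n = "Suc n", OF l v]
    obtain c where c: "c \<epsilon> l" "\<forall>j<Suc n. v j \<epsilon> V c" by (elim exE conjE)
    from closed_underD[OF l c(1)] obtain d where d: "d \<epsilon> l" "?W c d" by (elim exE conjE)
    define w where "w j = (if j < n then v j else v 0)" for j
    have "w j \<epsilon> V c" for j unfolding w_def using c(2) by simp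
    from funs_om_finite_part[of w, OF this] obtain g where
      g: "g \<epsilon> funs om (V c)" "\<And>j. j < n \<Longrightarrow> app g (num j) = w j" by blast
    have S: "?S a g \<longleftrightarrow> sat (\<epsilon>) p (v(i := a))" for a
      by (rule sat_cong) (auto simp: g(2) w_def dest!: assms)
    have "\<exists>a. ?S a g" using ex S by blast
    then have "\<exists>a. a \<epsilon> V d \<and> ?S a g" using d(2) g(1) by blast
    then obtain a where a: "a \<epsilon> V d" "?S a g" by blast
    have ol: "is_ordinal l" using l unfolding closed_under_def by blast
    have "a \<epsilon> V l" using V_mono[OF ol ord_subset[OF ol d(1)] ord_elem[OF ol d(1)]] a(1)
      unfolding subset_def by blast
    then show ?thesis using a(2) unfolding S by blast
  qed
  ultimately show ?thesis by blast
qed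

text \<open>Atomic formulas and negation impose nothing new, conjunction combines two relations, and
  only the quantifier requires witnesses.\<close>

lemma closing_reflects: "\<exists>W. closing W \<and> (\<forall>l. closed_under W l \<longrightarrow> reflects \<phi> l)"
proof (induction \<phi>)
  case (Mem i j)
  have "closing (\<lambda>c d. True)" unfolding closing_def using dfn_bool by blast
  then show ?case unfolding reflects_def by auto
next
  case (Equ i j)
  have "closing (\<lambda>c d. True)" unfolding closing_def using dfn_bool by blast
  then show ?case unfolding reflects_def by auto
next
  case (Neg p)
  then show ?case unfolding reflects_def by auto
next
  case (Conj p q)
  then obtain W W' where W: "closing W" "\<And>l. closed_under W l \<Longrightarrow> reflects p l"
    "closing W'" "\<And>l. closed_under W' l \<Longrightarrow> reflects q l" by blast
  have "reflects (Conj p q) l" if "closed_under (\<lambda>c d. W c d \<and> W' c d) l" for l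
  proof -
    have "reflects p l" by (rule W(2), rule closed_under_weaken[OF that]) blast
    moreover have "reflects q l" by (rule W(4), rule closed_under_weaken[OF that]) blast
    ultimately show ?thesis unfolding reflects_def by simp
  qed
  then show ?case using closing_conj[OF W(1,3)] by blast
next
  case (Univ i p)
  then obtain W where W: "closing W" "\<And>l. closed_under W l \<Longrightarrow> reflects p l" by blast
  obtain n where n: "\<And>j. j \<in> fv (Neg p) \<Longrightarrow> j < n"
    using finite_fv[of "Neg p"] by (meson finite_nat_set_iff_bounded)
  \<comment> \<open>The criterion is used for \<open>Neg p\<close>: a counterexample to the
    universal statement must be found within \<open>V l\<close>.\<close>
  from closing_witness[where i = i, OF n] have "\<exists>W'. closing W' \<and> (\<forall>l v. closed_under W' l \<longrightarrow>
      (\<forall>j. v j \<epsilon> V l) \<longrightarrow> (\<exists>a. sat (\<epsilon>) (Neg p) (v(i := a))) \<longrightarrow>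
      (\<exists>a. a \<epsilon> V l \<and> sat (\<epsilon>) (Neg p) (v(i := a))))" .
  then obtain W' where W': "closing W'"
    "\<And>l v. closed_under W' l \<Longrightarrow> (\<And>j. v j \<epsilon> V l) \<Longrightarrow> \<exists>a. \<not> sat (\<epsilon>) p (v(i := a)) \<Longrightarrow>
      \<exists>a. a \<epsilon> V l \<and> \<not> sat (\<epsilon>) p (v(i := a))"
    unfolding sat.simps by (elim exE conjE) metis
  have "reflects (Univ i p) l" if l: "closed_under (\<lambda>c d. W c d \<and> W' c d) l" for l
    unfolding reflects_def
  proof (intro allI impI)
    fix v :: "nat \<Rightarrow> 'a" assume v: "\<forall>j. v j \<epsilon> V l"
    have p: "reflects p l" by (rule W(2), rule closed_under_weaken[OF l]) blast
    have l': "closed_under W' l" by (rule closed_under_weaken[OF l]) blast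
    have "rsat (V l) p (v(i := a)) \<longleftrightarrow> sat (\<epsilon>) p (v(i := a))" if "a \<epsilon> V l" for a
      using p v that unfolding reflects_def by simp
    then show "rsat (V l) (Univ i p) v \<longleftrightarrow> sat (\<epsilon>) (Univ i p) v"
      using W'(2)[OF l', of v] v by auto
  qed
  then show ?case using closing_conj[OF W(1) W'(1)] by blast
qed

text \<open>This is a schema, with one HOL formula at a time; the closing relation \<open>W\<close>
  depends on the formula.\<close>

theorem reflection:
  assumes "is_ordinal g"
  shows "\<exists>l. is_ordinal l \<and> g \<epsilon> l \<and> reflects \<phi> l"
proof -
  obtain W where W: "closing W" "\<And>l. closed_under W l \<Longrightarrow> reflects \<phi> l" using closing_reflects by blast
  obtain l where l: "closed_under W l" "g \<epsilon> l" using closing_point[OF W(1) assms] by blast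
  then show ?thesis using W(2)[OF l(1)] unfolding closed_under_def by blast
qed

section \<open>Indexing the ordinal definable sets\<close>

text \<open>Relations over \<open>L\<close> are coded as sets of assignments \<open>om \<rightarrow> L\<close>. The ordinal \<open>a\<close> selects the
  connective (membership, equality, nand, universal quantifier); \<open>b\<close> and \<open>c\<close> are variables or
  positions of earlier relations in the sequence \<open>s\<close>.\<close>

definition rel_step :: "'a \<Rightarrow> 'a \<Rightarrow> 'a \<Rightarrow> 'a \<Rightarrow> 'a \<Rightarrow> 'a \<Rightarrow> bool" where
  "rel_step L s a b c y \<longleftrightarrow>
     (a = num 0 \<and> b \<epsilon> om \<and> c \<epsilon> om \<and> (\<forall>g. g \<epsilon> y \<longleftrightarrow> g \<epsilon> funs om L \<and> app g b \<epsilon> app g c)) \<or>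
     (a = num 1 \<and> b \<epsilon> om \<and> c \<epsilon> om \<and> (\<forall>g. g \<epsilon> y \<longleftrightarrow> g \<epsilon> funs om L \<and> app g b = app g c)) \<or>
     (a = num 2 \<and> (\<forall>g. g \<epsilon> y \<longleftrightarrow> g \<epsilon> funs om L \<and> \<not> (g \<epsilon> app s b \<and> g \<epsilon> app s c))) \<or>
     (a = num 3 \<and> b \<epsilon> om \<and> (\<forall>g. g \<epsilon> y \<longleftrightarrow> g \<epsilon> funs om L \<and> (\<forall>x. x \<epsilon> L \<longrightarrow>
        (\<exists>h. h \<epsilon> app s c \<and> app h b = x \<and> (\<forall>j. j \<epsilon> om \<longrightarrow> j \<noteq> b \<longrightarrow> app h j = app g j)))))"

lemma dfn_rel_step: "dfn ps (\<lambda>v. rel_step (v 0) (v 1) (v 2) (v 3) (v 4) (v 5))"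
  unfolding rel_step_def by (rule dfn_intros)+

lemma rel_step_functional: "rel_step L s a b c y \<Longrightarrow> rel_step L s a b c y' \<Longrightarrow> y = y'"
  unfolding rel_step_def set_eq_iff[of y] by (elim disjE conjE) (simp_all del: num.simps)

lemma rel_step_bound: "rel_step L s a b c y \<Longrightarrow> y \<epsilon> Po (funs om L)"
  unfolding rel_step_def mem_Po subset_def by blast

text \<open>The sequence is closed under the connectives and so lists the relation of every HOL
  formula over \<open>L\<close>. It may list further relations if \<open>om\<close> is nonstandard,
  but it depends on \<open>L\<close> alone.\<close>

definition relseq :: "'a \<Rightarrow> 'a \<Rightarrow> bool" where
  "relseq L s \<longleftrightarrow> greedy (lexleast (rel_step L)) s"

lemma relseq_ex1: "\<exists>!s. relseq L s"
  unfolding relseq_def by (rule greedy_lexleast_exists[OF dfn_rel_step rel_step_functional rel_step_bound])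

lemma dfn_relseq0: "dfn ps (\<lambda>v. relseq (v 0) (v 1))"
  unfolding relseq_def by (rule dfn_intros dfn_rel_step)+

lemmas dfn_relseq [dfn_intros] = dfn_subst2[where P = relseq, OF dfn_relseq0]

lemma relseq_closed:
  "relseq L s \<Longrightarrow> is_ordinal b \<Longrightarrow> is_ordinal c \<Longrightarrow> rel_step L s (num i) b c y \<Longrightarrow> y \<epsilon> rng s"
  unfolding relseq_def using greedy_lexleast_closed[OF dfn_rel_step] om_ord[OF num_om] by blast

lemma relseq_index:
  assumes "relseq L s" "S \<epsilon> rng s"
  obtains b where "is_ordinal b" "opair b S \<epsilon> s" "app s b = S"
proof -
  obtain b where b: "opair b S \<epsilon> s" using assms(2) unfolding mem_rng by blast
  obtain k where k: "is_ordinal k" "fn s k" using assms(1) unfolding relseq_def greedy_def rseq_def by blast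
  then have "b \<epsilon> k" using fn_domD b by blast
  then show thesis using that b ord_elem k app_eq by metis
qed

lemma funs_comprehension:
  assumes "dfn ps (\<lambda>v. P (v 0))"
  obtains y where "\<And>g. g \<epsilon> y \<longleftrightarrow> g \<epsilon> funs om L \<and> P g"
  using comprehension[OF assms, of "funs om L"] by blast

lemma relseq_nand:
  assumes s: "relseq L s" and "S \<epsilon> rng s" "T \<epsilon> rng s"
  obtains U where "U \<epsilon> rng s" "\<And>g. g \<epsilon> U \<longleftrightarrow> g \<epsilon> funs om L \<and> \<not> (g \<epsilon> S \<and> g \<epsilon> T)"
proof -
  obtain b c where b: "is_ordinal b" "app s b = S" and c: "is_ordinal c" "app s c = T"
    using relseq_index[OF s] assms(2,3) by metis
  have "dfn [S, T] (\<lambda>v. \<not> (v 0 \<epsilon> S \<and> v 0 \<epsilon> T))" by (rule dfn_intros | (rule dft_const, simp; fail))+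
  from funs_comprehension[OF this, of L]
  obtain U where U: "\<And>g. g \<epsilon> U \<longleftrightarrow> g \<epsilon> funs om L \<and> \<not> (g \<epsilon> S \<and> g \<epsilon> T)" by blast
  then have "rel_step L s (num 2) b c U" unfolding rel_step_def b c by blast
  then show thesis using that relseq_closed[OF s b(1) c(1)] U by blast
qed

lemma relseq_all:
  assumes s: "relseq L s" and S: "S \<epsilon> rng s"
  obtains U where "U \<epsilon> rng s" "\<And>g. g \<epsilon> U \<longleftrightarrow> g \<epsilon> funs om L \<and> (\<forall>x. x \<epsilon> L \<longrightarrow>
    (\<exists>h. h \<epsilon> S \<and> app h (num i) = x \<and> (\<forall>j. j \<epsilon> om \<longrightarrow> j \<noteq> num i \<longrightarrow> app h j = app g j)))"
proof -
  obtain c where c: "is_ordinal c" "app s c = S" using relseq_index[OF s S] by blast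
  have "dfn [L, S] (\<lambda>v. \<forall>x. x \<epsilon> L \<longrightarrow>
    (\<exists>h. h \<epsilon> S \<and> app h (num i) = x \<and> (\<forall>j. j \<epsilon> om \<longrightarrow> j \<noteq> num i \<longrightarrow> app h j = app (v 0) j)))"
    by (rule dfn_intros | (rule dft_const, simp; fail))+
  from funs_comprehension[OF this, of L] obtain U where
    U: "\<And>g. g \<epsilon> U \<longleftrightarrow> g \<epsilon> funs om L \<and> (\<forall>x. x \<epsilon> L \<longrightarrow>
    (\<exists>h. h \<epsilon> S \<and> app h (num i) = x \<and> (\<forall>j. j \<epsilon> om \<longrightarrow> j \<noteq> num i \<longrightarrow> app h j = app g j)))" by blast
  then have "rel_step L s (num 3) (num i) c U" unfolding rel_step_def c using num_om by blast
  then show thesis using that relseq_closed[OF s om_ord[OF num_om] c(1)] U by blast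
qed

text \<open>Each HOL connective corresponds to one or two enumeration steps; negation and
  conjunction are expressed by nand.\<close>

lemma relseq_definable_sets:
  assumes s: "relseq L s"
  shows "\<exists>S. S \<epsilon> rng s \<and> (\<forall>g. g \<epsilon> S \<longleftrightarrow> g \<epsilon> funs om L \<and> rsat L \<phi> (\<lambda>i. app g (num i)))"
proof (induction \<phi>)
  case (Mem i j)
  have "dfn [] (\<lambda>v. app (v 0) (num i) \<epsilon> app (v 0) (num j))" by (rule dfn_intros)+
  from funs_comprehension[OF this, of L] obtain y where
    y: "\<And>g. g \<epsilon> y \<longleftrightarrow> g \<epsilon> funs om L \<and> app g (num i) \<epsilon> app g (num j)" by blast
  then have "rel_step L s (num 0) (num i) (num j) y" unfolding rel_step_def using num_om by blast
  then have "y \<epsilon> rng s" by (rule relseq_closed[OF s om_ord[OF num_om] om_ord[OF num_om]])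
  then show ?case unfolding rsat.simps using y by blast
next
  case (Equ i j)
  have "dfn [] (\<lambda>v. app (v 0) (num i) = app (v 0) (num j))" by (rule dfn_intros)+
  from funs_comprehension[OF this, of L] obtain y where
    y: "\<And>g. g \<epsilon> y \<longleftrightarrow> g \<epsilon> funs om L \<and> app g (num i) = app g (num j)" by blast
  then have "rel_step L s (num 1) (num i) (num j) y" unfolding rel_step_def using num_om by blast
  then have "y \<epsilon> rng s" by (rule relseq_closed[OF s om_ord[OF num_om] om_ord[OF num_om]])
  then show ?case unfolding rsat.simps using y by blast
next
  case (Neg p)
  then obtain S where S: "S \<epsilon> rng s" "\<And>g. g \<epsilon> S \<longleftrightarrow> g \<epsilon> funs om L \<and> rsat L p (\<lambda>i. app g (num i))"
    by blast
  obtain U where "U \<epsilon> rng s" "\<And>g. g \<epsilon> U \<longleftrightarrow> g \<epsilon> funs om L \<and> \<not> (g \<epsilon> S \<and> g \<epsilon> S)"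
    by (rule relseq_nand[OF s S(1) S(1)]) (rule that)
  then show ?case using S(2) by auto
next
  case (Conj p q)
  then obtain S T where S: "S \<epsilon> rng s" "\<And>g. g \<epsilon> S \<longleftrightarrow> g \<epsilon> funs om L \<and> rsat L p (\<lambda>i. app g (num i))"
    and T: "T \<epsilon> rng s" "\<And>g. g \<epsilon> T \<longleftrightarrow> g \<epsilon> funs om L \<and> rsat L q (\<lambda>i. app g (num i))"
    by blast
  obtain U where U: "U \<epsilon> rng s" "\<And>g. g \<epsilon> U \<longleftrightarrow> g \<epsilon> funs om L \<and> \<not> (g \<epsilon> S \<and> g \<epsilon> T)"
    by (rule relseq_nand[OF s S(1) T(1)]) (rule that)
  obtain W where "W \<epsilon> rng s" "\<And>g. g \<epsilon> W \<longleftrightarrow> g \<epsilon> funs om L \<and> \<not> (g \<epsilon> U \<and> g \<epsilon> U)"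
    by (rule relseq_nand[OF s U(1) U(1)]) (rule that)
  then show ?case using S(2) T(2) U(2) by auto
next
  case (Univ i p)
  then obtain S where S: "S \<epsilon> rng s" "\<And>g. g \<epsilon> S \<longleftrightarrow> g \<epsilon> funs om L \<and> rsat L p (\<lambda>i. app g (num i))"
    by blast
  obtain U where U: "U \<epsilon> rng s" "\<And>g. g \<epsilon> U \<longleftrightarrow> g \<epsilon> funs om L \<and> (\<forall>x. x \<epsilon> L \<longrightarrow>
    (\<exists>h. h \<epsilon> S \<and> app h (num i) = x \<and> (\<forall>j. j \<epsilon> om \<longrightarrow> j \<noteq> num i \<longrightarrow> app h j = app g j)))"
    by (rule relseq_all[OF s S(1), of i]) (rule that)
  \<comment> \<open>Updating the internal assignment \<open>g\<close> at \<open>num i\<close>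
    matches updating its restriction to the numerals, which is all that \<open>rsat\<close>
    sees.\<close>
  have "(\<exists>h. h \<epsilon> S \<and> app h (num i) = x \<and> (\<forall>j. j \<epsilon> om \<longrightarrow> j \<noteq> num i \<longrightarrow> app h j = app g j)) \<longleftrightarrow>
      rsat L p ((\<lambda>j. app g (num j))(i := x))" if x: "x \<epsilon> L" and g: "g \<epsilon> funs om L" for x g
  proof -
    have eq: "(\<lambda>j. app h (num j)) = (\<lambda>j. app g (num j))(i := x)"
      if "app h (num i) = x" "\<forall>j. j \<epsilon> om \<longrightarrow> j \<noteq> num i \<longrightarrow> app h j = app g j" for h
      using that by (auto simp: fun_eq_iff)
    obtain h where h: "h \<epsilon> funs om L" "app h (num i) = x" "\<forall>j. j \<epsilon> om \<longrightarrow> j \<noteq> num i \<longrightarrow> app h j = app g j"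
      using funs_om_update[OF g x, of "num i"] num_om by metis
    show ?thesis
    proof
      assume "\<exists>h. h \<epsilon> S \<and> app h (num i) = x \<and> (\<forall>j. j \<epsilon> om \<longrightarrow> j \<noteq> num i \<longrightarrow> app h j = app g j)"
      then obtain h' where h': "h' \<epsilon> S" "app h' (num i) = x"
        "\<forall>j. j \<epsilon> om \<longrightarrow> j \<noteq> num i \<longrightarrow> app h' j = app g j" by blast
      show "rsat L p ((\<lambda>j. app g (num j))(i := x))"
        unfolding eq[OF h'(2,3), symmetric] using S(2) h'(1) by blast
    next
      assume "rsat L p ((\<lambda>j. app g (num j))(i := x))"
      then have "h \<epsilon> S" unfolding S(2) eq[OF h(2,3)] using h(1) by blast
      then show "\<exists>h. h \<epsilon> S \<and> app h (num i) = x \<and> (\<forall>j. j \<epsilon> om \<longrightarrow> j \<noteq> num i \<longrightarrow> app h j = app g j)"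
        using h by blast
    qed
  qed
  then have "g \<epsilon> U \<longleftrightarrow> g \<epsilon> funs om L \<and> rsat L (Univ i p) (\<lambda>i. app g (num i))" for g
    unfolding U(2) by auto
  then show ?case using U(1) by blast
qed

text \<open>\<open>def_index x b c r\<close>: the \<open>c\<close>-th parameter-free definable relation over the level \<open>V b\<close> defines
  \<open>r\<close> from \<open>x\<close>. The index \<open>(b, c)\<close> consists of ordinals, which makes the class of all such \<open>r\<close>
  well-ordered.\<close>

definition def_index :: "'a \<Rightarrow> 'a \<Rightarrow> 'a \<Rightarrow> 'a \<Rightarrow> bool" where
  "def_index x b c r \<longleftrightarrow> (\<exists>s S. relseq (V b) s \<and> opair c S \<epsilon> s \<and>
     (\<forall>y. (\<exists>g. g \<epsilon> S \<and> app g (num 0) = y \<and> app g (num 1) = x) \<longleftrightarrow> y = r))"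

lemma dfn_def_index0: "dfn ps (\<lambda>v. def_index (v 0) (v 1) (v 2) (v 3))"
  unfolding def_index_def by (rule dfn_intros)+

lemma dfn_def_index [dfn_intros]:
  "dft ps x \<Longrightarrow> dft ps b \<Longrightarrow> dft ps c \<Longrightarrow> dft ps r \<Longrightarrow> dfn ps (\<lambda>v. def_index (x v) (b v) (c v) (r v))"
  by (rule dfn_subst6[where P = "\<lambda>x b c r _ _. def_index x b c r", OF dfn_def_index0])

lemma def_index_functional:
  assumes "def_index x b c r" "def_index x b c r'"
  shows "r = r'"
proof -
  obtain s S where s: "relseq (V b) s" "opair c S \<epsilon> s"
    "\<And>y. (\<exists>g. g \<epsilon> S \<and> app g (num 0) = y \<and> app g (num 1) = x) \<longleftrightarrow> y = r"
    using assms(1) unfolding def_index_def by blast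
  obtain t T where t: "relseq (V b) t" "opair c T \<epsilon> t"
    "\<And>y. (\<exists>g. g \<epsilon> T \<and> app g (num 0) = y \<and> app g (num 1) = x) \<longleftrightarrow> y = r'"
    using assms(2) unfolding def_index_def by blast
  have "s = t" using s(1) t(1) relseq_ex1 by blast
  moreover obtain k where "fn s k" using s(1) unfolding relseq_def greedy_def rseq_def by blast
  ultimately have "S = T" using s(2) t(2) app_eq fn_domD by metis
  then show ?thesis using s(3) t(3) by blast
qed

section \<open>Indices for all OD sets\<close>

definition indexed :: "'a \<Rightarrow> 'a \<Rightarrow> bool" where
  "indexed x r \<longleftrightarrow> (\<exists>b c. is_ordinal b \<and> is_ordinal c \<and> def_index x b c r)"

text \<open>Reflecting the defining formula at a level that contains \<open>x\<close> and
  \<open>r\<close> turns truth in the universe into membership in a listed relation. The level and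
  the position in the list form the index.\<close>

lemma definable_indexed:
  assumes "definable_from [x] r"
  shows "indexed x r"
proof -
  obtain \<phi> where \<phi>: "fv \<phi> \<subseteq> {..1}" "\<And>y. sat (\<epsilon>) \<phi> ((!) [y, x]) \<longleftrightarrow> y = r"
    using assms unfolding definable_from_def by auto
  obtain b b' where b: "is_ordinal b" "x \<epsilon> V b" "is_ordinal b'" "r \<epsilon> V b'" using V_cover by metis
  obtain e where e: "is_ordinal e" "b \<epsilon> e" "b' \<epsilon> e" using ord_two_bound[OF b(1,3)] by blast
  obtain l where l: "is_ordinal l" "e \<epsilon> l" "reflects \<phi> l" using reflection[OF e(1)] by blast
  have "b \<epsilon> l" "b' \<epsilon> l" using ord_trans[OF l(1)] e l(2) by blast+
  then have xr: "x \<epsilon> V l" "r \<epsilon> V l"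
    using V_mono[OF l(1) ord_subset[OF l(1)]] b unfolding subset_def by blast+
  obtain s where s: "relseq (V l) s" using relseq_ex1 by blast
  obtain S where S: "S \<epsilon> rng s"
    "\<And>g. g \<epsilon> S \<longleftrightarrow> g \<epsilon> funs om (V l) \<and> rsat (V l) \<phi> (\<lambda>i. app g (num i))"
    using relseq_definable_sets[OF s] by blast
  obtain c where c: "is_ordinal c" "opair c S \<epsilon> s" using relseq_index[OF s S(1)] by blast
  have sat: "rsat (V l) \<phi> (\<lambda>i. app g (num i)) \<longleftrightarrow> app g (num 0) = r"
    if "g \<epsilon> funs om (V l)" "app g (num 1) = x" for g
  proof -
    have "rsat (V l) \<phi> (\<lambda>i. app g (num i)) \<longleftrightarrow> sat (\<epsilon>) \<phi> (\<lambda>i. app g (num i))"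
      using l(3) app_om_mem[OF that(1) num_om] unfolding reflects_def by simp
    also have "\<dots> \<longleftrightarrow> sat (\<epsilon>) \<phi> ((!) [app g (num 0), x])"
    proof (rule sat_cong)
      fix i assume "i \<in> fv \<phi>"
      then have "i = 0 \<or> i = 1" using \<phi>(1) by auto
      then show "app g (num i) = [app g (num 0), x] ! i" using that(2) by auto
    qed
    finally show ?thesis using \<phi>(2) by simp
  qed
  \<comment> \<open>An internal assignment with \<open>r\<close> and \<open>x\<close> in slots 0 and
    1 is needed for \<open>r\<close> to be produced by the listed relation at all.\<close>
  have "\<exists>g. g \<epsilon> funs om (V l) \<and> (\<forall>j<2. app g (num j) = (if j = 0 then r else x))"
    by (rule funs_om_finite_part) (use xr in auto)
  then obtain g where g: "g \<epsilon> funs om (V l)" "\<And>j. j < 2 \<Longrightarrow> app g (num j) = (if j = 0 then r else x)"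
    by blast
  from g(2)[of 0] g(2)[of 1] have g01: "app g (num 0) = r" "app g (num 1) = x" by simp_all
  have "(\<exists>g. g \<epsilon> S \<and> app g (num 0) = y \<and> app g (num 1) = x) \<longleftrightarrow> y = r" for y
    unfolding S(2) using sat g(1) g01 by blast
  then show ?thesis unfolding indexed_def def_index_def using l(1) c s by blast
qed

text \<open>An ordinal parameter can be traded for the least ordinal that still yields a witness.\<close>

lemma eliminate_ordinal_parameter:
  assumes G: "dfn ps (\<lambda>v. G (v 0))" and "definable_from (ps @ [a]) y" "is_ordinal a" "G y"
  shows "\<exists>z. definable_from ps z \<and> G z"
proof -
  obtain P where P: "dfn (ps @ [a]) (\<lambda>v. P (v 0))" "\<And>z. P z \<longleftrightarrow> z = y"
    using definable_fromE[OF assms(2)] by blast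
  have "dfn (a # ps) (\<lambda>v. P (v 0))" by (rule dfn_mono[OF P(1)]) auto
  from dfn_abs[OF this] obtain Q where
    Q: "dfn ps (\<lambda>v. Q (v 0) (\<lambda>i. v (Suc i)))" "\<And>v. Q a v \<longleftrightarrow> P (v 0)" by blast
  \<comment> \<open>\<open>e\<close> is a candidate in place of the ordinal parameter
    \<open>a\<close>; the remaining variables of \<open>Q\<close> are all set to
    \<open>z\<close>.\<close>
  define F where "F e z = Q e (\<lambda>_. z)" for e z
  have F: "dfn ps (\<lambda>v. F (v 0) (v 1))" unfolding F_def
    using dfn_rename[OF Q(1), of "\<lambda>i. if i = 0 then 0 else 1"] by simp
  note F' = dfn_subst2[OF F] dfn_subst1[OF G]
  let ?W = "\<lambda>e. \<exists>z. G z \<and> (\<forall>z'. F e z' \<longleftrightarrow> z' = z)"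
  have W: "dfn ps (\<lambda>v. ?W (v 0))" by (rule dfn_intros F')+
  have "?W a" using Q(2) P(2) assms(4) unfolding F_def by auto
  then obtain m where m: "is_ordinal m" "?W m" "\<And>e. e \<epsilon> m \<Longrightarrow> \<not> ?W e"
    by (rule ord_least[where P = ?W, OF W assms(3)]) (rule that)
  then obtain z where z: "G z" "\<And>z'. F m z' \<longleftrightarrow> z' = z" by blast
  \<comment> \<open>The formula itself describes the least ordinal \<open>m\<close>, which removes
    it from the parameters.\<close>
  let ?H = "\<lambda>z. \<exists>e. is_ordinal e \<and> ?W e \<and> (\<forall>d. d \<epsilon> e \<longrightarrow> \<not> ?W d) \<and> F e z"
  have "definable_from ps z"
  proof (rule definable_fromI[where P = ?H])
    show "dfn ps (\<lambda>v. ?H (v 0))" by (rule dfn_intros F' dfn_subst1[where P = ?W, OF W])+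
    have "e = m" if "is_ordinal e" "?W e" "\<forall>d. d \<epsilon> e \<longrightarrow> \<not> ?W d" for e
      using ord_linear[OF that(1) m(1)] m(2,3) that(2,3) by metis
    then show "?H z' \<longleftrightarrow> z' = z" for z' using m z(2) by metis
  qed
  then show ?thesis using z(1) by blast
qed

lemma eliminate_ordinal_parameters:
  assumes G: "dfn ps (\<lambda>v. G (v 0))"
  shows "definable_from (ps @ as) y \<Longrightarrow> (\<forall>a\<in>set as. is_ordinal a) \<Longrightarrow> G y \<Longrightarrow> \<exists>z. definable_from ps z \<and> G z"
proof (induction as arbitrary: y rule: rev_induct)
  case Nil
  then show ?case by auto
next
  case (snoc a as)
  have "dfn (ps @ as) (\<lambda>v. G (v 0))" by (rule dfn_mono[OF G]) auto
  then have "\<exists>z. definable_from (ps @ as) z \<and> G z"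
    using eliminate_ordinal_parameter[of "ps @ as" G a y] snoc.prems by auto
  then show ?case using snoc by auto
qed

text \<open>The elimination is applied to the property of having no index: an OD set without one
  would yield such a set definable from \<open>x\<close> alone, against
  \<open>definable_indexed\<close>.\<close>

theorem OD_indexed:
  assumes "OD [x] r"
  shows "indexed x r"
proof (rule ccontr)
  assume "\<not> indexed x r"
  obtain as where as: "\<forall>a\<in>set as. is_ordinal a" "definable_from ([x] @ as) r"
    using assms unfolding OD_def by blast
  have "dfn [x] (\<lambda>v. \<not> indexed x (v 0))" unfolding indexed_def
    by (rule dfn_intros | (rule dft_const, simp; fail))+
  from eliminate_ordinal_parameters[where G = "\<lambda>r. \<not> indexed x r", OF this as(2,1) \<open>\<not> indexed x r\<close>]
  show False using definable_indexed by blast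
qed

section \<open>Finite sets and ideals on omega\<close>

definition "cap a b = col (\<lambda>x. x \<epsilon> a \<and> x \<epsilon> b)"

lemma mem_cap [simp]: "x \<epsilon> cap a b \<longleftrightarrow> x \<epsilon> a \<and> x \<epsilon> b"
  unfolding cap_def
proof (rule mem_col_sub[where a = a and ps = "[a, b]"])
  show "dfn [a, b] (\<lambda>v. v 0 \<epsilon> a \<and> v 0 \<epsilon> b)" by (rule dfn_intros | (rule dft_const, simp; fail))+
qed blast

lemma dft_cap0: "dfn ps (\<lambda>v. v 0 = cap (v 1) (v 2))"
  unfolding set_eq_iff[of "v 0" for v] mem_cap by (rule dfn_intros)+

lemmas dft_cap [dfn_intros] = dft_fun2[where f = cap, OF dft_cap0]

lemma is_inter_iff: "is_inter z x y \<longleftrightarrow> z = cap x y"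
  by (simp add: is_inter_def set_eq_iff[of z])

lemma is_bijection_iff: "is_bijection f a b \<longleftrightarrow> fn f a \<and> (\<forall>x y. opair x y \<epsilon> f \<longrightarrow> y \<epsilon> b) \<and>
    (\<forall>x x' y. opair x y \<epsilon> f \<and> opair x' y \<epsilon> f \<longrightarrow> x = x') \<and> (\<forall>y. y \<epsilon> b \<longrightarrow> (\<exists>x. opair x y \<epsilon> f))"
  unfolding is_bijection_def is_injection_def is_function_iff pair_in_iff by blast

lemma dfn_is_bijection0: "dfn ps (\<lambda>v. is_bijection (v 0) (v 1) (v 2))"
  unfolding is_bijection_iff by (rule dfn_intros)+

lemmas dfn_is_bijection [dfn_intros] = dfn_subst3[where P = is_bijection, OF dfn_is_bijection0]

lemma is_finite_iff: "is_finite x \<longleftrightarrow> (\<exists>n f. n \<epsilon> om \<and> is_bijection f n x)"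
  unfolding is_finite_def by simp

lemma dfn_is_finite0: "dfn ps (\<lambda>v. is_finite (v 0))"
  unfolding is_finite_iff by (rule dfn_intros)+

lemmas dfn_is_finite [dfn_intros] = dfn_subst1[where P = is_finite, OF dfn_is_finite0]

lemma fin_emp: "is_finite emp"
proof -
  have "is_bijection emp emp emp" unfolding is_bijection_iff fn_def by simp
  then show ?thesis unfolding is_finite_iff using emp_om by blast
qed

lemma cup_absorb: "e \<epsilon> X \<Longrightarrow> cup X (upr e e) = X"
  by (subst set_eq_iff) auto

lemma fin_insert:
  assumes "is_finite X"
  shows "is_finite (cup X (upr e e))"
proof (cases "e \<epsilon> X")
  case True
  then show ?thesis using assms cup_absorb by simp
next
  case False
  obtain n f where n: "n \<epsilon> om" and f: "fn f n" "\<And>x y. opair x y \<epsilon> f \<Longrightarrow> y \<epsilon> X"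
    "\<And>x x' y. opair x y \<epsilon> f \<Longrightarrow> opair x' y \<epsilon> f \<Longrightarrow> x = x'" "\<And>y. y \<epsilon> X \<Longrightarrow> \<exists>x. opair x y \<epsilon> f"
    using assms unfolding is_finite_iff is_bijection_iff by blast
  let ?g = "cup f (upr (opair n e) (opair n e))"
  have g: "opair x y \<epsilon> ?g \<longleftrightarrow> opair x y \<epsilon> f \<or> x = n \<and> y = e" for x y by simp
  have nf: "\<not> opair n y \<epsilon> f" for y using fn_domD[OF f(1)] not_mem_self by blast
  have "fn ?g (suc n)" unfolding fn_def
  proof (intro conjI allI impI)
    fix p assume "p \<epsilon> ?g"
    then show "\<exists>x y. x \<epsilon> suc n \<and> p = opair x y" using f(1) unfolding fn_def by fastforce
  next
    fix x assume "x \<epsilon> suc n"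
    then have "x \<epsilon> n \<or> x = n" by simp
    then show "\<exists>!y. opair x y \<epsilon> ?g"
    proof
      assume x: "x \<epsilon> n"
      then have "x \<noteq> n" by auto
      then show ?thesis using f(1) x unfolding g fn_def by simp
    next
      assume "x = n"
      then show ?thesis unfolding g using nf by simp
    qed
  qed
  moreover have "y \<epsilon> cup X (upr e e)" if "opair x y \<epsilon> ?g" for x y
    using that f(2) unfolding g by auto
  moreover have "x = x'" if "opair x y \<epsilon> ?g" "opair x' y \<epsilon> ?g" for x x' y
    using that f(2,3) False nf unfolding g by blast
  moreover have "\<exists>x. opair x y \<epsilon> ?g" if "y \<epsilon> cup X (upr e e)" for y
    using that f(4) unfolding g by auto
  ultimately have "is_bijection ?g (suc n) (cup X (upr e e))" unfolding is_bijection_iff by blast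
  then show ?thesis unfolding is_finite_iff using suc_om[OF n] by blast
qed

lemma bijection_suc:
  assumes n: "n \<epsilon> om" and f: "is_bijection f (suc n) X"
  obtains Y e where "is_bijection (restr f n) n Y" "X = cup Y (upr e e)"
proof -
  have ff: "fn f (suc n)" "\<And>x y. opair x y \<epsilon> f \<Longrightarrow> y \<epsilon> X"
    "\<And>x x' y. opair x y \<epsilon> f \<Longrightarrow> opair x' y \<epsilon> f \<Longrightarrow> x = x'" "\<And>y. y \<epsilon> X \<Longrightarrow> \<exists>x. opair x y \<epsilon> f"
    using f unfolding is_bijection_iff by blast+
  define e where "e = app f n"
  have e: "opair n y \<epsilon> f \<longleftrightarrow> y = e" for y unfolding e_def using app_eq[OF ff(1), of n y] by simp
  have "dfn [e] (\<lambda>v. v 0 \<noteq> e)" by (rule dfn_intros | (rule dft_const, simp; fail))+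
  from comprehension[OF this, of X] obtain Y where Y: "\<And>y. y \<epsilon> Y \<longleftrightarrow> y \<epsilon> X \<and> y \<noteq> e" by blast
  have sub: "subset n (suc n)" by (simp add: subset_def)
  have "fn (restr f n) n" by (rule fn_restr[OF ff(1) sub])
  moreover have "y \<epsilon> Y" if "opair x y \<epsilon> restr f n" for x y
  proof -
    have "opair x y \<epsilon> f" "x \<epsilon> n" using that by simp_all
    moreover have "y \<noteq> e"
    proof
      assume "y = e"
      then have "x = n" using ff(3)[of x y n] e \<open>opair x y \<epsilon> f\<close> by blast
      then show False using \<open>x \<epsilon> n\<close> by simp
    qed
    ultimately show ?thesis unfolding Y using ff(2) by blast
  qed
  moreover have "x = x'" if "opair x y \<epsilon> restr f n" "opair x' y \<epsilon> restr f n" for x x' y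
    using that ff(3) by auto
  moreover have "\<exists>x. opair x y \<epsilon> restr f n" if "y \<epsilon> Y" for y
  proof -
    obtain x where x: "opair x y \<epsilon> f" using \<open>y \<epsilon> Y\<close> ff(4) unfolding Y by blast
    then have "x \<epsilon> suc n" "x \<noteq> n" using fn_domD[OF ff(1)] e that unfolding Y by blast+
    then show ?thesis using x by auto
  qed
  ultimately have "is_bijection (restr f n) n Y" unfolding is_bijection_iff by blast
  moreover have "e \<epsilon> X" using ff(2) e by blast
  then have "X = cup Y (upr e e)" by (subst set_eq_iff) (auto simp: Y)
  ultimately show thesis using that by blast
qed

text \<open>The induction runs over the length \<open>n\<close> in \<open>om\<close> of an
  enumeration, since finiteness is internal and \<open>n\<close> may be nonstandard.\<close>

lemma fin_induct:
  assumes P: "dfn ps (\<lambda>v. P (v 0))" and "P emp"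
    and step: "\<And>X e. is_finite X \<Longrightarrow> P X \<Longrightarrow> P (cup X (upr e e))" and "is_finite X"
  shows "P X"
proof -
  obtain n f where n: "n \<epsilon> om" "is_bijection f n X" using assms(4) unfolding is_finite_iff by blast
  let ?Q = "\<lambda>n. \<forall>X f. is_bijection f n X \<longrightarrow> P X"
  have "?Q n"
  proof (rule om_induct[where P = ?Q and ps = ps, OF _ _ _ n(1)])
    show "dfn ps (\<lambda>v. ?Q (v 0))" by (rule dfn_intros dfn_subst1[OF P])+
    have "X = emp" if "is_bijection f emp X" for X f
      using that unfolding is_bijection_iff fn_def by (subst set_eq_iff) fastforce
    then show "?Q emp" using assms(2) by blast
    fix n assume n: "n \<epsilon> om" "?Q n"
    show "?Q (suc n)"
    proof (intro allI impI)
      fix X f assume "is_bijection f (suc n) X"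
      then obtain Y e where Y: "is_bijection (restr f n) n Y" "X = cup Y (upr e e)"
        by (rule bijection_suc[OF n(1)]) (rule that)
      then have "is_finite Y" unfolding is_finite_iff using n(1) by blast
      then show "P X" unfolding Y(2) using step n(2) Y(1) by blast
    qed
  qed
  then show ?thesis using n(2) by blast
qed

lemma fin_subset:
  assumes "is_finite X" "subset Y X"
  shows "is_finite Y"
proof -
  let ?P = "\<lambda>X. \<forall>Y. subset Y X \<longrightarrow> is_finite Y"
  have "?P X"
  proof (rule fin_induct[where P = ?P and ps = "[]", OF _ _ _ assms(1)])
    show "dfn [] (\<lambda>v. ?P (v 0))" by (rule dfn_intros)+
    have "Y = emp" if "subset Y emp" for Y using that by (subst set_eq_iff) (simp add: subset_def)
    then show "?P emp" using fin_emp by blast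
    fix X e assume X: "?P X"
    show "?P (cup X (upr e e))"
    proof (intro allI impI)
      fix Y assume Y: "subset Y (cup X (upr e e))"
      show "is_finite Y"
      proof (cases "e \<epsilon> Y")
        case True
        have eq: "Y = cup (cap X Y) (upr e e)"
          using Y True by (subst set_eq_iff) (auto simp: subset_def)
        have "is_finite (cap X Y)" using X by (simp add: subset_def)
        then show ?thesis using fin_insert eq by metis
      next
        case False
        then have "subset Y X" using Y unfolding subset_def by auto
        then show ?thesis using X by blast
      qed
    qed
  qed
  then show ?thesis using assms(2) by blast
qed

lemma fin_cup:
  assumes "is_finite X" "is_finite Y"
  shows "is_finite (cup X Y)"
proof (rule fin_induct[where P = "\<lambda>X. is_finite (cup X Y)" and ps = "[Y]", OF _ _ _ assms(1)])
  show "dfn [Y] (\<lambda>v. is_finite (cup (v 0) Y))" by (rule dfn_intros | (rule dft_const, simp; fail))+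
  have "cup emp Y = Y" by (subst set_eq_iff) simp
  then show "is_finite (cup emp Y)" using assms(2) by simp
  fix X e assume "is_finite (cup X Y)"
  moreover have "cup (cup X (upr e e)) Y = cup (cup X Y) (upr e e)" by (subst set_eq_iff) auto
  ultimately show "is_finite (cup (cup X (upr e e)) Y)" using fin_insert by simp
qed

lemma fin_om: "n \<epsilon> om \<Longrightarrow> is_finite n"
proof (rule om_induct[where P = is_finite, OF dfn_is_finite0])
  show "is_finite (suc n)" if "is_finite n" for n unfolding suc_def by (rule fin_insert[OF that])
qed (rule fin_emp)

lemma fin_image:
  assumes "is_finite X" and Q: "dfn ps (\<lambda>v. Q (v 0) (v 1))"
    and fQ: "\<And>x y y'. Q x y \<Longrightarrow> Q x y' \<Longrightarrow> y = y'"
  shows "\<exists>Y. is_finite Y \<and> (\<forall>x y. x \<epsilon> X \<and> Q x y \<longrightarrow> y \<epsilon> Y)"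
proof -
  let ?P = "\<lambda>X. \<exists>Y. is_finite Y \<and> (\<forall>x y. x \<epsilon> X \<and> Q x y \<longrightarrow> y \<epsilon> Y)"
  show "?P X"
  proof (rule fin_induct[where P = ?P and ps = ps, OF _ _ _ assms(1)])
    show "dfn ps (\<lambda>v. ?P (v 0))" by (rule dfn_intros dfn_subst2[OF Q])+
    show "?P emp" using fin_emp by auto
    fix X e assume "?P X"
    then obtain Y where Y: "is_finite Y" "\<And>x y. x \<epsilon> X \<Longrightarrow> Q x y \<Longrightarrow> y \<epsilon> Y" by blast
    show "?P (cup X (upr e e))"
    proof (cases "\<exists>y. Q e y")
      case True
      then obtain y where y: "Q e y" by blast
      have "z \<epsilon> cup Y (upr y y)" if "x \<epsilon> cup X (upr e e)" "Q x z" for x z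
        using that Y(2)[of x z] fQ[OF y, of z] by auto
      then show ?thesis using fin_insert[OF Y(1)] by blast
    next
      case False
      have "z \<epsilon> Y" if "x \<epsilon> cup X (upr e e)" "Q x z" for x z
        using that Y(2)[of x z] False by auto
      then show ?thesis using Y(1) by blast
    qed
  qed
qed

lemma fin_bounded:
  assumes "is_finite X" "subset X om"
  shows "\<exists>m. m \<epsilon> om \<and> subset X m"
proof -
  let ?P = "\<lambda>X. subset X om \<longrightarrow> (\<exists>m. m \<epsilon> om \<and> subset X m)"
  have "?P X"
  proof (rule fin_induct[where P = ?P and ps = "[]", OF _ _ _ assms(1)])
    show "dfn [] (\<lambda>v. ?P (v 0))" by (rule dfn_intros)+
    show "?P emp" using emp_om subset_refl by blast
    fix X e assume X: "?P X"
    show "?P (cup X (upr e e))"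
    proof
      assume sub: "subset (cup X (upr e e)) om"
      then have "subset X om" and e: "e \<epsilon> om" by (auto simp: subset_def)
      then obtain m where m: "m \<epsilon> om" "subset X m" using X by blast
      have om: "is_ordinal m" "is_ordinal e" "is_ordinal (suc e)" using m(1) e om_ord suc_om by blast+
      have "e \<epsilon> m \<or> subset m (suc e)"
        using ord_linear[OF om(1,2)] ord_subset[OF om(3), of m] ord_subset[OF om(3), of e] by auto
      then show "\<exists>m. m \<epsilon> om \<and> subset (cup X (upr e e)) m"
      proof
        assume "e \<epsilon> m"
        then have "subset (cup X (upr e e)) m" using m(2) by (auto simp: subset_def)
        then show ?thesis using m(1) by blast
      next
        assume "subset m (suc e)"
        then have "subset (cup X (upr e e)) (suc e)" using m(2) by (auto simp: subset_def)
        then show ?thesis using suc_om[OF e] by blast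
      qed
    qed
  qed
  then show ?thesis using assms(2) by blast
qed

section \<open>Proper ideals and small sets\<close>

text \<open>Members \<open>n\<close> of \<open>om\<close> are initial segments; as every finite
  subset of \<open>om\<close> lies in one of them, the last clause puts all finite subsets into
  \<open>J\<close>.\<close>

definition ideal :: "'a \<Rightarrow> bool" where
  "ideal J \<longleftrightarrow> (\<forall>u. u \<epsilon> J \<longrightarrow> subset u om) \<and> (\<forall>u w. u \<epsilon> J \<and> subset w u \<longrightarrow> w \<epsilon> J) \<and>
     (\<forall>u w. u \<epsilon> J \<and> w \<epsilon> J \<longrightarrow> cup u w \<epsilon> J) \<and> \<not> om \<epsilon> J \<and> (\<forall>n. n \<epsilon> om \<longrightarrow> n \<epsilon> J)"

text \<open>For a MAD family this is the ideal generated by its members and the finite sets. The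
  present form avoids coding finite unions.\<close>

definition small :: "'a \<Rightarrow> 'a \<Rightarrow> bool" where
  "small A u \<longleftrightarrow> subset u om \<and>
     (\<exists>Z. is_finite Z \<and> (\<forall>a. a \<epsilon> A \<and> \<not> is_finite (cap a u) \<longrightarrow> a \<epsilon> Z))"

definition ideal_over :: "'a \<Rightarrow> 'a \<Rightarrow> bool" where
  "ideal_over A J \<longleftrightarrow> ideal J \<and> (\<forall>u. small A u \<longrightarrow> u \<epsilon> J)"

lemma dfn_ideal0: "dfn ps (\<lambda>v. ideal (v 0))"
  unfolding ideal_def by (rule dfn_intros)+

lemmas dfn_ideal [dfn_intros] = dfn_subst1[where P = ideal, OF dfn_ideal0]

lemma dfn_small0: "dfn ps (\<lambda>v. small (v 0) (v 1))"
  unfolding small_def by (rule dfn_intros)+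

lemmas dfn_small [dfn_intros] = dfn_subst2[where P = small, OF dfn_small0]

lemma dfn_ideal_over0: "dfn ps (\<lambda>v. ideal_over (v 0) (v 1))"
  unfolding ideal_over_def by (rule dfn_intros)+

lemmas dfn_ideal_over [dfn_intros] = dfn_subst2[where P = ideal_over, OF dfn_ideal_over0]

lemma idealD:
  assumes "ideal J"
  shows "u \<epsilon> J \<Longrightarrow> subset u om" "u \<epsilon> J \<Longrightarrow> subset w u \<Longrightarrow> w \<epsilon> J" "u \<epsilon> J \<Longrightarrow> w \<epsilon> J \<Longrightarrow> cup u w \<epsilon> J"
    "\<not> om \<epsilon> J" "n \<epsilon> om \<Longrightarrow> n \<epsilon> J"
  using assms unfolding ideal_def by blast+

lemma small_subset: "small A u \<Longrightarrow> subset w u \<Longrightarrow> small A w"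
proof -
  assume u: "small A u" "subset w u"
  then obtain Z where Z: "is_finite Z" "\<And>a. a \<epsilon> A \<Longrightarrow> \<not> is_finite (cap a u) \<Longrightarrow> a \<epsilon> Z"
    unfolding small_def by blast
  have "is_finite (cap a w)" if "is_finite (cap a u)" for a
    using fin_subset[OF that, of "cap a w"] u(2) by (simp add: subset_def)
  then have "a \<epsilon> Z" if "a \<epsilon> A" "\<not> is_finite (cap a w)" for a using that Z(2) by blast
  moreover have "subset w om" using u unfolding small_def subset_def by blast
  ultimately show ?thesis unfolding small_def using Z(1) by blast
qed

lemma small_cup:
  assumes "small A u" "small A w"
  shows "small A (cup u w)"
proof -
  obtain Z where Z: "is_finite Z" "\<And>a. a \<epsilon> A \<Longrightarrow> \<not> is_finite (cap a u) \<Longrightarrow> a \<epsilon> Z"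
    using assms(1) unfolding small_def by blast
  obtain Y where Y: "is_finite Y" "\<And>a. a \<epsilon> A \<Longrightarrow> \<not> is_finite (cap a w) \<Longrightarrow> a \<epsilon> Y"
    using assms(2) unfolding small_def by blast
  have "cap a (cup u w) = cup (cap a u) (cap a w)" for a by (subst set_eq_iff) auto
  then have "is_finite (cap a (cup u w))" if "is_finite (cap a u)" "is_finite (cap a w)" for a
    using fin_cup[OF that] by simp
  then have "a \<epsilon> cup Z Y" if "a \<epsilon> A" "\<not> is_finite (cap a (cup u w))" for a
    using that Z(2) Y(2) by auto
  moreover have "subset (cup u w) om" using assms unfolding small_def subset_def by simp
  ultimately show ?thesis unfolding small_def using fin_cup[OF Z(1) Y(1)] by blast
qed

lemma small_om: "n \<epsilon> om \<Longrightarrow> small A n"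
proof -
  assume n: "n \<epsilon> om"
  have "is_finite (cap a n)" for a
    using fin_subset[OF fin_om[OF n], of "cap a n"] by (simp add: subset_def)
  then show ?thesis unfolding small_def using om_subset[OF n] fin_emp by blast
qed

lemma almost_disjoint_family_iff: "almost_disjoint_family A \<longleftrightarrow> \<not> is_finite A \<and>
    (\<forall>a. a \<epsilon> A \<longrightarrow> subset a om \<and> \<not> is_finite a) \<and>
    (\<forall>a b. a \<epsilon> A \<and> b \<epsilon> A \<and> a \<noteq> b \<longrightarrow> is_finite (cap a b))"
  unfolding almost_disjoint_family_def is_inter_iff is_omega_iff by blast

lemma cap_om: "subset a om \<Longrightarrow> cap a om = a"
  by (subst set_eq_iff) (auto simp: subset_def)

text \<open>All members of \<open>A\<close> meet \<open>om\<close> in an infinite set, and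
  \<open>A\<close> is infinite.\<close>

lemma not_small_om:
  assumes "almost_disjoint_family A"
  shows "\<not> small A om"
proof
  assume "small A om"
  then obtain Z where Z: "is_finite Z" "\<And>a. a \<epsilon> A \<Longrightarrow> \<not> is_finite (cap a om) \<Longrightarrow> a \<epsilon> Z"
    unfolding small_def by blast
  have "subset A Z" unfolding subset_def
    using Z(2) assms cap_om unfolding almost_disjoint_family_iff by metis
  then show False using fin_subset[OF Z(1)] assms unfolding almost_disjoint_family_iff by blast
qed

lemma small_member:
  assumes "almost_disjoint_family A" "a \<epsilon> A"
  shows "small A a"
proof -
  have "is_finite (cup emp (upr a a))" by (rule fin_insert[OF fin_emp])
  moreover have "b \<epsilon> cup emp (upr a a)" if "b \<epsilon> A" "\<not> is_finite (cap b a)" for b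
    using that assms unfolding almost_disjoint_family_iff by auto
  ultimately show ?thesis using assms unfolding small_def almost_disjoint_family_iff by blast
qed

section \<open>The greedy family of OD sets and its ideal\<close>

text \<open>The parameter \<open>p\<close> of \<open>ideal_step\<close> codes the pair of \<open>x\<close> and the family \<open>A\<close>.\<close>

definition ideal_step :: "'a \<Rightarrow> 'a \<Rightarrow> 'a \<Rightarrow> 'a \<Rightarrow> 'a \<Rightarrow> 'a \<Rightarrow> bool" where
  "ideal_step p s a b c y \<longleftrightarrow> a = emp \<and> subset y om \<and> (\<exists>x A. p = opair x A \<and> def_index x b c y \<and>
     (\<exists>J. ideal_over A J \<and> subset (rng s) J \<and> y \<epsilon> J))"

lemma dfn_ideal_step: "dfn ps (\<lambda>v. ideal_step (v 0) (v 1) (v 2) (v 3) (v 4) (v 5))"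
  unfolding ideal_step_def by (rule dfn_intros)+

lemma ideal_step_functional: "ideal_step p s a b c y \<Longrightarrow> ideal_step p s a b c y' \<Longrightarrow> y = y'"
  unfolding ideal_step_def using def_index_functional by auto

lemma ideal_step_bound: "ideal_step p s a b c y \<Longrightarrow> y \<epsilon> Po om"
  unfolding ideal_step_def by simp

text \<open>A set is listed when it has an index and some ideal over \<open>A\<close> contains it
  together with everything listed before. Indices are pairs, so the first of the three ordinals
  required by \<open>lexleast\<close> is pinned to \<open>emp\<close>.\<close>

definition dseq :: "'a \<Rightarrow> 'a \<Rightarrow> 'a \<Rightarrow> bool" where
  "dseq x A s \<longleftrightarrow> greedy (lexleast (ideal_step (opair x A))) s"

lemma dseq_ex1: "\<exists>!s. dseq x A s"
  unfolding dseq_def by (rule greedy_lexleast_exists[OF dfn_ideal_step ideal_step_functional ideal_step_bound])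

lemma dfn_dseq0: "dfn ps (\<lambda>v. dseq (v 0) (v 1) (v 2))"
proof -
  have "dfn ps (\<lambda>v. greedy (lexleast (ideal_step (opair (v 0) (v 1)))) (v 2))"
    by (rule dfn_greedy[where C = "\<lambda>v. lexleast (ideal_step (opair (v 0) (v 1)))"]) (rule dfn_intros dfn_ideal_step)+
  then show ?thesis unfolding dseq_def .
qed

lemmas dfn_dseq [dfn_intros] = dfn_subst3[where P = dseq, OF dfn_dseq0]

lemma dseq_stage:
  assumes "rseq (lexleast (ideal_step (opair x A))) s k" "i \<epsilon> k"
  shows "subset (app s i) om" "\<not> app s i \<epsilon> rng (restr s i)"
    "\<exists>J. ideal_over A J \<and> subset (rng (restr s i)) J \<and> app s i \<epsilon> J"
proof -
  obtain a b c where "fresh (ideal_step (opair x A)) (restr s i) a b c (app s i)"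
    using rseq_app[OF assms] unfolding lexleast_def by blast
  then show "subset (app s i) om" "\<not> app s i \<epsilon> rng (restr s i)"
    "\<exists>J. ideal_over A J \<and> subset (rng (restr s i)) J \<and> app s i \<epsilon> J"
    unfolding fresh_def ideal_step_def by auto
qed

lemma dseq_maximal:
  assumes "dseq x A s" "indexed x y" "ideal_over A J" "subset (rng s) J" "y \<epsilon> J"
  shows "y \<epsilon> rng s"
proof -
  obtain b c where bc: "is_ordinal b" "is_ordinal c" "def_index x b c y"
    using assms(2) unfolding indexed_def by blast
  have "subset y om" using assms(3,5) idealD(1) unfolding ideal_over_def by blast
  then have "ideal_step (opair x A) s emp b c y" unfolding ideal_step_def using bc(3) assms(3-5) by blast
  then show ?thesis
    using greedy_lexleast_closed[OF dfn_ideal_step] assms(1) bc(1,2) ord_emp unfolding dseq_def by blast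
qed

text \<open>The witnesses of different stages are unrelated, so their union need not be an ideal.
  The intersections of all witnesses of a stage are canonical and increase with the stage.\<close>

lemma dseq_ideal:
  assumes A: "almost_disjoint_family A" and s: "dseq x A s"
  shows "\<exists>J. ideal_over A J \<and> subset (rng s) J"
proof -
  obtain k where k: "rseq (lexleast (ideal_step (opair x A))) s k" using s unfolding dseq_def greedy_def by blast
  then have ok: "is_ordinal k" and fs: "fn s k" unfolding rseq_def by auto
  define B where "B i I \<longleftrightarrow> ideal_over A I \<and> subset (rng (restr s i)) I \<and> app s i \<epsilon> I" for i I
  define G where "G u \<longleftrightarrow> small A u \<or> (\<exists>i. i \<epsilon> k \<and> (\<forall>I. B i I \<longrightarrow> u \<epsilon> I))" for u
  have "dfn [A, s, k] (\<lambda>v. G (v 0))" unfolding G_def B_def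
    by (rule dfn_intros | (rule dft_const, simp; fail))+
  from comprehension[OF this, of "Po om"] obtain J where
    J: "\<And>u. u \<epsilon> J \<longleftrightarrow> subset u om \<and> G u" by auto
  have exB: "\<exists>I. B i I" if "i \<epsilon> k" for i unfolding B_def by (rule dseq_stage(3)[OF k that])
  \<comment> \<open>A witness for a later stage is also a witness for every earlier one.\<close>
  have B_mono: "B i I" if "B j I" "i \<epsilon> j" "j \<epsilon> k" for i j I
  proof -
    have oj: "is_ordinal j" using ord_elem[OF ok that(3)] .
    have "i \<epsilon> k" using ord_trans[OF ok that(2,3)] .
    have sub: "subset (rng (restr s j)) I" "ideal_over A I" using that(1) unfolding B_def by auto
    have "y \<epsilon> rng (restr s j)" if "y \<epsilon> rng (restr s i)" for y
      using that ord_trans[OF oj _ \<open>i \<epsilon> j\<close>] unfolding mem_rng by auto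
    moreover have "app s i \<epsilon> rng (restr s j)" unfolding mem_rng
      using app_eq[OF fs \<open>i \<epsilon> k\<close>] that(2) by auto
    ultimately show ?thesis unfolding B_def using sub unfolding subset_def by blast
  qed
  have smallB: "u \<epsilon> I" if "small A u" "B i I" for u i I
    using that unfolding B_def ideal_over_def by blast
  have idB: "ideal I" if "B i I" for i I using that unfolding B_def ideal_over_def by blast
  have "ideal J" unfolding ideal_def
  proof (intro conjI allI impI)
    show "subset u om" if "u \<epsilon> J" for u using that unfolding J by blast
    fix u w assume "u \<epsilon> J \<and> subset w u"
    then have u: "subset u om" "G u" "subset w u" unfolding J by auto
    have "subset w om" using u(1,3) unfolding subset_def by blast
    moreover have "G w" using u(2,3) small_subset idealD(2)[OF idB] unfolding G_def by blast
    ultimately show "w \<epsilon> J" unfolding J by blast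
  next
    fix u w assume "u \<epsilon> J \<and> w \<epsilon> J"
    then have u: "subset u om" "G u" "subset w om" "G w" unfolding J by auto
    have cup: "G (cup u w)" if "i \<epsilon> k" "\<And>I. B i I \<Longrightarrow> u \<epsilon> I" "\<And>I. B i I \<Longrightarrow> w \<epsilon> I" for i
      using that idealD(3)[OF idB] unfolding G_def by blast
    have "G (cup u w)"
    proof (cases "small A u \<and> small A w")
      case True
      then show ?thesis using small_cup unfolding G_def by blast
    next
      case False
      \<comment> \<open>Unless both are small, the two sets can be placed at one common stage; a
        small set lies in every witness of every stage.\<close>
      have "\<exists>i. i \<epsilon> k \<and> (\<forall>I. B i I \<longrightarrow> u \<epsilon> I \<and> w \<epsilon> I)"
      proof (cases "small A u \<or> small A w")
        case True
        then show ?thesis using False u(2,4) smallB unfolding G_def by blast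
      next
        case False
        obtain i where i: "i \<epsilon> k" "\<And>I. B i I \<Longrightarrow> u \<epsilon> I" using u(2) False unfolding G_def by blast
        obtain j where j: "j \<epsilon> k" "\<And>I. B j I \<Longrightarrow> w \<epsilon> I" using u(4) False unfolding G_def by blast
        have "is_ordinal i" "is_ordinal j" using ord_elem[OF ok] i(1) j(1) by blast+
        then consider "i \<epsilon> j" | "i = j" | "j \<epsilon> i" using ord_linear by blast
        then show ?thesis
        proof cases
          case 1
          then show ?thesis using i j B_mono[OF _ 1 j(1)] by blast
        next
          case 2
          then show ?thesis using i j by blast
        next
          case 3
          then show ?thesis using i j B_mono[OF _ 3 i(1)] by blast
        qed
      qed
      then show ?thesis using cup by blast
    qed
    moreover have "subset (cup u w) om" using u(1,3) by (simp add: subset_def)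
    ultimately show "cup u w \<epsilon> J" unfolding J by blast
  next
    show "\<not> om \<epsilon> J"
    proof
      assume "om \<epsilon> J"
      then obtain i where i: "i \<epsilon> k" "\<And>I. B i I \<Longrightarrow> om \<epsilon> I"
        using not_small_om[OF A] unfolding J G_def by blast
      then show False using exB[OF i(1)] idealD(4)[OF idB] by blast
    qed
    show "n \<epsilon> J" if "n \<epsilon> om" for n
      using small_om[OF that] om_subset[OF that] unfolding J G_def by blast
  qed
  moreover have "u \<epsilon> J" if "small A u" for u
    using that unfolding J G_def small_def by blast
  moreover have "d \<epsilon> J" if "d \<epsilon> rng s" for d
  proof -
    obtain i where i: "opair i d \<epsilon> s" using \<open>d \<epsilon> rng s\<close> unfolding mem_rng by blast
    then have ik: "i \<epsilon> k" using fn_domD[OF fs] by blast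
    then have d: "d = app s i" using app_eq[OF fs] i by blast
    then have "subset d om" using dseq_stage(1)[OF k ik] by simp
    moreover have "G d" unfolding G_def B_def d using ik by blast
    ultimately show ?thesis unfolding J by blast
  qed
  ultimately show ?thesis unfolding ideal_over_def subset_def by blast
qed

lemma dseq_inj:
  assumes k: "rseq (lexleast (ideal_step (opair x A))) s k" and "opair i y \<epsilon> s" "opair j y \<epsilon> s"
  shows "i = j"
proof -
  have ok: "is_ordinal k" and fs: "fn s k" using k unfolding rseq_def by auto
  have less: False if "i \<epsilon> j" "opair i y \<epsilon> s" "opair j y \<epsilon> s" for i j
  proof -
    have "j \<epsilon> k" using fn_domD[OF fs that(3)] .
    then have "app s j = y" using app_eq[OF fs \<open>j \<epsilon> k\<close>, of y] that(3) by simp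
    moreover have "y \<epsilon> rng (restr s j)" unfolding mem_rng using that(1,2) by auto
    ultimately show False using dseq_stage(2)[OF k \<open>j \<epsilon> k\<close>] by simp
  qed
  have "is_ordinal i" "is_ordinal j" using fn_domD[OF fs] assms(2,3) ord_elem[OF ok] by blast+
  then show ?thesis using ord_linear less assms(2,3) by blast
qed

section \<open>Countability of the enumeration and orthogonal sets\<close>

lemma is_countable_iff: "is_countable x \<longleftrightarrow> (\<exists>f. is_injection f x om)"
  unfolding is_countable_def by simp

lemma dfn_is_injection0: "dfn ps (\<lambda>v. is_injection (v 0) (v 1) (v 2))"
  unfolding is_injection_def pair_in_iff by (rule dfn_intros)+

lemmas dfn_is_injection [dfn_intros] = dfn_subst3[where P = is_injection, OF dfn_is_injection0]

text \<open>An uncountable length would be at least the least uncountable ordinal, and restricting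
  the enumeration to that ordinal would inject it into the power set of \<open>om\<close>.\<close>

lemma dseq_countable:
  assumes inacc: inaccessibility_axiom and k: "rseq (lexleast (ideal_step (opair x A))) s k"
  shows "is_countable k"
proof (rule ccontr)
  assume "\<not> is_countable k"
  have ok: "is_ordinal k" and fs: "fn s k" using k unfolding rseq_def by auto
  have "dfn [] (\<lambda>v. \<not> is_countable (v 0))" unfolding is_countable_iff by (rule dfn_intros)+
  then obtain m where m: "is_ordinal m" "\<not> is_countable m" "\<And>b. b \<epsilon> m \<Longrightarrow> \<not> \<not> is_countable b"
    by (rule ord_least[where P = "\<lambda>a. \<not> is_countable a", OF _ ok \<open>\<not> is_countable k\<close>]) (rule that)
  have "\<not> k \<epsilon> m" using m(3) \<open>\<not> is_countable k\<close> by blast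
  then have mk: "subset m k" using ord_linear[OF m(1) ok] ord_subset_iff[OF m(1) ok] by blast
  have "is_omega1 m" unfolding is_omega1_def using m by blast
  moreover have "is_injection (restr s m) m (Po om)"
    unfolding is_injection_def is_function_iff
  proof (intro conjI allI impI)
    show "fn (restr s m) m" by (rule fn_restr[OF fs mk])
    show "y \<epsilon> Po om" if "opair i y \<epsilon> restr s m" for i y
    proof -
      have "i \<epsilon> k" "opair i y \<epsilon> s" using that fn_domD[OF fs] by auto
      then show ?thesis using dseq_stage(1)[OF k] app_eq[OF fs] by auto
    qed
    show "i = j" if "pair_in i y (restr s m) \<and> pair_in j y (restr s m)" for i j y
      using that dseq_inj[OF k] by auto
  qed
  ultimately show False using inacc unfolding inaccessibility_axiom_def is_power_iff by auto
qed

text \<open>An infinite set almost disjoint from countably many members \<open>s i\<close> of an ideal: pick for every \<open>n\<close>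
  the least element, not below \<open>n\<close>, outside the union of those \<open>s i\<close> whose index under the
  injection \<open>e\<close> is below \<open>n\<close>.\<close>

lemma ideal_countable_orthogonal:
  assumes J: "ideal J" and s: "fn s k" "subset (rng s) J" and e: "is_injection e k om"
  shows "\<exists>z. subset z om \<and> \<not> is_finite z \<and> (\<forall>d. d \<epsilon> rng s \<longrightarrow> is_finite (cap z d))"
proof -
  have fe: "fn e k" "\<And>i n. opair i n \<epsilon> e \<Longrightarrow> n \<epsilon> om"
    "\<And>i j n. opair i n \<epsilon> e \<Longrightarrow> opair j n \<epsilon> e \<Longrightarrow> i = j"
    using e unfolding is_injection_def is_function_iff pair_in_iff by blast+
  define U where "U n m \<longleftrightarrow> (\<exists>i j d. opair i j \<epsilon> e \<and> j \<epsilon> n \<and> opair i d \<epsilon> s \<and> m \<epsilon> d)" for n m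
  have U: "dfn [s, e] (\<lambda>v. U (v 0) (v 1))" unfolding U_def
    by (rule dfn_intros | (rule dft_const, simp; fail))+
  note U' = dfn_subst2[OF U]
  \<comment> \<open>The union up to \<open>n\<close> stays inside a member of the ideal because,
    \<open>e\<close> being injective, each step adds at most one set.\<close>
  have UJ: "\<exists>u. u \<epsilon> J \<and> (\<forall>m. U n m \<longrightarrow> m \<epsilon> u)" if "n \<epsilon> om" for n
  proof (rule om_induct[where P = "\<lambda>n. \<exists>u. u \<epsilon> J \<and> (\<forall>m. U n m \<longrightarrow> m \<epsilon> u)" and ps = "[s, e, J]", OF _ _ _ that])
    have "dfn [s, e, J] (\<lambda>v. U (v 0) (v 1))" by (rule dfn_mono[OF U]) auto
    note U'' = dfn_subst2[OF this]
    show "dfn [s, e, J] (\<lambda>v. \<exists>u. u \<epsilon> J \<and> (\<forall>m. U (v 0) m \<longrightarrow> m \<epsilon> u))"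
      by (rule dfn_intros U'' | (rule dft_const, simp; fail))+
    have "\<not> U emp m" for m unfolding U_def by simp
    then show "\<exists>u. u \<epsilon> J \<and> (\<forall>m. U emp m \<longrightarrow> m \<epsilon> u)" using idealD(5)[OF J emp_om] by blast
    fix n assume n: "n \<epsilon> om" "\<exists>u. u \<epsilon> J \<and> (\<forall>m. U n m \<longrightarrow> m \<epsilon> u)"
    then obtain u where u: "u \<epsilon> J" "\<And>m. U n m \<Longrightarrow> m \<epsilon> u" by blast
    show "\<exists>u. u \<epsilon> J \<and> (\<forall>m. U (suc n) m \<longrightarrow> m \<epsilon> u)"
    proof (cases "\<exists>i d. opair i n \<epsilon> e \<and> opair i d \<epsilon> s")
      case True
      then obtain i d where id: "opair i n \<epsilon> e" "opair i d \<epsilon> s" by blast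
      have "d \<epsilon> J" using id(2) s(2) unfolding subset_def mem_rng by blast
      then have "cup u d \<epsilon> J" using idealD(3)[OF J u(1)] by blast
      moreover have "m \<epsilon> cup u d" if "U (suc n) m" for m
      proof -
        obtain i' j d' where *: "opair i' j \<epsilon> e" "j \<epsilon> suc n" "opair i' d' \<epsilon> s" "m \<epsilon> d'"
          using \<open>U (suc n) m\<close> unfolding U_def by blast
        show ?thesis
        proof (cases "j = n")
          case True
          then have "i' = i" using fe(3) *(1) id(1) by blast
          then have "d' = d" using app_eq[OF s(1) fn_domD[OF s(1) id(2)]] id(2) *(3) by metis
          then show ?thesis using *(4) by simp
        next
          case False
          then have "j \<epsilon> n" using *(2) by simp
          then have "U n m" unfolding U_def using * by blast
          then show ?thesis using u(2) by simp
        qed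
      qed
      ultimately show ?thesis by blast
    next
      case False
      have "U n m" if "U (suc n) m" for m
        using that False unfolding U_def mem_suc by blast
      then show ?thesis using u by blast
    qed
  qed
  define Q where "Q n p \<longleftrightarrow> p \<epsilon> om \<and> \<not> U n p \<and> \<not> p \<epsilon> n \<and> (\<forall>q. q \<epsilon> p \<longrightarrow> U n q \<or> q \<epsilon> n)" for n p
  have Q: "dfn [s, e] (\<lambda>v. Q (v 0) (v 1))" unfolding Q_def
    by (rule dfn_intros U' | (rule dft_const, simp; fail))+
  have exQ: "\<exists>p. Q n p" if n: "n \<epsilon> om" for n
  proof -
    obtain u where u: "u \<epsilon> J" "\<And>m. U n m \<Longrightarrow> m \<epsilon> u" using UJ[OF n] by blast
    have "cup u n \<epsilon> J" using idealD(3,5)[OF J] u(1) n by blast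
    then have "\<not> subset om (cup u n)" using idealD(2,4)[OF J] by blast
    then obtain p where p: "p \<epsilon> om" "\<not> p \<epsilon> u" "\<not> p \<epsilon> n" unfolding subset_def by auto
    let ?P = "\<lambda>p. \<not> U n p \<and> \<not> p \<epsilon> n"
    have "dfn [n, s, e] (\<lambda>v. U (v 0) (v 1))" by (rule dfn_mono[OF U]) auto
    note U'' = dfn_subst2[OF this]
    have "dfn [n, s, e] (\<lambda>v. ?P (v 0))" by (rule dfn_intros U'' | (rule dft_const, simp; fail))+
    moreover have "?P p" using p u(2) by blast
    ultimately obtain m where m: "is_ordinal m" "?P m" "\<And>q. q \<epsilon> m \<Longrightarrow> \<not> ?P q"
      using ord_least[where P = ?P, OF _ om_ord[OF p(1)]] by blast
    have "\<not> p \<epsilon> m" using m(3) \<open>?P p\<close> by blast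
    then have "m \<epsilon> p \<or> m = p" using ord_linear[OF m(1) om_ord[OF p(1)]] by blast
    then have "m \<epsilon> om" using om_trans p(1) by blast
    then show ?thesis unfolding Q_def using m by blast
  qed
  have Q_unique: "p = p'" if "Q n p" "Q n p'" for n p p'
  proof -
    have "is_ordinal p" "is_ordinal p'" using that om_ord unfolding Q_def by blast+
    then show ?thesis using ord_linear that unfolding Q_def by blast
  qed
  have "dfn [s, e] (\<lambda>v. \<exists>n. n \<epsilon> om \<and> Q n (v 0))"
    by (rule dfn_intros dfn_subst2[OF Q] | (rule dft_const, simp; fail))+
  from comprehension[OF this, of om] obtain z where
    z: "\<And>p. p \<epsilon> z \<longleftrightarrow> p \<epsilon> om \<and> (\<exists>n. n \<epsilon> om \<and> Q n p)" by blast
  have zom: "subset z om" unfolding subset_def z by blast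
  have "\<not> is_finite z"
  \<comment> \<open>The element picked at stage \<open>m\<close> is not below \<open>m\<close>, so
    no \<open>m\<close> bounds \<open>z\<close>.\<close>
  proof
    assume "is_finite z"
    then obtain m where m: "m \<epsilon> om" "subset z m" using fin_bounded zom by blast
    obtain p where p: "Q m p" using exQ[OF m(1)] by blast
    then have "p \<epsilon> z" unfolding z using m(1) unfolding Q_def by blast
    then show False using m(2) p unfolding Q_def subset_def by blast
  qed
  moreover have "is_finite (cap z d)" if d: "d \<epsilon> rng s" for d
  proof -
    obtain i where i: "opair i d \<epsilon> s" using d unfolding mem_rng by blast
    then have "i \<epsilon> k" using fn_domD[OF s(1)] by blast
    then obtain j where j: "opair i j \<epsilon> e" using app_eq[OF fe(1)] by blast
    then have jo: "j \<epsilon> om" using fe(2) by blast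
    \<comment> \<open>If \<open>j\<close> is below \<open>n\<close>, the set \<open>d\<close> is
      among those avoided at stage \<open>n\<close>; only the finitely many stages up to
      \<open>j\<close> can pick a member of \<open>d\<close>.\<close>
    have "\<exists>Y. is_finite Y \<and> (\<forall>n p. n \<epsilon> suc j \<and> Q n p \<longrightarrow> p \<epsilon> Y)"
      by (rule fin_image[OF fin_om[OF suc_om[OF jo]] Q]) (rule Q_unique)
    then obtain Y where Y: "is_finite Y" "\<And>n p. n \<epsilon> suc j \<Longrightarrow> Q n p \<Longrightarrow> p \<epsilon> Y" by blast
    have "p \<epsilon> Y" if "p \<epsilon> z" "p \<epsilon> d" for p
    proof -
      obtain n where n: "n \<epsilon> om" "Q n p" using \<open>p \<epsilon> z\<close> unfolding z by blast
      have "\<not> j \<epsilon> n" using n(2) i j \<open>p \<epsilon> d\<close> unfolding Q_def U_def by blast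
      then have "n \<epsilon> suc j" using ord_linear[OF om_ord[OF n(1)] om_ord[OF jo]] by auto
      then show ?thesis using Y(2) n(2) by blast
    qed
    then show ?thesis using fin_subset[OF Y(1), of "cap z d"] by (simp add: subset_def)
  qed
  ultimately show ?thesis using zom by blast
qed

lemma MAD_not_covered:
  assumes A: "MAD_family A" and s: "dseq x A s" and inacc: inaccessibility_axiom
  shows "\<exists>a. a \<epsilon> A \<and> (\<forall>d. d \<epsilon> rng s \<longrightarrow> \<not> subset a d)"
proof (rule ccontr)
  assume "\<not> ?thesis"
  then have cov: "\<exists>d. d \<epsilon> rng s \<and> subset a d" if "a \<epsilon> A" for a using that by blast
  have ad: "almost_disjoint_family A" using A unfolding MAD_family_def by blast
  obtain J where J: "ideal_over A J" "subset (rng s) J" using dseq_ideal[OF ad s] by blast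
  obtain k where k: "rseq (lexleast (ideal_step (opair x A))) s k" using s unfolding dseq_def greedy_def by blast
  then have fs: "fn s k" unfolding rseq_def by blast
  obtain e where "is_injection e k om" using dseq_countable[OF inacc k] unfolding is_countable_iff by blast
  then obtain z where z: "subset z om" "\<not> is_finite z" "\<And>d. d \<epsilon> rng s \<Longrightarrow> is_finite (cap z d)"
    using ideal_countable_orthogonal[OF _ fs J(2)] J(1) unfolding ideal_over_def by blast
  have za: "is_finite (cap z a)" if a: "a \<epsilon> A" for a
  proof -
    obtain d where d: "d \<epsilon> rng s" "subset a d" using cov[OF a] by blast
    have "subset (cap z a) (cap z d)" using d(2) by (simp add: subset_def)
    then show ?thesis using fin_subset z(3)[OF d(1)] by blast
  qed
  have az: "is_finite (cap a z)" if "a \<epsilon> A" for a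
  proof -
    have "cap a z = cap z a" by (subst set_eq_iff) auto
    then show ?thesis using za[OF that] by simp
  qed
  let ?B = "cup A (upr z z)"
  have "almost_disjoint_family ?B" unfolding almost_disjoint_family_iff
  proof (intro conjI allI impI)
    show "\<not> is_finite ?B"
    proof
      assume "is_finite ?B"
      then have "is_finite A" by (rule fin_subset) (simp add: subset_def)
      then show False using ad unfolding almost_disjoint_family_iff by blast
    qed
    fix a assume "a \<epsilon> ?B"
    then have "a \<epsilon> A \<or> a = z" by simp
    then show "subset a om" "\<not> is_finite a" using ad z(1,2) unfolding almost_disjoint_family_iff by blast+
  next
    fix a b assume "a \<epsilon> ?B \<and> b \<epsilon> ?B \<and> a \<noteq> b"
    then have "(a \<epsilon> A \<or> a = z) \<and> (b \<epsilon> A \<or> b = z) \<and> a \<noteq> b" by simp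
    then show "is_finite (cap a b)" using ad za az unfolding almost_disjoint_family_iff by blast
  qed
  moreover have "subset A ?B" by (simp add: subset_def)
  ultimately have "?B = A" using A unfolding MAD_family_def by blast
  moreover have "z \<epsilon> ?B" by simp
  ultimately have "z \<epsilon> A" by simp
  \<comment> \<open>As a member of \<open>A\<close>, the set \<open>z\<close> would have finite
    intersection with itself.\<close>
  from za[OF this] have "is_finite (cap z z)" .
  moreover have "cap z z = z" by (subst set_eq_iff) simp
  ultimately show False using z(2) by simp
qed

section \<open>Consequences of the independence axiom\<close>

lemma OD_comprehension:
  assumes "OD xs a" "\<And>p. p \<in> set ps \<Longrightarrow> OD xs p" and P: "dfn ps (\<lambda>v. P (v 0))"
  shows "\<exists>b. OD xs b \<and> (\<forall>x. x \<epsilon> b \<longleftrightarrow> x \<epsilon> a \<and> P x)"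
proof -
  obtain b where b: "\<And>x. x \<epsilon> b \<longleftrightarrow> x \<epsilon> a \<and> P x" using comprehension[OF P] by blast
  have "OD xs b"
  proof (rule OD_I[where ps = "a # ps" and P = "\<lambda>y. \<forall>x. x \<epsilon> y \<longleftrightarrow> x \<epsilon> a \<and> P x"])
    show "OD xs p" if "p \<in> set (a # ps)" for p using that assms(1,2) by auto
    have "dfn (a # ps) (\<lambda>v. P (v 0))" by (rule dfn_mono[OF P]) auto
    note P' = dfn_subst1[OF this]
    show "dfn (a # ps) (\<lambda>v. \<forall>x. x \<epsilon> v 0 \<longleftrightarrow> x \<epsilon> a \<and> P x)"
      by (rule dfn_intros P' | (rule dft_const, simp; fail))+
    show "(\<forall>x. x \<epsilon> y \<longleftrightarrow> x \<epsilon> a \<and> P x) \<longleftrightarrow> y = b" for y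
      using b by (subst set_eq_iff) simp
  qed
  then show ?thesis using b by blast
qed

lemma OD_om: "OD xs om"
  by (rule OD_ordinal[OF ord_om])

lemma OD_Po_om: "OD xs (Po om)"
  by (rule OD_I[where ps = "[]" and P = "\<lambda>y. y = Po om"]) (rule dfn_intros | simp)+

lemma OD_cart_Po_om: "OD xs (cart (Po om) (Po om))"
proof (rule OD_I[where ps = "[]" and P = "\<lambda>y. \<forall>p. p \<epsilon> y \<longleftrightarrow>
    (\<exists>a b. a \<epsilon> Po om \<and> b \<epsilon> Po om \<and> p = opair a b)"])
  show "dfn [] (\<lambda>v. \<forall>p. p \<epsilon> v 0 \<longleftrightarrow> (\<exists>a b. a \<epsilon> Po om \<and> b \<epsilon> Po om \<and> p = opair a b))"
    by (rule dfn_intros)+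
  show "(\<forall>p. p \<epsilon> y \<longleftrightarrow> (\<exists>a b. a \<epsilon> Po om \<and> b \<epsilon> Po om \<and> p = opair a b)) \<longleftrightarrow> y = cart (Po om) (Po om)" for y
    by (subst set_eq_iff) (simp only: mem_cart)
qed simp

lemma dfn_set_of_ordinals0: "dfn ps (\<lambda>v. set_of_ordinals (v 0))"
  unfolding set_of_ordinals_def by (rule dfn_intros)+

lemmas dfn_set_of_ordinals [dfn_intros] = dfn_subst1[where P = set_of_ordinals, OF dfn_set_of_ordinals0]

lemma set_of_ordinals_subset_om: "subset a om \<Longrightarrow> set_of_ordinals a"
  unfolding set_of_ordinals_def subset_def using om_ord by blast

lemma independence_relationD:
  assumes "independence_relation c R"
  shows "R x y0 y1 \<Longrightarrow> R x y1 y0"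
    and "set_of_ordinals y0' \<Longrightarrow> OD [x, y0] y0' \<Longrightarrow> R x y0 y1 \<Longrightarrow> R x y0' y1"
    and "set_of_ordinals x \<Longrightarrow> OD [x] A \<Longrightarrow> \<exists>y. y \<epsilon> A \<Longrightarrow> \<forall>y. y \<epsilon> A \<longrightarrow> set_of_ordinals y \<Longrightarrow>
      \<exists>y0 y1. y0 \<epsilon> A \<and> y1 \<epsilon> A \<and> R x y0 y1"
    and "R x y0 y1 \<Longrightarrow> OD [x] A \<Longrightarrow> opair y0 y1 \<epsilon> A \<Longrightarrow>
      \<exists>B0 B1. OD [x] B0 \<and> OD [x] B1 \<and> y0 \<epsilon> B0 \<and> y1 \<epsilon> B1 \<and>
        (\<forall>y0' y1'. y0' \<epsilon> B0 \<and> y1' \<epsilon> B1 \<and> R x y0' y1' \<longrightarrow> opair y0' y1' \<epsilon> A)"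
  using assms unfolding independence_relation_def pair_in_iff by (elim conjE; blast)+

lemma pair_codingE:
  assumes "pair_coding c"
  obtains C where "dfn [] (\<lambda>v. C (v 0) (v 1) (v 2))"
    "\<And>x y z. set_of_ordinals x \<Longrightarrow> set_of_ordinals y \<Longrightarrow> C x y z \<longleftrightarrow> z = c x y"
proof -
  obtain \<phi> where \<phi>: "fv \<phi> \<subseteq> {..<3}" "\<And>x y z. set_of_ordinals x \<Longrightarrow> set_of_ordinals y \<Longrightarrow>
      sat (\<epsilon>) \<phi> ((!) [x, y, z]) \<longleftrightarrow> z = c x y"
    using assms unfolding pair_coding_def by blast
  have "sat (\<epsilon>) \<phi> ((!) [v 0, v 1, v 2]) \<longleftrightarrow> sat (\<epsilon>) \<phi> v" for v
  proof (rule sat_cong)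
    fix i assume "i \<in> fv \<phi>"
    then have "i = 0 \<or> i = 1 \<or> i = 2" using \<phi>(1) by auto
    then show "[v 0, v 1, v 2] ! i = v i" by auto
  qed
  then have "dfn [] (\<lambda>v. sat (\<epsilon>) \<phi> ((!) [v 0, v 1, v 2]))" using dfn_sat by simp
  then show thesis by (rule that) (rule \<phi>(2))
qed

text \<open>Duplication for the set of codes of pairs from \<open>B \<times> D\<close>, followed by heredity.\<close>

lemma independent_members:
  assumes c: "pair_coding c" and R: "independence_relation c R" and x: "set_of_ordinals x"
    and B: "OD [x] B" "b \<epsilon> B" "\<And>b. b \<epsilon> B \<Longrightarrow> set_of_ordinals b"
    and D: "OD [x] D" "d \<epsilon> D" "\<And>d. d \<epsilon> D \<Longrightarrow> set_of_ordinals d"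
  shows "\<exists>b d. b \<epsilon> B \<and> d \<epsilon> D \<and> R x b d"
proof -
  obtain C where C: "dfn [] (\<lambda>v. C (v 0) (v 1) (v 2))"
    "\<And>x y z. set_of_ordinals x \<Longrightarrow> set_of_ordinals y \<Longrightarrow> C x y z \<longleftrightarrow> z = c x y"
    using pair_codingE[OF c] by blast
  have inj: "a = a' \<and> b = b'"
    if "c a b = c a' b'" "set_of_ordinals a" "set_of_ordinals b" "set_of_ordinals a'" "set_of_ordinals b'"
    for a b a' b' using c that unfolding pair_coding_def by blast
  have cs: "set_of_ordinals (c a b)" if "set_of_ordinals a" "set_of_ordinals b" for a b
    using c that unfolding pair_coding_def by blast
  have C': "dfn ps (\<lambda>v. C (s v) (t v) (u v))" if "dft ps s" "dft ps t" "dft ps u" for ps s t u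
    by (rule dfn_subst3[OF dfn_mono[OF C(1)] that]) simp
  \<comment> \<open>\<open>c\<close> is a HOL function without a certificate; the relation
    \<open>C\<close> has one and agrees with the graph of \<open>c\<close> on sets of
    ordinals.\<close>
  have "\<exists>E. \<forall>z. z \<epsilon> E \<longleftrightarrow> (\<exists>p. p \<epsilon> cart B D \<and> (\<exists>b d. p = opair b d \<and> C b d z))"
  proof (rule collection_image)
    show "dfn [] (\<lambda>v. \<exists>b d. v 0 = opair b d \<and> C b d (v 1))" by (rule dfn_intros C')+
    show "z = z'" if "p \<epsilon> cart B D" "\<exists>b d. p = opair b d \<and> C b d z" "\<exists>b d. p = opair b d \<and> C b d z'" for p z z'
      using that C(2) B(3) D(3) by (auto simp: mem_cart)
  qed
  then obtain E where E0: "\<And>z. z \<epsilon> E \<longleftrightarrow> (\<exists>p. p \<epsilon> cart B D \<and> (\<exists>b d. p = opair b d \<and> C b d z))"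
    by blast
  have E: "z \<epsilon> E \<longleftrightarrow> (\<exists>b d. b \<epsilon> B \<and> d \<epsilon> D \<and> C b d z)" for z
    unfolding E0 mem_cart by (auto; blast)
  have Ec: "z \<epsilon> E \<longleftrightarrow> (\<exists>b d. b \<epsilon> B \<and> d \<epsilon> D \<and> z = c b d)" for z
    unfolding E using C(2) B(3) D(3) by blast
  have "OD [x] E"
  proof (rule OD_I[where ps = "[B, D]" and P = "\<lambda>e. \<forall>z. z \<epsilon> e \<longleftrightarrow> (\<exists>b d. b \<epsilon> B \<and> d \<epsilon> D \<and> C b d z)"])
    show "OD [x] p" if "p \<in> set [B, D]" for p using that B(1) D(1) by auto
    show "dfn [B, D] (\<lambda>v. \<forall>z. z \<epsilon> v 0 \<longleftrightarrow> (\<exists>b d. b \<epsilon> B \<and> d \<epsilon> D \<and> C b d z))"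
      by (rule dfn_intros C' | (rule dft_const, simp; fail))+
    show "(\<forall>z. z \<epsilon> e \<longleftrightarrow> (\<exists>b d. b \<epsilon> B \<and> d \<epsilon> D \<and> C b d z)) \<longleftrightarrow> e = E" for e
      unfolding E[symmetric] by (rule set_eq_iff[symmetric])
  qed
  moreover have "\<exists>y. y \<epsilon> E" "\<forall>y. y \<epsilon> E \<longrightarrow> set_of_ordinals y"
    using B D cs unfolding Ec by blast+
  ultimately obtain e0 e1 where e: "e0 \<epsilon> E" "e1 \<epsilon> E" "R x e0 e1"
    using independence_relationD(3)[OF R x] by blast
  obtain b0 d0 where 0: "b0 \<epsilon> B" "d0 \<epsilon> D" "e0 = c b0 d0" using e(1) unfolding Ec by blast
  obtain b1 d1 where 1: "b1 \<epsilon> B" "d1 \<epsilon> D" "e1 = c b1 d1" using e(2) unfolding Ec by blast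
  note so = B(3)[OF 0(1)] D(3)[OF 0(2)] B(3)[OF 1(1)] D(3)[OF 1(2)]
  \<comment> \<open>The first coordinate of \<open>e0\<close> and the second of \<open>e1\<close>
    are kept, so that one member comes from \<open>B\<close> and the other from
    \<open>D\<close>.\<close>
  have "OD [x, e0] b0"
  proof (rule OD_I[where ps = "[e0]" and
        P = "\<lambda>y. set_of_ordinals y \<and> (\<exists>d. set_of_ordinals d \<and> C y d e0)"])
    show "OD [x, e0] p" if "p \<in> set [e0]" for p using that by (intro OD_parameter) auto
    show "dfn [e0] (\<lambda>v. set_of_ordinals (v 0) \<and> (\<exists>d. set_of_ordinals d \<and> C (v 0) d e0))"
      by (rule dfn_intros C' | (rule dft_const, simp; fail))+
    show "(set_of_ordinals y \<and> (\<exists>d. set_of_ordinals d \<and> C y d e0)) \<longleftrightarrow> y = b0" for y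
      using C(2) inj so 0(3) by metis
  qed
  then have "R x b0 e1" using independence_relationD(2)[OF R so(1)] e(3) by blast
  then have "R x e1 b0" by (rule independence_relationD(1)[OF R])
  moreover have "OD [x, e1] d1"
  proof (rule OD_I[where ps = "[e1]" and
        P = "\<lambda>y. set_of_ordinals y \<and> (\<exists>b. set_of_ordinals b \<and> C b y e1)"])
    show "OD [x, e1] p" if "p \<in> set [e1]" for p using that by (intro OD_parameter) auto
    show "dfn [e1] (\<lambda>v. set_of_ordinals (v 0) \<and> (\<exists>b. set_of_ordinals b \<and> C b (v 0) e1))"
      by (rule dfn_intros C' | (rule dft_const, simp; fail))+
    show "(set_of_ordinals y \<and> (\<exists>b. set_of_ordinals b \<and> C b y e1)) \<longleftrightarrow> y = d1" for y
      using C(2) inj so 1(3) by metis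
  qed
  ultimately have "R x d1 b0" using independence_relationD(2)[OF R so(4)] by blast
  then have "R x b0 d1" by (rule independence_relationD(1)[OF R])
  then show ?thesis using 0 1 by blast
qed

text \<open>The witness is the ideal generated by \<open>J\<close> and \<open>y\<close>; the
  hypothesis says exactly that it is proper.\<close>

lemma ideal_over_extend:
  assumes J: "ideal_over A J" and y: "subset y om" and proper: "\<And>j. j \<epsilon> J \<Longrightarrow> \<not> subset om (cup j y)"
  shows "\<exists>I. ideal_over A I \<and> subset J I \<and> y \<epsilon> I"
proof -
  have iJ: "ideal J" using J unfolding ideal_over_def by blast
  have "dfn [J, y] (\<lambda>v. \<exists>j. j \<epsilon> J \<and> subset (v 0) (cup j y))"
    by (rule dfn_intros | (rule dft_const, simp; fail))+
  from comprehension[OF this, of "Po om"] obtain I where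
    I: "\<And>u. u \<epsilon> I \<longleftrightarrow> subset u om \<and> (\<exists>j. j \<epsilon> J \<and> subset u (cup j y))" by auto
  have JI: "u \<epsilon> I" if "u \<epsilon> J" for u
  proof -
    have "subset u (cup u y)" by (simp add: subset_def)
    then show ?thesis unfolding I using idealD(1)[OF iJ] that by blast
  qed
  have "ideal I" unfolding ideal_def
  proof (intro conjI allI impI)
    show "subset u om" if "u \<epsilon> I" for u using that unfolding I by blast
    show "w \<epsilon> I" if "u \<epsilon> I \<and> subset w u" for u w using that unfolding I subset_def by blast
    show "cup u w \<epsilon> I" if "u \<epsilon> I \<and> w \<epsilon> I" for u w
    proof -
      obtain i j where ij: "i \<epsilon> J" "j \<epsilon> J" "subset u (cup i y)" "subset w (cup j y)"
        using \<open>u \<epsilon> I \<and> w \<epsilon> I\<close> unfolding I by blast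
      have "subset (cup u w) (cup (cup i j) y)" using ij(3,4) by (auto simp: subset_def)
      moreover have "subset (cup u w) om" using that unfolding I by (auto simp: subset_def)
      ultimately show ?thesis unfolding I using idealD(3)[OF iJ ij(1,2)] by blast
    qed
    show "\<not> om \<epsilon> I" using proper unfolding I by blast
    show "n \<epsilon> I" if "n \<epsilon> om" for n using JI idealD(5)[OF iJ that] .
  qed
  moreover have "u \<epsilon> I" if "small A u" for u using J JI that unfolding ideal_over_def by blast
  moreover have "y \<epsilon> I"
  proof -
    have "subset y (cup emp y)" by (simp add: subset_def)
    then show ?thesis unfolding I using y idealD(5)[OF iJ emp_om] by blast
  qed
  ultimately show ?thesis unfolding ideal_over_def subset_def using JI by blast
qed

text \<open>With \<open>B0\<close>, \<open>B1\<close> given by the product axiom for the diagonal, \<open>a\<close> is the union of the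
  subsets of \<open>om\<close> in \<open>B0 \<inter> B1\<close>: two that disagree at \<open>k\<close> would yield an independent off-diagonal pair.\<close>

lemma self_independent_OD:
  assumes c: "pair_coding c" and R: "independence_relation c R" and x: "set_of_ordinals x"
    and a: "subset a om" "R x a a"
  shows "OD [x] a"
proof -
  have no_parameters: "OD [x] p" if "p \<in> set []" for p using that by simp
  have "dfn [] (\<lambda>v. \<exists>b. v 0 = opair b b)" by (rule dfn_intros)+
  from OD_comprehension[OF OD_cart_Po_om no_parameters this]
  obtain E where E: "OD [x] E" "\<And>p. p \<epsilon> E \<longleftrightarrow> p \<epsilon> cart (Po om) (Po om) \<and> (\<exists>b. p = opair b b)"
    by blast
  have "opair a a \<epsilon> E" unfolding E using a(1) by simp
  then obtain B0 B1 where B: "OD [x] B0" "OD [x] B1" "a \<epsilon> B0" "a \<epsilon> B1"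
    "\<And>b d. b \<epsilon> B0 \<Longrightarrow> d \<epsilon> B1 \<Longrightarrow> R x b d \<Longrightarrow> opair b d \<epsilon> E"
    using independence_relationD(4)[OF R a(2) E(1)] by blast
  have ODB: "OD [x] p" if "p \<in> set [B0, B1]" for p using that B(1,2) by auto
  have "dfn [B0, B1] (\<lambda>v. \<exists>b. b \<epsilon> B0 \<and> b \<epsilon> B1 \<and> subset b om \<and> v 0 \<epsilon> b)"
    by (rule dfn_intros | (rule dft_const, simp; fail))+
  from OD_comprehension[OF OD_om ODB this] obtain u where
    u: "OD [x] u" "\<And>k. k \<epsilon> u \<longleftrightarrow> k \<epsilon> om \<and> (\<exists>b. b \<epsilon> B0 \<and> b \<epsilon> B1 \<and> subset b om \<and> k \<epsilon> b)" by blast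
  have "k \<epsilon> a" if k: "k \<epsilon> u" for k
  proof (rule ccontr)
    assume ka: "\<not> k \<epsilon> a"
    obtain b where b: "k \<epsilon> om" "b \<epsilon> B0" "b \<epsilon> B1" "subset b om" "k \<epsilon> b" using k unfolding u by blast
    have ODk: "OD [x] p" if "p \<in> set [B0, B1, k]" for p
      using that B(1,2) OD_ordinal[OF om_ord[OF b(1)]] by auto
    have "dfn [B0, B1, k] (\<lambda>v. v 0 \<epsilon> B0 \<and> v 0 \<epsilon> B1 \<and> k \<epsilon> v 0)"
      by (rule dfn_intros | (rule dft_const, simp; fail))+
    from OD_comprehension[OF OD_Po_om ODk this] obtain P where
      P: "OD [x] P" "\<And>b. b \<epsilon> P \<longleftrightarrow> b \<epsilon> Po om \<and> b \<epsilon> B0 \<and> b \<epsilon> B1 \<and> k \<epsilon> b" by blast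
    have "dfn [B0, B1, k] (\<lambda>v. v 0 \<epsilon> B0 \<and> v 0 \<epsilon> B1 \<and> \<not> k \<epsilon> v 0)"
      by (rule dfn_intros | (rule dft_const, simp; fail))+
    from OD_comprehension[OF OD_Po_om ODk this] obtain N where
      N: "OD [x] N" "\<And>b. b \<epsilon> N \<longleftrightarrow> b \<epsilon> Po om \<and> b \<epsilon> B0 \<and> b \<epsilon> B1 \<and> \<not> k \<epsilon> b" by blast
    have bP: "b \<epsilon> P" unfolding P(2) using b by simp
    have aN: "a \<epsilon> N" unfolding N(2) using a(1) B(3,4) ka by simp
    \<comment> \<open>\<open>P\<close> and \<open>N\<close> are OD and inhabited by \<open>b\<close>
      and \<open>a\<close>, so they have independent members. The product axiom puts this pair on
      the diagonal, although its entries disagree at \<open>k\<close>.\<close>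
    have "\<exists>b d. b \<epsilon> P \<and> d \<epsilon> N \<and> R x b d"
      by (rule independent_members[OF c R x P(1) bP _ N(1) aN])
        (simp_all add: P(2) N(2) set_of_ordinals_subset_om)
    then obtain b' d where bd: "b' \<epsilon> P" "d \<epsilon> N" "R x b' d" by blast
    then have "opair b' d \<epsilon> E" using B(5) unfolding P(2) N(2) by blast
    then have "b' = d" unfolding E by auto
    then show False using bd(1,2) unfolding P(2) N(2) by blast
  qed
  moreover have "k \<epsilon> u" if "k \<epsilon> a" for k
    unfolding u using that a(1) B(3,4) unfolding subset_def by blast
  ultimately have "u = a" by (intro extensionality) blast
  then show ?thesis using u(1) by simp
qed

text \<open>Members of \<open>B0\<close> and \<open>B1\<close> need not be independent of each
  other. For a common point \<open>k\<close> of the unions, an independent pair is therefore chosen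
  among the members containing \<open>k\<close>; these form OD sets because \<open>k\<close> is an
  ordinal.\<close>

lemma independent_OD_separation:
  assumes c: "pair_coding c" and R: "independence_relation c R" and x: "set_of_ordinals x"
    and a: "subset a0 om" "subset a1 om" "R x a0 a1" and n: "n \<epsilon> om" "subset (cap a0 a1) n"
  shows "\<exists>u0 u1. OD [x] u0 \<and> OD [x] u1 \<and> subset a0 u0 \<and> subset a1 u1 \<and>
    subset u0 om \<and> subset u1 om \<and> subset (cap u0 u1) n"
proof -
  have ODn: "OD [x] p" if "p \<in> set [n]" for p using that OD_ordinal[OF om_ord[OF n(1)]] by simp
  have "dfn [n] (\<lambda>v. \<exists>b d. v 0 = opair b d \<and> subset (cap b d) n)"
    by (rule dfn_intros | (rule dft_const, simp; fail))+
  from OD_comprehension[OF OD_cart_Po_om ODn this] obtain E where E: "OD [x] E"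
    "\<And>p. p \<epsilon> E \<longleftrightarrow> p \<epsilon> cart (Po om) (Po om) \<and> (\<exists>b d. p = opair b d \<and> subset (cap b d) n)"
    by blast
  have "opair a0 a1 \<epsilon> E" unfolding E using a n(2) by simp
  then obtain B0 B1 where B: "OD [x] B0" "OD [x] B1" "a0 \<epsilon> B0" "a1 \<epsilon> B1"
    "\<And>b d. b \<epsilon> B0 \<Longrightarrow> d \<epsilon> B1 \<Longrightarrow> R x b d \<Longrightarrow> opair b d \<epsilon> E"
    using independence_relationD(4)[OF R a(3) E(1)] by blast
  \<comment> \<open>\<open>B0\<close> and \<open>B1\<close> may have members that are not subsets of
    \<open>om\<close>; only those that are enter the unions.\<close>
  have union: "\<exists>u. OD [x] u \<and> (\<forall>k. k \<epsilon> u \<longleftrightarrow> k \<epsilon> om \<and> (\<exists>b. b \<epsilon> B \<and> subset b om \<and> k \<epsilon> b))"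
    if "OD [x] B" for B
  proof -
    have "dfn [B] (\<lambda>v. \<exists>b. b \<epsilon> B \<and> subset b om \<and> v 0 \<epsilon> b)"
      by (rule dfn_intros | (rule dft_const, simp; fail))+
    moreover have "OD [x] p" if "p \<in> set [B]" for p using that \<open>OD [x] B\<close> by simp
    ultimately show ?thesis by (intro OD_comprehension[OF OD_om])
  qed
  obtain u0 where u0: "OD [x] u0" "\<And>k. k \<epsilon> u0 \<longleftrightarrow> k \<epsilon> om \<and> (\<exists>b. b \<epsilon> B0 \<and> subset b om \<and> k \<epsilon> b)"
    using union[OF B(1)] by blast
  obtain u1 where u1: "OD [x] u1" "\<And>k. k \<epsilon> u1 \<longleftrightarrow> k \<epsilon> om \<and> (\<exists>b. b \<epsilon> B1 \<and> subset b om \<and> k \<epsilon> b)"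
    using union[OF B(2)] by blast
  have members: "\<exists>P. OD [x] P \<and> (\<forall>b. b \<epsilon> P \<longleftrightarrow> b \<epsilon> Po om \<and> b \<epsilon> B \<and> k \<epsilon> b)"
    if "OD [x] B" "k \<epsilon> om" for B k
  proof -
    have "dfn [B, k] (\<lambda>v. v 0 \<epsilon> B \<and> k \<epsilon> v 0)" by (rule dfn_intros | (rule dft_const, simp; fail))+
    moreover have "OD [x] p" if "p \<in> set [B, k]" for p
      using that \<open>OD [x] B\<close> OD_ordinal[OF om_ord[OF \<open>k \<epsilon> om\<close>]] by auto
    ultimately show ?thesis by (intro OD_comprehension[OF OD_Po_om])
  qed
  have "k \<epsilon> n" if k: "k \<epsilon> u0" "k \<epsilon> u1" for k
  proof -
    obtain b0 where b0: "k \<epsilon> om" "b0 \<epsilon> B0" "subset b0 om" "k \<epsilon> b0" using k(1) unfolding u0 by blast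
    obtain b1 where b1: "b1 \<epsilon> B1" "subset b1 om" "k \<epsilon> b1" using k(2) unfolding u1 by blast
    obtain P where P: "OD [x] P" "\<And>b. b \<epsilon> P \<longleftrightarrow> b \<epsilon> Po om \<and> b \<epsilon> B0 \<and> k \<epsilon> b"
      using members[OF B(1) b0(1)] by blast
    obtain N where N: "OD [x] N" "\<And>b. b \<epsilon> N \<longleftrightarrow> b \<epsilon> Po om \<and> b \<epsilon> B1 \<and> k \<epsilon> b"
      using members[OF B(2) b0(1)] by blast
    have bP: "b0 \<epsilon> P" unfolding P(2) using b0 by simp
    have bN: "b1 \<epsilon> N" unfolding N(2) using b1 by simp
    have "\<exists>b d. b \<epsilon> P \<and> d \<epsilon> N \<and> R x b d"
      by (rule independent_members[OF c R x P(1) bP _ N(1) bN])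
        (simp_all add: P(2) N(2) set_of_ordinals_subset_om)
    then obtain b d where bd: "b \<epsilon> P" "d \<epsilon> N" "R x b d" by blast
    then have "opair b d \<epsilon> E" using B(5) unfolding P(2) N(2) by blast
    then have "subset (cap b d) n" unfolding E by auto
    then show ?thesis using bd(1,2) unfolding P(2) N(2) subset_def by simp
  qed
  then have "subset (cap u0 u1) n" by (simp add: subset_def)
  moreover have "subset a0 u0" "subset u0 om" unfolding subset_def u0
    using a(1) B(3) unfolding subset_def by blast+
  moreover have "subset a1 u1" "subset u1 om" unfolding subset_def u1
    using a(2) B(4) unfolding subset_def by blast+
  ultimately show ?thesis using u0(1) u1(1) by blast
qed

section \<open>Nonexistence of MAD families\<close>

theorem no_MAD_family:
  assumes c: "pair_coding c" and definability_axiom "independence_axiom c"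
    and inacc: inaccessibility_axiom
  shows "\<not> MAD_family A"
proof
  assume A: "MAD_family A"
  then have ad: "almost_disjoint_family A" unfolding MAD_family_def by blast
  then have Aom: "subset a om" if "a \<epsilon> A" for a using that unfolding almost_disjoint_family_iff by blast
  obtain R where R: "independence_relation c R" using assms(3) unfolding independence_axiom_def by blast
  obtain x where x: "set_of_ordinals x" "definable_from [x] A"
    using assms(2) unfolding definability_axiom_def by blast
  have ODA: "OD [x] A" unfolding OD_def by (rule exI[of _ "[]"]) (simp add: x(2))
  obtain s where s: "dseq x A s" using dseq_ex1 by blast
  \<comment> \<open>Uniqueness of the enumeration makes it definable from \<open>x\<close> and
    \<open>A\<close>.\<close>
  have ODs: "OD [x] s"
  proof (rule OD_I[where ps = "[x, A]" and P = "\<lambda>s. dseq x A s"])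
    show "OD [x] p" if "p \<in> set [x, A]" for p using that ODA OD_parameter[of x "[x]"] by auto
    show "dfn [x, A] (\<lambda>v. dseq x A (v 0))" by (rule dfn_intros | (rule dft_const, simp; fail))+
    show "dseq x A t \<longleftrightarrow> t = s" for t using s dseq_ex1 by blast
  qed
  obtain J where J: "ideal_over A J" "subset (rng s) J" using dseq_ideal[OF ad s] by blast
  have iJ: "ideal J" using J(1) unfolding ideal_over_def by blast
  have maximal: "u \<epsilon> rng s" if "OD [x] u" "ideal_over A I" "subset (rng s) I" "u \<epsilon> I" for u I
    using dseq_maximal[OF s OD_indexed] that by blast
  have ODp: "OD [x] p" if "p \<in> set [s]" for p using that ODs by auto
  have "dfn [s] (\<lambda>v. \<forall>d. d \<epsilon> rng s \<longrightarrow> \<not> subset (v 0) d)"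
    by (rule dfn_intros | (rule dft_const, simp; fail))+
  from OD_comprehension[OF ODA ODp this] obtain X where
    X: "OD [x] X" "\<And>a. a \<epsilon> X \<longleftrightarrow> a \<epsilon> A \<and> (\<forall>d. d \<epsilon> rng s \<longrightarrow> \<not> subset a d)" by blast
  have "\<exists>a. a \<epsilon> X" unfolding X using MAD_not_covered[OF A s inacc] .
  moreover have "\<forall>a. a \<epsilon> X \<longrightarrow> set_of_ordinals a"
    unfolding X using Aom set_of_ordinals_subset_om by blast
  ultimately obtain a0 a1 where a: "a0 \<epsilon> X" "a1 \<epsilon> X" "R x a0 a1"
    using independence_relationD(3)[OF R x(1) X(1)] by blast
  have aA: "a0 \<epsilon> A" "a1 \<epsilon> A" using a(1,2) unfolding X by auto
  show False
  proof (cases "a0 = a1")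
    case True
    then have "OD [x] a0" using self_independent_OD[OF c R x(1) Aom[OF aA(1)]] a(3) by simp
    \<comment> \<open>Members of \<open>A\<close> are small and hence lie in every ideal over
      \<open>A\<close>; this makes an OD member of \<open>A\<close> eligible for the family.\<close>
    moreover have "a0 \<epsilon> J" using J(1) small_member[OF ad aA(1)] unfolding ideal_over_def by blast
    ultimately have "a0 \<epsilon> rng s" using maximal J by blast
    then show False using a(1) subset_refl unfolding X by blast
  next
    case False
    then have "is_finite (cap a0 a1)" using ad aA unfolding almost_disjoint_family_iff by blast
    moreover have "subset (cap a0 a1) om" using Aom[OF aA(1)] by (simp add: subset_def)
    ultimately obtain n where n: "n \<epsilon> om" "subset (cap a0 a1) n" using fin_bounded by blast
    obtain u0 u1 where u: "OD [x] u0" "OD [x] u1" "subset a0 u0" "subset a1 u1"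
      "subset u0 om" "subset u1 om" "subset (cap u0 u1) n"
      using independent_OD_separation[OF c R x(1) Aom[OF aA(1)] Aom[OF aA(2)] a(3) n] by blast
    have cover: "\<exists>j. j \<epsilon> J \<and> subset om (cup j u)"
      if "OD [x] u" "subset u om" "subset a u" "a \<epsilon> X" for a u
    proof (rule ccontr)
      assume "\<not> ?thesis"
      then obtain I where I: "ideal_over A I" "subset J I" "u \<epsilon> I"
        using ideal_over_extend[OF J(1) \<open>subset u om\<close>] by blast
      have "subset (rng s) I" using J(2) I(2) unfolding subset_def by blast
      then have "u \<epsilon> rng s" using maximal \<open>OD [x] u\<close> I by blast
      then show False using that(3,4) unfolding X by blast
    qed
    obtain j0 where j0: "j0 \<epsilon> J" "subset om (cup j0 u0)" using cover[OF u(1,5,3) a(1)] by blast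
    obtain j1 where j1: "j1 \<epsilon> J" "subset om (cup j1 u1)" using cover[OF u(2,6,4) a(2)] by blast
    \<comment> \<open>A point outside \<open>j0\<close> and \<open>j1\<close> lies in both
      \<open>u0\<close> and \<open>u1\<close>, hence below \<open>n\<close>, so these three sets
      cover \<open>om\<close>.\<close>
    have "cup (cup j0 j1) n \<epsilon> J" using idealD(3,5)[OF iJ] j0(1) j1(1) n(1) by blast
    moreover have "subset om (cup (cup j0 j1) n)" unfolding subset_def
    proof (intro allI impI)
      fix m assume m: "m \<epsilon> om"
      have "m \<epsilon> j0 \<or> m \<epsilon> u0" "m \<epsilon> j1 \<or> m \<epsilon> u1" using m j0(2) j1(2) unfolding subset_def by auto
      moreover have "m \<epsilon> n" if "m \<epsilon> u0" "m \<epsilon> u1" using that u(7) unfolding subset_def by simp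
      ultimately show "m \<epsilon> cup (cup j0 j1) n" by auto
    qed
    ultimately show False using idealD(2,4)[OF iJ] by blast
  qed
qed

end

theorem theorem4p1:
  fixes mem :: "'a \<Rightarrow> 'a \<Rightarrow> bool"
    and c :: "'a \<Rightarrow> 'a \<Rightarrow> 'a"
  assumes "ZF_DC mem"
    and "set_structure.pair_coding mem c"
    and "set_structure.definability_axiom mem"
    and "set_structure.independence_axiom mem c"
    and "set_structure.inaccessibility_axiom mem"
  shows "\<not> (\<exists>A. set_structure.MAD_family mem A)"
proof -
  interpret ZF mem using assms(1) by (rule ZF_DC.axioms(1))
  show ?thesis using no_MAD_family assms(2-5) by blast
qed

end
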